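(* Let $\mathfrak{F}\subset B(\mathcal{X})$ satisfy $L_b(\mathcal{X})\subset\mathfrak{F}$ and Hypothesis $(\mathbf{H_1})$. Then the following are equivalent: (i) $\Phi$ is mean ergodic with respect to $\mathfrak{F}$; (ii) $\Phi$ is Cesàro eventually continuous with respect to $\mathfrak{F}$ on $\mathcal{X}$, and there exists $z\in\mathcal{X}$ such that $\Phi$ satisfies the lower bound condition $(\mathcal{C}_2)$ at $z$; (iii) there exists $z\in\mathcal{X}$ such that $\Phi$ is Cesàro eventually continuous with respect to $\mathfrak{F}$ at $z$ and satisfies $(\mathcal{C}_2)$ at $z$.
   Context: Standing setting: $(\mathcal{X},\rho)$ is a Polish space; $\Phi=\{\Phi_t\}_{t\ge0}$ is a càdlàg Feller Markov process on $\mathcal{X}$ (hence strong Markov), realized as a Markov family with laws $\mathbb{P}^x$, expectations $\mathbb{E}^x$, and transition kernels $P_t(x,\cdot)$. $B(\mathcal{X})$ denotes Borel real functions, $L_b(\mathcal{X})$ bounded Lipschitz functions, $B(z,r)$ the open ball, $\langle f,\mu\rangle=\int f\,d\mu$. Let $\mathcal{A}=\{f\in B(\mathcal{X}):\int|f(y)|P_t(x,dy)<\infty\ \forall x,t\}$; for $f\in\mathcal{A}$, $P_tf(x)=\int f\,dP_t(x,\cdot)$, $Q_tf(x)=\frac1t\int_0^tP_sf(x)ds$, $Q_t(x,\cdot)=\frac1t\int_0^tP_s(x,\cdot)ds$. Invariant measure: $\int P_t(x,\cdot)\mu(dx)=\mu$ for all $t$. Definitions: $\Phi$ is mean ergodic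 with respect to $\mathfrak{F}$ if it has a unique invariant probability measure $\mu$, $\mathfrak{F}\subset L^1(\mu)$, and $\lim_{t\to\infty}|Q_tf(x)-\langle f,\mu\rangle|=0$ for all $x$, $f\in\mathfrak F$. Lower bound condition $(\mathcal{C}_2)$ at $z$: for every $r>0$, $\inf_{x\in\mathcal X}\limsup_{t\to\infty}Q_t(x,B(z,r))>0$. For $\mathfrak{F}\subset\mathcal A$, $\Phi$ is Cesàro eventually continuous with respect to $\mathfrak{F}$ at $x$ if for every $f\in\mathfrak F$, $\limsup_{x'\to x}\limsup_{t\to\infty}|Q_tf(x')-Q_tf(x)|=0$; "on $\mathcal X$" means at every point. Uniform integrability of $\{\xi_t\}$: $\lim_{K\to\infty}\sup_t\mathbb{E}(|\xi_t|\chi_{\{|\xi_t|\ge K\}})=0$. Hypothesis $(\mathbf{H_1})$: for every $f\in\mathfrak F$ and $x\in\mathcal X$, $\{f(\Phi_t)\}_{t\ge0}$ is uniformly integrable under $\mathbb{P}^x$. *)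

theory Defs
  imports "HOL-Probability.Probability"
begin

definition nat_filt :: "'w measure \<Rightarrow> (real \<Rightarrow> 'w \<Rightarrow> 'a::topological_space) \<Rightarrow> real \<Rightarrow> 'w set set" where
  "nat_filt M Phi s = sigma_sets (space M)
      {Phi u -` B \<inter> space M | u B. 0 \<le> u \<and> u \<le> s \<and> B \<in> sets borel}"

definition Pk :: "('a \<Rightarrow> 'w measure) \<Rightarrow> (real \<Rightarrow> 'w \<Rightarrow> 'a::topological_space) \<Rightarrow> real \<Rightarrow> 'a \<Rightarrow> 'a measure" where
  "Pk Pr Phi t x = distr (Pr x) borel (Phi t)"

definition cadlag_feller_markov ::
  "'w measure \<Rightarrow> ('a \<Rightarrow> 'w measure) \<Rightarrow> (real \<Rightarrow> 'w \<Rightarrow> 'a::polish_space) \<Rightarrow> bool" where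
  "cadlag_feller_markov M Pr Phi \<longleftrightarrow>
     (\<forall>x. prob_space (Pr x) \<and> sets (Pr x) = sets M) \<and>
     (\<forall>t\<ge>0. Phi t \<in> M \<rightarrow>\<^sub>M borel) \<and>
     (\<forall>x. emeasure (Pr x) {\<omega>\<in>space M. Phi 0 \<omega> = x} = 1) \<and>
     \<comment> \<open>measurability of the kernels\<close>
     (\<forall>t\<ge>0. \<forall>B\<in>sets borel. (\<lambda>y. emeasure (Pk Pr Phi t y) B) \<in> borel_measurable borel) \<and>
     \<comment> \<open>Markov property w.r.t. the natural filtration\<close>
     (\<forall>x s t. 0 \<le> s \<longrightarrow> 0 \<le> t \<longrightarrow> (\<forall>A\<in>nat_filt M Phi s. \<forall>B\<in>sets borel.
        emeasure (Pr x) ({\<omega>\<in>space M. Phi (s + t) \<omega> \<in> B} \<inter> A)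
          = (\<integral>\<^sup>+\<omega>. emeasure (Pk Pr Phi t (Phi s \<omega>)) B * indicator A \<omega> \<partial>Pr x))) \<and>
     \<comment> \<open>Feller property\<close>
     (\<forall>t\<ge>0. \<forall>f::'a \<Rightarrow> real. continuous_on UNIV f \<and> bounded (range f) \<longrightarrow>
        continuous_on UNIV (\<lambda>y. \<integral>z. f z \<partial>Pk Pr Phi t y)) \<and>
     \<comment> \<open>cadlag paths\<close>
     (\<forall>\<omega>\<in>space M. \<forall>t\<ge>0. continuous (at_right t) (\<lambda>s. Phi s \<omega>) \<and>
        (t > 0 \<longrightarrow> (\<exists>l. ((\<lambda>s. Phi s \<omega>) \<longlongrightarrow> l) (at_left t))))"

definition Ptf :: "('a \<Rightarrow> 'w measure) \<Rightarrow> (real \<Rightarrow> 'w \<Rightarrow> 'a::topological_space) \<Rightarrow> real \<Rightarrow> ('a \<Rightarrow> real) \<Rightarrow> 'a \<Rightarrow> real" where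
  "Ptf Pr Phi t f x = (\<integral>y. f y \<partial>Pk Pr Phi t x)"

definition Qtf :: "('a \<Rightarrow> 'w measure) \<Rightarrow> (real \<Rightarrow> 'w \<Rightarrow> 'a::topological_space) \<Rightarrow> real \<Rightarrow> ('a \<Rightarrow> real) \<Rightarrow> 'a \<Rightarrow> real" where
  "Qtf Pr Phi t f x = (LINT s:{0..t}|lborel. Ptf Pr Phi s f x) / t"

definition invariant_prob :: "('a \<Rightarrow> 'w measure) \<Rightarrow> (real \<Rightarrow> 'w \<Rightarrow> 'a::topological_space) \<Rightarrow> 'a measure \<Rightarrow> bool" where
  "invariant_prob Pr Phi \<mu> \<longleftrightarrow> prob_space \<mu> \<and> sets \<mu> = sets borel \<and>
     (\<forall>t\<ge>0. \<forall>B\<in>sets borel. (\<integral>\<^sup>+x. emeasure (Pk Pr Phi t x) B \<partial>\<mu>) = emeasure \<mu> B)"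

definition mean_ergodic :: "('a \<Rightarrow> 'w measure) \<Rightarrow> (real \<Rightarrow> 'w \<Rightarrow> 'a::topological_space) \<Rightarrow> ('a \<Rightarrow> real) set \<Rightarrow> bool" where
  "mean_ergodic Pr Phi F \<longleftrightarrow> (\<exists>!\<mu>. invariant_prob Pr Phi \<mu>) \<and>
     (\<forall>\<mu>. invariant_prob Pr Phi \<mu> \<longrightarrow>
        (\<forall>f\<in>F. integrable \<mu> f) \<and>
        (\<forall>f\<in>F. \<forall>x. ((\<lambda>t. \<bar>Qtf Pr Phi t f x - (\<integral>y. f y \<partial>\<mu>)\<bar>) \<longlongrightarrow> 0) at_top))"

definition lower_bound_C2 :: "('a \<Rightarrow> 'w measure) \<Rightarrow> (real \<Rightarrow> 'w \<Rightarrow> 'a::metric_space) \<Rightarrow> 'a \<Rightarrow> bool" where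
  "lower_bound_C2 Pr Phi z \<longleftrightarrow> (\<forall>r>0.
     (INF x. Limsup at_top (\<lambda>t. ereal (Qtf Pr Phi t (indicator (ball z r)) x))) > 0)"

text \<open>Cesaro eventual continuity at x. The values are nonnegative, so "<= 0" is "= 0";
  at an isolated point the limsup over the (empty) punctured neighbourhood is vacuous.\<close>
definition cesaro_ev_cont_at :: "('a \<Rightarrow> 'w measure) \<Rightarrow> (real \<Rightarrow> 'w \<Rightarrow> 'a::topological_space) \<Rightarrow> ('a \<Rightarrow> real) set \<Rightarrow> 'a \<Rightarrow> bool" where
  "cesaro_ev_cont_at Pr Phi F x \<longleftrightarrow> (\<forall>f\<in>F.
     Limsup (at x) (\<lambda>x'. Limsup at_top (\<lambda>t. ereal \<bar>Qtf Pr Phi t f x' - Qtf Pr Phi t f x\<bar>)) \<le> 0)"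

definition hyp_H1 :: "('a \<Rightarrow> 'w measure) \<Rightarrow> (real \<Rightarrow> 'w \<Rightarrow> 'a) \<Rightarrow> ('a \<Rightarrow> real) set \<Rightarrow> bool" where
  "hyp_H1 Pr Phi F \<longleftrightarrow> (\<forall>f\<in>F. \<forall>x.
     ((\<lambda>K::real. SUP t\<in>{0..}. \<integral>\<^sup>+\<omega>. ennreal \<bar>f (Phi t \<omega>)\<bar> * indicator {\<omega>. \<bar>f (Phi t \<omega>)\<bar> \<ge> K} \<omega> \<partial>Pr x)
        \<longlongrightarrow> 0) at_top)"

definition bounded_lipschitz :: "('a::metric_space \<Rightarrow> real) set" where
  "bounded_lipschitz = {f. bounded (range f) \<and> (\<exists>L. L-lipschitz_on UNIV f)}"

end

theory Submission
  imports Defs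
begin

text \<open>
  Let \<open>g x = limsup \<bar>Q\<^sub>n f x - Q\<^sub>n f z\<bar>\<close>. Since \<open>g \<le> P\<^sub>s g\<close>, \<open>g\<close> is small near \<open>z\<close>, and from every point the
  process reaches each ball around \<open>z\<close> with a probability bounded below, \<open>g\<close> vanishes identically
  for every bounded Lipschitz \<open>f\<close>.

  This makes \<open>Q\<^sub>n z\<close> tight. Otherwise there are uniformly separated sets \<open>A\<^sub>k\<close>, with bumps \<open>h\<^sub>k\<close>, and
  times \<open>t\<^sub>k\<close> such that \<open>Q\<^bsub>t\<^sub>k\<^esub> h\<^sub>k z \<ge> e\<close>. All sums of the \<open>h\<^sub>k\<close> over subsets of the naturals are
  Lipschitz, so by Schur's gliding hump argument \<open>Q\<^bsub>t\<^sub>k\<^esub> h\<^sub>k x \<ge> e / 2\<close> eventually, for every \<open>x\<close>.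
  Baire's theorem on the set reachable from \<open>z\<close> makes this uniform on an open set \<open>U\<close>, which has
  positive upper density of visits by the Feller property and the lower bound condition. Hence
  \<open>Q\<^sub>t h\<^sub>k z\<close> is, for suitable large \<open>t\<close>, bounded below uniformly in \<open>k\<close>, contradicting
  \<open>\<Sum>\<^sub>k h\<^sub>k \<le> 1\<close>. A weak limit of \<open>Q\<^sub>n z\<close> is the unique invariant measure \<open>\<mu>\<close>.

  For \<open>f\<close> unbounded, the first step is repeated for the laws of the process killed on entering the
  ball around \<open>z\<close>, whose mass decays geometrically, the uniform integrability controlling the
  remainder. That \<open>f\<close> is \<open>\<mu>\<close>-integrable follows since \<open>Q\<^sub>n\<close> applied to an indicator converges in
  \<open>L\<^sup>1(\<mu>)\<close>, while \<open>Q\<^sub>n \<bar>f\<bar>\<close> is bounded pointwise.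
\<close>

section \<open>Bumps, bounded Lipschitz functions and averages\<close>

text \<open>Cesaro eventual continuity gives no information at finite times: how long it takes two
  averages to come close depends on both starting points, so the averages need not be equicontinuous
  in the starting point and no Arzela-Ascoli argument is at hand. The subset sums of bumps
  compensate for this by controlling a whole matrix of averages through single test functions, and
  Baire's theorem restores uniformity in the starting point, though only on an open piece of the
  reachable set. That is enough because the laws started at z are carried by this set. For unbounded
  f an iteration over starting points breaks down, since the modulus of uniform integrability varies
  with the point without any control. Initial laws sharing one modulus are followed instead, and
  their mass has to be tested at one deterministic time for the whole law. As f is merely Borel, its
  integrability cannot be obtained from weak convergence by semicontinuity. In the converse
  direction z may be any point of the support of the invariant measure.\<close>

definition bump :: "'a::metric_space set \<Rightarrow> real \<Rightarrow> 'a \<Rightarrow> real" where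
  "bump A e x = max 0 (1 - infdist x A / e)"

lemma bump_nonneg [simp]: "0 \<le> bump A e x"
  by (simp add: bump_def)

lemma bump_le_1 [simp]: "0 < e \<Longrightarrow> bump A e x \<le> 1"
  by (simp add: bump_def infdist_nonneg)

lemma bump_eq_1 [simp]: "x \<in> A \<Longrightarrow> bump A e x = 1"
  by (simp add: bump_def)

lemma bump_pos_iff: "0 < e \<Longrightarrow> 0 < bump A e x \<longleftrightarrow> infdist x A < e"
  by (auto simp: bump_def less_max_iff_disj field_simps)

lemma bump_diff_le:
  assumes "0 < e"
  shows "bump A e x - bump A e y \<le> dist x y / e"
proof -
  have "infdist y A \<le> infdist x A + dist x y"
    using infdist_triangle[of y A x] by (simp add: dist_commute)
  then have "infdist y A / e \<le> (infdist x A + dist x y) / e"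
    using assms by (intro divide_right_mono) auto
  then have "(1 - infdist x A / e) - (1 - infdist y A / e) \<le> dist x y / e"
    by (simp add: add_divide_distrib)
  then show ?thesis
    using assms unfolding bump_def by (smt (verit) divide_nonneg_pos zero_le_dist)
qed

lemma bounded_lipschitzI:
  assumes "\<And>x. \<bar>f x\<bar> \<le> C" "0 \<le> L" "\<And>x y. f x - f y \<le> L * dist x y"
  shows "f \<in> bounded_lipschitz"
proof -
  have "L-lipschitz_on UNIV f"
  proof (rule lipschitz_onI)
    fix x y :: 'a
    show "dist (f x) (f y) \<le> L * dist x y"
      using assms(3)[of x y] assms(3)[of y x] by (auto simp: dist_real_def dist_commute)
  qed fact
  moreover have "bounded (range f)"
    using assms(1) by (auto simp: bounded_iff)
  ultimately show ?thesis
    by (auto simp: bounded_lipschitz_def)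
qed

lemma bounded_lipschitzE:
  assumes "f \<in> bounded_lipschitz"
  obtains C L where "0 \<le> C" "\<And>x. \<bar>f x\<bar> \<le> C" "0 \<le> L" "\<And>x y. \<bar>f x - f y\<bar> \<le> L * dist x y"
proof -
  from assms obtain C where C: "\<And>x. \<bar>f x\<bar> \<le> C"
    by (auto simp: bounded_lipschitz_def bounded_iff)
  from assms obtain L where L: "L-lipschitz_on UNIV f"
    by (auto simp: bounded_lipschitz_def)
  show ?thesis
  proof (rule that)
    show "0 \<le> C" using C[of undefined] by linarith
    show "0 \<le> L" using L by (rule lipschitz_on_nonneg)
    show "\<bar>f x - f y\<bar> \<le> L * dist x y" for x y
      using lipschitz_onD[OF L, of x y] by (simp add: dist_real_def)
  qed (rule C)
qed

lemma bounded_lipschitz_continuous: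
  "f \<in> bounded_lipschitz \<Longrightarrow> continuous_on UNIV f"
  by (auto simp: bounded_lipschitz_def intro: lipschitz_on_continuous_on)

lemma bounded_lipschitz_measurable:
  "f \<in> bounded_lipschitz \<Longrightarrow> f \<in> borel_measurable borel"
  by (intro borel_measurable_continuous_onI bounded_lipschitz_continuous)

lemma bump_bounded_lipschitz: "0 < e \<Longrightarrow> bump A e \<in> bounded_lipschitz"
  by (rule bounded_lipschitzI[where C=1 and L="1/e"]) (use bump_diff_le[of e A] in auto)

lemma continuous_bump: "0 < e \<Longrightarrow> continuous_on UNIV (bump A e)"
  by (intro bounded_lipschitz_continuous bump_bounded_lipschitz)

text \<open>Nonemptiness matters: \<open>infdist x {}\<close> is 0 by convention, so the bump of the
  empty set is constantly 1.\<close>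

lemma bump_tendsto_indicator:
  assumes "closed C" "C \<noteq> {}"
  shows "(\<lambda>n. bump C (1 / real (Suc n)) x) \<longlonglongrightarrow> indicator C x"
proof (cases "x \<in> C")
  case False
  then have pos: "0 < infdist x C"
    using assms in_closed_iff_infdist_zero[of C x] infdist_nonneg[of x C] by auto
  obtain N where N: "1 / infdist x C < real N"
    using reals_Archimedean2 by blast
  have "\<forall>\<^sub>F n in sequentially. bump C (1 / real (Suc n)) x = 0"
  proof (rule eventually_sequentiallyI)
    fix n assume "N \<le> n"
    then have "1 / infdist x C < real (Suc n)" using N by linarith
    then have "1 < infdist x C * real (Suc n)" using pos by (simp add: field_simps)
    then show "bump C (1 / real (Suc n)) x = 0"
      by (simp add: bump_def max_def)
  qed
  then show ?thesis using False by (auto intro: tendsto_eventually)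
qed auto

lemma (in finite_measure) integrable_bounded:
  fixes f :: "'a \<Rightarrow> real"
  assumes "f \<in> borel_measurable M" "\<And>x. \<bar>f x\<bar> \<le> C"
  shows "integrable M f"
  using assms by (intro integrable_const_bound[where B=C]) auto

text \<open>Measurability is not asked for: a function that is not integrable has Bochner integral
  0, and \<open>C\<close> dominates an absolute value.\<close>

lemma (in prob_space) abs_integral_le_const:
  fixes f :: "'a \<Rightarrow> real"
  assumes "\<And>x. \<bar>f x\<bar> \<le> C"
  shows "\<bar>\<integral>x. f x \<partial>M\<bar> \<le> C"
proof (cases "integrable M f")
  case True
  have "\<bar>\<integral>x. f x \<partial>M\<bar> \<le> (\<integral>x. \<bar>f x\<bar> \<partial>M)" by (rule integral_abs_bound)
  also have "\<dots> \<le> (\<integral>x. C \<partial>M)"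
    using True assms by (intro integral_mono) auto
  finally show ?thesis by (simp add: prob_space)
next
  case False
  then show ?thesis
    using assms[of undefined] by (simp add: not_integrable_integral_eq)
qed

section \<open>Bounded Lipschitz functions as test functions\<close>

lemma measure_closed_lim_bump:
  fixes M :: "'a::metric_space measure"
  assumes "finite_measure M" and M: "sets M = sets borel" and C: "closed C" "C \<noteq> {}"
  shows "(\<lambda>n. \<integral>x. bump C (1 / real (Suc n)) x \<partial>M) \<longlonglongrightarrow> measure M C"
proof -
  interpret finite_measure M by fact
  have [measurable]: "C \<in> sets M" using C M by auto
  have bm: "bump C (1 / real (Suc n)) \<in> borel_measurable M" for n
    using bounded_lipschitz_measurable[OF bump_bounded_lipschitz, of "1 / real (Suc n)" C] M
      measurable_cong_sets[OF M refl] by auto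
  have "(\<lambda>n. \<integral>x. bump C (1 / real (Suc n)) x \<partial>M) \<longlonglongrightarrow> (\<integral>x. indicator C x \<partial>M)"
  proof (rule integral_dominated_convergence[where w="\<lambda>_. 1"])
    show "AE x in M. (\<lambda>n. bump C (1 / real (Suc n)) x) \<longlonglongrightarrow> indicator C x"
      using bump_tendsto_indicator[OF C] by auto
  qed (use bm in auto)
  then show ?thesis by (simp add: sets_eq_imp_space_eq[OF M])
qed

text \<open>Bumps recover the mass of every closed set in the limit, and the closed sets are an
  intersection-stable generator of the Borel sets.\<close>

lemma measure_eqI_bounded_lipschitz:
  fixes M N :: "'a::metric_space measure"
  assumes "prob_space M" "prob_space N" and M: "sets M = sets borel" and N: "sets N = sets borel"
    and eq: "\<And>f. f \<in> bounded_lipschitz \<Longrightarrow> (\<integral>x. f x \<partial>M) = (\<integral>x. f x \<partial>N)"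
  shows "M = N"
proof -
  interpret M: prob_space M by fact
  interpret N: prob_space N by fact
  have cl: "measure M C = measure N C" if "closed C" for C
  proof (cases "C = {}")
    case False
    have "(\<lambda>n. \<integral>x. bump C (1 / real (Suc n)) x \<partial>M) \<longlonglongrightarrow> measure N C"
      using measure_closed_lim_bump[OF N.finite_measure_axioms N that False]
      by (simp add: eq bump_bounded_lipschitz)
    with measure_closed_lim_bump[OF M.finite_measure_axioms M that False] show ?thesis
      by (rule LIMSEQ_unique)
  qed auto
  show ?thesis
  proof (rule measure_eqI_generator_eq[where A="\<lambda>_. UNIV" and \<Omega>=UNIV and E="{C. closed C}"])
    show "sets M = sigma_sets UNIV {C. closed C}" "sets N = sigma_sets UNIV {C. closed C}"
      using M N by (simp_all add: borel_eq_closed)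
    show "emeasure M C = emeasure N C" if "C \<in> {C. closed C}" for C
      using cl that by (simp add: M.emeasure_eq_measure N.emeasure_eq_measure)
  qed (auto simp: Int_stable_def)
qed

text \<open>\<open>g n\<close> is the Lipschitz regularisation (Pasch-Hausdorff envelope) of
  \<open>h\<close>: as an infimum of functions that are \<open>n\<close>-Lipschitz in
  \<open>x\<close> it is itself \<open>n\<close>-Lipschitz.\<close>

lemma bounded_continuous_lipschitz_approx:
  fixes h :: "'a::metric_space \<Rightarrow> real"
  assumes cont: "continuous_on UNIV h" and bd: "\<And>x. \<bar>h x\<bar> \<le> C"
  obtains g :: "nat \<Rightarrow> 'a \<Rightarrow> real" where "\<And>n. g n \<in> bounded_lipschitz"
    "\<And>n x. \<bar>g n x\<bar> \<le> C" "\<And>n x. g n x \<le> h x" "\<And>x. (\<lambda>n. g n x) \<longlonglongrightarrow> h x"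
proof -
  define g where "g n x = (INF y. h y + real n * dist x y)" for n x
  have lb: "- C \<le> h y + real n * dist x y" for n x y
    using bd[of y] by (smt (verit) mult_nonneg_nonneg of_nat_0_le_iff zero_le_dist)
  have bb: "bdd_below (range (\<lambda>y. h y + real n * dist x y))" for n x
    using lb by (intro bdd_belowI2[where m="-C"])
  have le: "g n x \<le> h y + real n * dist x y" for n x y
    unfolding g_def by (rule cINF_lower[OF bb]) simp
  have gh: "g n x \<le> h x" for n x
    using le[of n x x] by simp
  have lbg: "- C \<le> g n x" for n x
    unfolding g_def by (rule cINF_greatest) (use lb in auto)
  have gC: "\<bar>g n x\<bar> \<le> C" for n x
    using lbg[of n x] gh[of n x] bd[of x] by linarith
  have lip: "g n x - g n x' \<le> real n * dist x x'" for n x x'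
  proof -
    have "g n x - real n * dist x x' \<le> g n x'"
      unfolding g_def[of n x']
    proof (rule cINF_greatest)
      fix y
      have "g n x \<le> h y + real n * dist x y" by (rule le)
      also have "\<dots> \<le> h y + real n * (dist x x' + dist x' y)"
        by (intro add_left_mono mult_left_mono dist_triangle) auto
      finally show "g n x - real n * dist x x' \<le> h y + real n * dist x' y"
        by (simp add: algebra_simps)
    qed auto
    then show ?thesis by simp
  qed
  have lim: "(\<lambda>n. g n x) \<longlonglongrightarrow> h x" for x
  proof (rule LIMSEQ_I)
    fix e :: real assume "0 < e"
    then obtain d where d: "0 < d" "\<And>y. dist y x < d \<Longrightarrow> dist (h y) (h x) < e / 2"
      using cont[unfolded continuous_on_iff, rule_format, of x "e / 2"] by auto
    obtain N where N: "2 * C / d < real N" using reals_Archimedean2 by blast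
    show "\<exists>N. \<forall>n\<ge>N. norm (g n x - h x) < e"
    proof (intro exI allI impI)
      fix n assume "N \<le> n"
      \<comment> \<open>\<open>2 * C\<close> bounds the oscillation of \<open>h\<close>. Once
        \<open>n * d\<close> exceeds it, points farther than \<open>d\<close> from \<open>x\<close>
        cannot push the infimum below \<open>h x\<close>.\<close>
      then have nd: "2 * C < real n * d" using N d(1) 
        by (smt (verit) of_nat_le_iff pos_divide_less_eq)
      have "h x - e / 2 \<le> g n x"
        unfolding g_def
      proof (rule cINF_greatest)
        fix y
        show "h x - e / 2 \<le> h y + real n * dist x y"
        proof (cases "dist y x < d")
          case True
          then have "h x - e / 2 \<le> h y" using d(2)[of y] unfolding dist_real_def by linarith
          then show ?thesis by (smt (verit) mult_nonneg_nonneg of_nat_0_le_iff zero_le_dist)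
        next
          case False
          then have "real n * d \<le> real n * dist x y"
            by (intro mult_left_mono) (auto simp: dist_commute)
          then show ?thesis using nd bd[of x] bd[of y] \<open>0 < e\<close> by linarith
        qed
      qed auto
      then show "norm (g n x - h x) < e" using gh[of n x] \<open>0 < e\<close> by simp
    qed
  qed
  show ?thesis
  proof (rule that)
    show "g n \<in> bounded_lipschitz" for n
      by (rule bounded_lipschitzI[OF gC _ lip]) auto
  qed (use gC gh lim in auto)
qed

text \<open>The Feller property turns Lipschitz functions into merely continuous ones, so
  convergence has to be extended to these. Approximation from below gives the lower half of the
  limit; the upper half is the lower half for \<open>- h\<close>.\<close>

lemma weak_conv_bounded_lipschitz_continuous:
  fixes \<mu> :: "nat \<Rightarrow> 'a::metric_space measure" and h :: "'a \<Rightarrow> real"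
  assumes pn: "\<And>n. prob_space (\<mu> n)" "\<And>n. sets (\<mu> n) = sets borel"
    and p: "prob_space m" "sets m = sets borel"
    and conv: "\<And>f. f \<in> bounded_lipschitz \<Longrightarrow> (\<lambda>n. \<integral>x. f x \<partial>\<mu> n) \<longlonglongrightarrow> (\<integral>x. f x \<partial>m)"
    and cont: "continuous_on UNIV h" and bd: "\<And>x. \<bar>h x\<bar> \<le> C"
  shows "(\<lambda>n. \<integral>x. h x \<partial>\<mu> n) \<longlonglongrightarrow> (\<integral>x. h x \<partial>m)"
proof -
  have lower: "\<forall>\<^sub>F n in sequentially. (\<integral>x. h x \<partial>m) - e < (\<integral>x. h x \<partial>\<mu> n)"
    if cont: "continuous_on UNIV h" and bd: "\<And>x. \<bar>h x\<bar> \<le> C" and "0 < e" for h :: "'a \<Rightarrow> real" and e C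
  proof -
    interpret m: prob_space m by fact
    obtain g where g: "\<And>n. g n \<in> bounded_lipschitz" "\<And>n x. \<bar>g n x\<bar> \<le> C"
      "\<And>n x. g n x \<le> h x" "\<And>x. (\<lambda>n. g n x) \<longlonglongrightarrow> h x"
      using bounded_continuous_lipschitz_approx[OF cont bd] by blast
    have hm: "h \<in> borel_measurable M" and gm: "g k \<in> borel_measurable M"
      if "sets M = sets borel" for M and k
      using measurable_cong_sets[OF that refl] cont bounded_lipschitz_measurable[OF g(1)]
      by (auto intro: borel_measurable_continuous_onI)
    have "(\<lambda>k. \<integral>x. g k x \<partial>m) \<longlonglongrightarrow> (\<integral>x. h x \<partial>m)"
      by (rule integral_dominated_convergence[where w="\<lambda>_. C"]) (use g hm gm p in auto)
    then have "\<forall>\<^sub>F k in sequentially. (\<integral>x. h x \<partial>m) - e < (\<integral>x. g k x \<partial>m)"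
      using \<open>0 < e\<close> by (intro order_tendstoD) auto
    then obtain k where k: "(\<integral>x. h x \<partial>m) - e < (\<integral>x. g k x \<partial>m)"
      by (auto simp: eventually_sequentially)
    have "\<forall>\<^sub>F n in sequentially. (\<integral>x. h x \<partial>m) - e < (\<integral>x. g k x \<partial>\<mu> n)"
      using conv[OF g(1)] k by (rule order_tendstoD)
    then show ?thesis
    proof eventually_elim
      case (elim n)
      interpret \<mu>: prob_space "\<mu> n" by (rule pn)
      have "(\<integral>x. g k x \<partial>\<mu> n) \<le> (\<integral>x. h x \<partial>\<mu> n)"
        by (intro integral_mono \<mu>.integrable_bounded[where C=C] hm gm pn g bd)
      then show ?case using elim by simp
    qed
  qed
  show ?thesis
  proof (rule order_tendstoI, goal_cases)
    case (1 a)
    then have a: "a < (\<integral>x. h x \<partial>m)" .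
    show "\<forall>\<^sub>F n in sequentially. a < (\<integral>x. h x \<partial>\<mu> n)"
      using lower[OF cont bd, of "(\<integral>x. h x \<partial>m) - a"] a by auto
  next
    case (2 a)
    then have a: "(\<integral>x. h x \<partial>m) < a" .
    have "\<forall>\<^sub>F n in sequentially. (\<integral>x. - h x \<partial>m) - (a - (\<integral>x. h x \<partial>m)) < (\<integral>x. - h x \<partial>\<mu> n)"
      by (rule lower) (use a cont bd in \<open>auto intro: continuous_intros\<close>)
    then show "\<forall>\<^sub>F n in sequentially. (\<integral>x. h x \<partial>\<mu> n) < a"
      by auto
  qed
qed

section \<open>Mixtures of measures and averages over time intervals\<close>

lemma
  fixes f :: "'b \<Rightarrow> real"
  assumes N [measurable]: "N \<in> M \<rightarrow>\<^sub>M subprob_algebra B" and f [measurable]: "f \<in> borel_measurable B"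
    and fin: "(\<integral>\<^sup>+x. \<integral>\<^sup>+y. ennreal \<bar>f y\<bar> \<partial>N x \<partial>M) < \<infinity>" and ne: "space M \<noteq> {}"
  shows integrable_bind_of_finite: "integrable (M \<bind> N) f"
    and integral_bind_of_finite: "(\<integral>y. f y \<partial>(M \<bind> N)) = (\<integral>x. \<integral>y. f y \<partial>N x \<partial>M)"
proof -
  have sb: "sets (M \<bind> N) = sets B"
    using ne by (intro sets_bind) (auto simp: sets_kernel[OF N])
  have fm: "f \<in> borel_measurable (M \<bind> N)"
    using f by (subst measurable_cong_sets[OF sb refl])
  show int: "integrable (M \<bind> N) f"
    unfolding integrable_iff_bounded using fin fm by (simp add: nn_integral_bind[OF _ N])
  \<comment> \<open>\<open>nn_integral_bind\<close> treats nonnegative functions. The means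
    \<open>p\<close> and \<open>q\<close> of the positive and negative part are finite almost
    everywhere, which allows their difference to be taken in the reals.\<close>
  define p where "p x = (\<integral>\<^sup>+y. ennreal (f y) \<partial>N x)" for x
  define q where "q x = (\<integral>\<^sup>+y. ennreal (- f y) \<partial>N x)" for x
  have [measurable]: "p \<in> borel_measurable M" "q \<in> borel_measurable M"
    unfolding p_def q_def by measurable
  have ple: "p x \<le> (\<integral>\<^sup>+y. ennreal \<bar>f y\<bar> \<partial>N x)" "q x \<le> (\<integral>\<^sup>+y. ennreal \<bar>f y\<bar> \<partial>N x)" for x
    unfolding p_def q_def by (auto intro!: nn_integral_mono ennreal_leI)
  have fp: "(\<integral>\<^sup>+x. p x \<partial>M) < \<infinity>" "(\<integral>\<^sup>+x. q x \<partial>M) < \<infinity>"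
    using nn_integral_mono[of M p, OF ple(1)] nn_integral_mono[of M q, OF ple(2)] fin
    by (auto intro: le_less_trans)
  have ae: "AE x in M. p x \<noteq> \<infinity>" "AE x in M. q x \<noteq> \<infinity>"
    using fp by (auto intro!: nn_integral_PInf_AE simp del: infinity_ennreal_def)
  have ip: "(\<integral>\<^sup>+x. ennreal (enn2real (p x)) \<partial>M) = (\<integral>\<^sup>+x. p x \<partial>M)"
    "(\<integral>\<^sup>+x. ennreal (enn2real (q x)) \<partial>M) = (\<integral>\<^sup>+x. q x \<partial>M)"
    using ae by (auto intro!: nn_integral_cong_AE simp: less_top)
  have intp: "integrable M (\<lambda>x. enn2real (p x))" "integrable M (\<lambda>x. enn2real (q x))"
    using fp by (auto intro!: integrableI_bounded simp: ip)
  have aeint: "AE x in M. (\<integral>\<^sup>+y. ennreal \<bar>f y\<bar> \<partial>N x) \<noteq> \<infinity>"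
    using fin by (intro nn_integral_PInf_AE) auto
  have eq: "AE x in M. (\<integral>y. f y \<partial>N x) = enn2real (p x) - enn2real (q x)"
    using aeint AE_space
  proof eventually_elim
    case (elim x)
    have "f \<in> borel_measurable (N x)"
      using f by (subst measurable_cong_sets[OF sets_kernel[OF N elim(2)] refl])
    then have "integrable (N x) f"
      unfolding integrable_iff_bounded using elim by (simp add: less_top)
    then show ?case unfolding p_def q_def by (rule real_lebesgue_integral_def)
  qed
  have m: "(\<lambda>x. \<integral>y. f y \<partial>N x) \<in> borel_measurable M" by measurable
  have "(\<integral>x. \<integral>y. f y \<partial>N x \<partial>M) = (\<integral>x. enn2real (p x) - enn2real (q x) \<partial>M)"
    by (rule integral_cong_AE) (use eq m in auto)
  also have "\<dots> = (\<integral>x. enn2real (p x) \<partial>M) - (\<integral>x. enn2real (q x) \<partial>M)"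
    using intp by simp
  also have "\<dots> = enn2real (\<integral>\<^sup>+x. p x \<partial>M) - enn2real (\<integral>\<^sup>+x. q x \<partial>M)"
    by (simp add: integral_eq_nn_integral ip)
  also have "\<dots> = (\<integral>y. f y \<partial>(M \<bind> N))"
    unfolding real_lebesgue_integral_def[OF int] p_def q_def
    by (simp add: nn_integral_bind[OF _ N])
  finally show "(\<integral>y. f y \<partial>(M \<bind> N)) = (\<integral>x. \<integral>y. f y \<partial>N x \<partial>M)" by simp
qed

lemma set_integrable_bounded_Icc:
  fixes \<phi> :: "real \<Rightarrow> real"
  assumes "\<phi> \<in> borel_measurable borel" "\<And>r. a \<le> r \<Longrightarrow> r \<le> b \<Longrightarrow> \<bar>\<phi> r\<bar> \<le> C"
  shows "set_integrable lborel {a..b} \<phi>"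
  unfolding set_integrable_def
proof (rule Bochner_Integration.integrable_bound)
  show "integrable lborel (\<lambda>r. indicator {a..b} r *\<^sub>R C)"
    by (intro integrable_scaleR_left integrable_real_indicator) (auto simp: emeasure_lborel_Icc_eq)
  show "AE r in lborel. norm (indicator {a..b} r *\<^sub>R \<phi> r) \<le> norm (indicator {a..b} r *\<^sub>R C)"
  proof (rule AE_I2)
    fix r show "norm (indicator {a..b} r *\<^sub>R \<phi> r) \<le> norm (indicator {a..b} r *\<^sub>R C)"
      using assms(2)[of r] by (cases "r \<in> {a..b}") auto
  qed
qed (use assms(1) in auto)

lemma average_shift_diff_le:
  fixes \<phi> :: "real \<Rightarrow> real"
  assumes m [measurable]: "\<phi> \<in> borel_measurable borel" and bd: "\<And>r. 0 \<le> r \<Longrightarrow> \<bar>\<phi> r\<bar> \<le> C"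
    and s: "0 \<le> s" and t: "0 < t"
  shows "\<bar>(LINT r:{0..t}|lborel. \<phi> (s + r)) / t - (LINT r:{0..t}|lborel. \<phi> r) / t\<bar> \<le> 2 * C * s / t"
proof -
  have C: "0 \<le> C" using bd[of 0] by linarith
  have eq: "(LINT r:{0..t}|lborel. \<phi> (s + r)) = (LINT r:{s..s+t}|lborel. \<phi> r)"
  proof -
    have "(LINT r:{s..s+t}|lborel. \<phi> r)
        = (\<integral>r. indicator {s..s+t} (s + 1 * r) *\<^sub>R \<phi> (s + 1 * r) \<partial>lborel)"
      unfolding set_lebesgue_integral_def by (subst lborel_integral_real_affine[of 1 _ s]) auto
    also have "\<dots> = (LINT r:{0..t}|lborel. \<phi> (s + r))"
      unfolding set_lebesgue_integral_def
      by (intro Bochner_Integration.integral_cong) (auto split: split_indicator)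
    finally show ?thesis by simp
  qed
  have i1: "integrable lborel (\<lambda>r. indicator {s..s+t} r *\<^sub>R \<phi> r)"
    "integrable lborel (\<lambda>r. indicator {0..t} r *\<^sub>R \<phi> r)"
    using set_integrable_bounded_Icc[of \<phi> _ _ C] bd s unfolding set_integrable_def by auto
  have "\<bar>(LINT r:{s..s+t}|lborel. \<phi> r) - (LINT r:{0..t}|lborel. \<phi> r)\<bar>
      = \<bar>\<integral>r. indicator {s..s+t} r *\<^sub>R \<phi> r - indicator {0..t} r *\<^sub>R \<phi> r \<partial>lborel\<bar>"
    unfolding set_lebesgue_integral_def using i1 by simp
  also have "\<dots> \<le> (\<integral>r. \<bar>indicator {s..s+t} r *\<^sub>R \<phi> r - indicator {0..t} r *\<^sub>R \<phi> r\<bar> \<partial>lborel)"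
    by (rule integral_abs_bound)
  \<comment> \<open>A time covered by exactly one of the two windows lies in \<open>{0..s}\<close>
    or in \<open>{t..t+s}\<close>, whichever of \<open>s\<close> and \<open>t\<close> is
    larger.\<close>
  also have "\<dots> \<le> (\<integral>r. C * indicator {0..s} r + C * indicator {t..t+s} r \<partial>lborel)"
  proof (rule integral_mono)
    show "integrable lborel (\<lambda>r. C * indicator {0..s} r + C * indicator {t..t+s} r)"
      by (intro Bochner_Integration.integrable_add integrable_mult_right integrable_real_indicator)
        (auto simp: emeasure_lborel_Icc_eq)
    fix r
    have "r < 0 \<or> \<bar>\<phi> r\<bar> \<le> C" using bd[of r] by linarith
    then show "\<bar>indicator {s..s+t} r *\<^sub>R \<phi> r - indicator {0..t} r *\<^sub>R \<phi> r\<bar>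
        \<le> C * indicator {0..s} r + C * indicator {t..t+s} r"
      using s C by (auto split: split_indicator)
  qed (use i1 in auto)
  also have "\<dots> = 2 * C * s" using s by simp
  finally have "\<bar>(LINT r:{s..s+t}|lborel. \<phi> r) - (LINT r:{0..t}|lborel. \<phi> r)\<bar> \<le> 2 * C * s" .
  then show ?thesis unfolding eq diff_divide_distrib[symmetric] using t
    by (simp add: divide_right_mono)
qed

text \<open>Used with \<open>u\<close> the integer part of \<open>t\<close>, which reduces limits
  over real times to limits over integer times.\<close>

lemma average_diff_le:
  fixes \<phi> :: "real \<Rightarrow> real"
  assumes m [measurable]: "\<phi> \<in> borel_measurable borel" and bd: "\<And>r. 0 \<le> r \<Longrightarrow> \<bar>\<phi> r\<bar> \<le> C"
    and u: "0 < u" "u \<le> t"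
  shows "\<bar>(LINT r:{0..t}|lborel. \<phi> r) / t - (LINT r:{0..u}|lborel. \<phi> r) / u\<bar> \<le> 2 * C * (t - u) / t"
proof -
  have C: "0 \<le> C" using bd[of 0] by linarith
  have bound: "\<bar>LINT r:{a..b}|lborel. \<phi> r\<bar> \<le> C * (b - a)" if "0 \<le> a" "a \<le> b" for a b
  proof -
    have "\<bar>LINT r:{a..b}|lborel. \<phi> r\<bar> \<le> (\<integral>r. \<bar>indicator {a..b} r *\<^sub>R \<phi> r\<bar> \<partial>lborel)"
      unfolding set_lebesgue_integral_def by (rule integral_abs_bound)
    also have "\<dots> \<le> (\<integral>r. C * indicator {a..b} r \<partial>lborel)"
    proof (rule integral_mono)
      show "integrable lborel (\<lambda>r. \<bar>indicator {a..b} r *\<^sub>R \<phi> r\<bar>)"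
        using set_integrable_bounded_Icc[of \<phi> a b C] bd that unfolding set_integrable_def by auto
      show "integrable lborel (\<lambda>r. C * indicator {a..b} r)"
        by (intro integrable_mult_right integrable_real_indicator) (auto simp: emeasure_lborel_Icc_eq)
    qed (use bd that in \<open>auto split: split_indicator\<close>)
    finally show ?thesis using that by simp
  qed
  define A where "A = (LINT r:{0..u}|lborel. \<phi> r)"
  define D where "D = (LINT r:{u..t}|lborel. \<phi> r)"
  have "(LINT r:{0..t}|lborel. \<phi> r) = A + D"
    unfolding A_def D_def set_lebesgue_integral_def
  proof (subst Bochner_Integration.integral_add[symmetric])
    show "integrable lborel (\<lambda>r. indicator {0..u} r *\<^sub>R \<phi> r)" "integrable lborel (\<lambda>r. indicator {u..t} r *\<^sub>R \<phi> r)"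
      using set_integrable_bounded_Icc[of \<phi> _ _ C] bd u unfolding set_integrable_def by auto
    show "(LINT r|lborel. indicator {0..t} r *\<^sub>R \<phi> r)
      = (LINT r|lborel. indicator {0..u} r *\<^sub>R \<phi> r + indicator {u..t} r *\<^sub>R \<phi> r)"
    proof (rule integral_cong_AE)
      show "AE r in lborel. indicator {0..t} r *\<^sub>R \<phi> r = indicator {0..u} r *\<^sub>R \<phi> r + indicator {u..t} r *\<^sub>R \<phi> r"
        using AE_lborel_singleton[of u] by eventually_elim (use u in \<open>auto split: split_indicator\<close>)
    qed auto
  qed
  \<comment> \<open>\<open>A / t\<close> is \<open>A / u\<close> minus the fraction
    \<open>(t - u) / t\<close> of it. This correction and the new part \<open>D / t\<close> are each
    at most \<open>C * (t - u) / t\<close>.\<close>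
  then have eq: "(LINT r:{0..t}|lborel. \<phi> r) / t - A / u = D / t - A / u * ((t - u) / t)"
    using u by (simp add: field_simps)
  have A: "\<bar>A\<bar> \<le> C * u" and D: "\<bar>D\<bar> \<le> C * (t - u)"
    unfolding A_def D_def using bound[of 0 u] bound[of u t] u by auto
  have "\<bar>A / u * ((t - u) / t)\<bar> \<le> C * ((t - u) / t)"
    unfolding abs_mult using A u C by (intro mult_mono) (auto simp: field_simps)
  moreover have "\<bar>D / t\<bar> \<le> C * ((t - u) / t)"
    using D u by (simp add: divide_right_mono)
  ultimately have "\<bar>D / t - A / u * ((t - u) / t)\<bar> \<le> C * ((t - u) / t) + C * ((t - u) / t)"
    by (intro order_trans[OF abs_triangle_ineq4] add_mono)
  then show ?thesis unfolding eq[symmetric] A_def[symmetric] by simp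
qed

text \<open>A gliding hump argument, the core of Schur's theorem on weakly null sequences in \<open>\<ell>\<^sup>1\<close>.\<close>

lemma gliding_hump:
  fixes a :: "nat \<Rightarrow> nat \<Rightarrow> real"
  assumes sm: "\<And>n. summable (\<lambda>k. \<bar>a n k\<bar>)"
    and lim: "\<And>J. (\<lambda>n. \<Sum>k. if k \<in> J then a n k else 0) \<longlonglongrightarrow> 0"
  shows "(\<lambda>n. a n n) \<longlonglongrightarrow> 0"
proof (rule ccontr)
  assume "\<not> ?thesis"
  then obtain e where e: "0 < e" "\<And>N. \<exists>n\<ge>N. e \<le> \<bar>a n n\<bar>"
    by (auto simp: LIMSEQ_def not_less)
  have col: "(\<lambda>n. a n k) \<longlonglongrightarrow> 0" for k
  proof -
    have "(\<Sum>j. if j \<in> {k} then a n j else 0) = a n k" for n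
      by (subst suminf_finite[of "{k}"]) auto
    then show ?thesis using lim[of "{k}"] by simp
  qed
  \<comment> \<open>Row \<open>n'\<close> has little mass on the columns up to \<open>n\<close>, and
    row \<open>n\<close> has little mass from column \<open>n'\<close> on. Along a chain of this
    relation every row is concentrated at its diagonal entry, as far as the columns of the chain can
    see.\<close>
  define R where "R n n' \<longleftrightarrow> n < n' \<and> e \<le> \<bar>a n' n'\<bar> \<and> (\<Sum>i\<le>n. \<bar>a n' i\<bar>) < e / 4
      \<and> (\<Sum>k. \<bar>a n (k + n')\<bar>) < e / 4" for n n'
  have step: "\<exists>n'. R n n'" for n
  proof -
    have "(\<lambda>n'. \<Sum>i\<le>n. \<bar>a n' i\<bar>) \<longlonglongrightarrow> (\<Sum>i\<le>n. 0)"
      by (intro tendsto_sum tendsto_rabs_zero col)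
    then have "\<forall>\<^sub>F n' in sequentially. (\<Sum>i\<le>n. \<bar>a n' i\<bar>) < e / 4"
      using e(1) by (intro order_tendstoD) auto
    moreover have "(\<lambda>n'. \<Sum>k. \<bar>a n (k + n')\<bar>) \<longlonglongrightarrow> 0"
      using suminf_exist_split2[OF sm[of n]] by simp
    then have "\<forall>\<^sub>F n' in sequentially. (\<Sum>k. \<bar>a n (k + n')\<bar>) < e / 4"
      using e(1) by (intro order_tendstoD) auto
    ultimately have "\<forall>\<^sub>F n' in sequentially. (\<Sum>i\<le>n. \<bar>a n' i\<bar>) < e / 4 \<and> (\<Sum>k. \<bar>a n (k + n')\<bar>) < e / 4"
      by eventually_elim simp
    then obtain N where "\<And>n'. N \<le> n' \<Longrightarrow> (\<Sum>i\<le>n. \<bar>a n' i\<bar>) < e / 4 \<and> (\<Sum>k. \<bar>a n (k + n')\<bar>) < e / 4"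
      by (auto simp: eventually_sequentially)
    moreover obtain n' where "max N (Suc n) \<le> n'" "e \<le> \<bar>a n' n'\<bar>" using e(2) by blast
    ultimately show ?thesis unfolding R_def by (intro exI[of _ n']) auto
  qed
  obtain s where s: "\<And>j. R (s j) (s (Suc j))"
    using dependent_nat_choice[of "\<lambda>_ _. True" "\<lambda>_. R"] step by auto
  have smono: "strict_mono s"
    using s by (auto simp: strict_mono_Suc_iff R_def)
  define J where "J = range s"
  \<comment> \<open>In the columns of \<open>J\<close>, row \<open>n\<close> consists of its
    diagonal entry, at least \<open>e\<close> in size, a part up to \<open>s i\<close> and a part
    from \<open>m\<close> on. The last two are at most \<open>e / 4\<close> each, so
    \<open>e / 2\<close> survives.\<close>
  have big: "e / 2 \<le> \<bar>\<Sum>k. if k \<in> J then a (s (Suc i)) k else 0\<bar>" for i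
  proof -
    define n where "n = s (Suc i)"
    define m where "m = s (Suc (Suc i))"
    define b where "b k = (if k \<in> J then a n k else 0)" for k
    have lt: "s i < n" "n < m" using smono by (auto simp: n_def m_def strict_mono_Suc_iff)
    have bs: "summable (\<lambda>k. \<bar>b k\<bar>)"
      by (rule summable_comparison_test[OF _ sm[of n]]) (auto simp: b_def)
    have gap: "b k = 0" if "s i < k" "k < m" "k \<noteq> n" for k
    proof -
      have "k \<noteq> s j" for j
      proof
        assume k: "k = s j"
        then have "i < j" "j < Suc (Suc i)" using that smono
          by (simp_all add: m_def strict_mono_less)
        then have "j = Suc i" by simp
        then show False using that k by (simp add: n_def)
      qed
      then show ?thesis by (auto simp: b_def J_def)
    qed
    have "(\<Sum>k. b k) = (\<Sum>k. b (k + m)) + (\<Sum>k<m. b k)"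
      using bs by (intro suminf_split_initial_segment) (rule summable_rabs_cancel)
    moreover have "(\<Sum>k<m. b k) = (\<Sum>k\<in>insert n {..s i}. b k)"
      by (rule sum.mono_neutral_right) (use lt gap in auto)
    moreover have "\<dots> = b n + (\<Sum>k\<le>s i. b k)"
      using lt by (subst sum.insert) auto
    moreover have "b n = a n n" by (simp add: b_def J_def n_def)
    moreover have "\<bar>\<Sum>k\<le>s i. b k\<bar> \<le> e / 4"
    proof -
      have "\<bar>\<Sum>k\<le>s i. b k\<bar> \<le> (\<Sum>k\<le>s i. \<bar>a n k\<bar>)"
        by (rule order_trans[OF sum_abs]) (auto intro!: sum_mono simp: b_def)
      then show ?thesis using s[of i] by (simp add: R_def n_def)
    qed
    moreover have "\<bar>\<Sum>k. b (k + m)\<bar> \<le> e / 4"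
    proof -
      have sb: "summable (\<lambda>k. \<bar>b (k + m)\<bar>)" using bs by (rule summable_ignore_initial_segment)
      have "\<bar>\<Sum>k. b (k + m)\<bar> \<le> (\<Sum>k. \<bar>b (k + m)\<bar>)" using sb by (rule summable_rabs)
      also have "\<dots> \<le> (\<Sum>k. \<bar>a n (k + m)\<bar>)"
        by (rule suminf_le[OF _ sb summable_ignore_initial_segment[OF sm[of n]]]) (auto simp: b_def)
      finally show ?thesis using s[of "Suc i"] by (simp add: R_def n_def m_def)
    qed
    moreover have "e \<le> \<bar>a n n\<bar>" using s[of i] by (simp add: R_def n_def)
    ultimately have "e / 2 \<le> \<bar>\<Sum>k. b k\<bar>" by linarith
    then show ?thesis unfolding b_def n_def .
  qed
  have "(\<lambda>i. \<Sum>k. if k \<in> J then a (s (Suc i)) k else 0) \<longlonglongrightarrow> 0"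
    using LIMSEQ_subseq_LIMSEQ[OF LIMSEQ_subseq_LIMSEQ[OF lim[of J] smono], of Suc]
    by (simp add: o_def strict_mono_Suc_iff)
  then have "\<forall>\<^sub>F i in sequentially. \<bar>\<Sum>k. if k \<in> J then a (s (Suc i)) k else 0\<bar> < e / 2"
    using e(1) by (intro order_tendstoD(2)[OF tendsto_rabs_zero]) auto
  then obtain i where "\<bar>\<Sum>k. if k \<in> J then a (s (Suc i)) k else 0\<bar> < e / 2"
    by (auto simp: eventually_sequentially)
  with big[of i] show False by simp
qed

section \<open>Sequential compactness of tight sequences of measures\<close>

text \<open>Half the first ternary digit of a point of the middle-thirds Cantor set: 0 up to 1/3, 1
  from 2/3 on, and linear across the gap, which makes it continuous on the whole line.\<close>

definition clamp3 :: "real \<Rightarrow> real" where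
  "clamp3 u = max 0 (min 1 (3 * u - 1))"

text \<open>On the Cantor set this deletes the first ternary digit.\<close>

definition shift3 :: "real \<Rightarrow> real" where
  "shift3 u = 3 * u - 2 * clamp3 u"

definition digit3 :: "nat \<Rightarrow> real \<Rightarrow> real" where
  "digit3 j u = clamp3 ((shift3 ^^ j) u)"

text \<open>The ternary expansion with digits \<open>2 * c j\<close>. Binary expansions would not
  do, as their digits jump at dyadic rationals; the removed middle thirds leave room for
  interpolation.\<close>

definition cantor_sum :: "(nat \<Rightarrow> real) \<Rightarrow> real" where
  "cantor_sum c = (\<Sum>j. 2 / 3 * (1 / 3) ^ j * c j)"

lemma isCont_digit3: "isCont (digit3 j) u"
proof -
  have c: "continuous_on UNIV clamp3"
    unfolding clamp3_def by (intro continuous_intros)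
  have t: "continuous_on UNIV shift3"
    unfolding shift3_def by (intro continuous_intros continuous_on_subset[OF c]) auto
  have "continuous_on UNIV (shift3 ^^ j)"
  proof (induction j)
    case (Suc j)
    then show ?case
      using continuous_on_compose[OF Suc continuous_on_subset[OF t subset_UNIV]] by simp
  qed (simp add: id_def)
  then have "continuous_on UNIV (clamp3 \<circ> (shift3 ^^ j))"
    by (rule continuous_on_compose[OF _ continuous_on_subset[OF c subset_UNIV]])
  then have "continuous_on UNIV (digit3 j)"
    by (simp add: digit3_def[abs_def] o_def)
  then show ?thesis by (simp add: continuous_on_eq_continuous_at)
qed

lemma digit3_measurable [measurable]: "digit3 j \<in> borel_measurable borel"
  by (intro borel_measurable_continuous_onI continuous_at_imp_continuous_on) (auto simp: isCont_digit3)

lemma digit3_bounds: "0 \<le> digit3 j u" "digit3 j u \<le> 1"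
  by (auto simp: digit3_def clamp3_def)

lemma
  assumes c: "\<And>j. c j = 0 \<or> c j = (1::real)"
  shows cantor_sum_bounds: "0 \<le> cantor_sum c" "cantor_sum c \<le> 1"
    and cantor_sum_Suc: "3 * cantor_sum c = 2 * c 0 + cantor_sum (\<lambda>j. c (Suc j))"
proof -
  have g: "(\<lambda>j. 2 / 3 * (1 / 3) ^ j :: real) sums (2 / 3 * (1 / (1 - 1 / 3)))"
    by (intro sums_mult geometric_sums) auto
  have sm: "summable (\<lambda>j. 2 / 3 * (1 / 3) ^ j * c j)" if c: "\<And>j. c j = 0 \<or> c j = (1::real)" for c
  proof (rule summable_comparison_test[OF _ sums_summable[OF g]])
    show "\<exists>N. \<forall>n\<ge>N. norm (2 / 3 * (1 / 3) ^ n * c n) \<le> 2 / 3 * (1 / 3) ^ n"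
    proof (intro exI allI impI)
      fix n show "norm (2 / 3 * (1 / 3) ^ n * c n) \<le> 2 / 3 * (1 / 3) ^ n"
        using c[of n] by auto
    qed
  qed
  have s: "summable (\<lambda>j. 2 / 3 * (1 / 3) ^ j * c j)" using sm c by blast
  show "0 \<le> cantor_sum c" unfolding cantor_sum_def
  proof (rule suminf_nonneg[OF s])
    fix n show "0 \<le> 2 / 3 * (1 / 3) ^ n * c n" using c[of n] by auto
  qed
  have "cantor_sum c \<le> (\<Sum>j. 2 / 3 * (1 / 3) ^ j)" unfolding cantor_sum_def
  proof (rule suminf_le[OF _ s sums_summable[OF g]])
    fix n show "2 / 3 * (1 / 3) ^ n * c n \<le> 2 / 3 * (1 / 3) ^ n" using c[of n] by auto
  qed
  then show "cantor_sum c \<le> 1" using sums_unique[OF g] by simp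
  have "cantor_sum c = (\<Sum>j. 2 / 3 * (1 / 3) ^ Suc j * c (Suc j)) + 2 / 3 * c 0"
    unfolding cantor_sum_def by (subst suminf_split_head[OF s]) simp
  also have "(\<Sum>j. 2 / 3 * (1 / 3) ^ Suc j * c (Suc j)) = (\<Sum>j. 1 / 3 * (2 / 3 * (1 / 3) ^ j * c (Suc j)))"
    by (rule suminf_cong) simp
  also have "\<dots> = 1 / 3 * cantor_sum (\<lambda>j. c (Suc j))"
    unfolding cantor_sum_def using c by (intro suminf_mult sm) auto
  finally show "3 * cantor_sum c = 2 * c 0 + cantor_sum (\<lambda>j. c (Suc j))" by simp
qed

text \<open>\<open>shift3\<close> moves the sequence by one place, and \<open>clamp3\<close> reads
  its first entry because the remaining entries contribute at most 1/3.\<close>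

lemma digit3_cantor_sum:
  assumes c: "\<And>j. c j = 0 \<or> c j = (1::real)"
  shows "digit3 j (cantor_sum c) = c j"
proof -
  have cl: "clamp3 (cantor_sum c) = c 0" if c: "\<And>j. c j = 0 \<or> c j = (1::real)" for c
  proof -
    have "0 \<le> cantor_sum (\<lambda>j. c (Suc j))" "cantor_sum (\<lambda>j. c (Suc j)) \<le> 1"
      "3 * cantor_sum c = 2 * c 0 + cantor_sum (\<lambda>j. c (Suc j))"
      using cantor_sum_bounds[of "\<lambda>j. c (Suc j)"] cantor_sum_Suc[of c] c by blast+
    with c[of 0] show ?thesis
      unfolding clamp3_def by (elim disjE) auto
  qed
  have "(shift3 ^^ j) (cantor_sum c) = cantor_sum (\<lambda>i. c (i + j))"
  proof (induction j)
    case (Suc j)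
    have "shift3 (cantor_sum (\<lambda>i. c (i + j))) = cantor_sum (\<lambda>i. c (i + Suc j))"
      unfolding shift3_def using cl[of "\<lambda>i. c (i + j)"] cantor_sum_Suc[of "\<lambda>i. c (i + j)"] c
      by simp
    then show ?case using Suc by simp
  qed simp
  then show ?thesis unfolding digit3_def using cl[of "\<lambda>i. c (i + j)"] c by simp
qed

text \<open>The sum is a polynomial in the digits that picks out the weight of the first digit equal
  to 1. In this form a quantity depending on the first ball that contains a point becomes a
  continuous function of the code.\<close>

lemma first_one_sum:
  fixes c w :: "nat \<Rightarrow> real"
  assumes c: "\<And>j. c j = 0 \<or> c j = 1"
  shows "(\<Sum>i<N. w i * c i * (\<Prod>j<i. 1 - c j)) = (if \<exists>i<N. c i = 1 then w (LEAST i. c i = 1) else 0)"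
    (is "?S = ?R")
    and "(\<Prod>i<N. 1 - c i) = (if \<exists>i<N. c i = 1 then 0 else 1)"
proof -
  show pr: "(\<Prod>i<N. 1 - c i) = (if \<exists>i<N. c i = 1 then 0 else 1)" for N
  proof (cases "\<exists>i<N. c i = 1")
    case False
    then have "\<And>i. i < N \<Longrightarrow> c i = 0" using c by blast
    then show ?thesis using False by simp
  qed (auto simp: prod_zero_iff)
  show "?S = ?R"
  proof (cases "\<exists>i<N. c i = 1")
    case True
    define i0 where "i0 = (LEAST i. c i = 1)"
    from True obtain i where i: "i < N" "c i = 1" by blast
    have "c i0 = 1" "i0 \<le> i" unfolding i0_def using i by (auto intro: LeastI Least_le)
    have "w k * c k * (\<Prod>j<k. 1 - c j) = (if k = i0 then w k else 0)" for k
    proof (cases "k = i0")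
      case True
      have "\<not> (\<exists>j<i0. c j = 1)" unfolding i0_def using not_less_Least by blast
      then show ?thesis using True \<open>c i0 = 1\<close> by (auto simp: pr)
    next
      case False
      show ?thesis
      proof (cases "c k = 1")
        case True
        then have "i0 \<le> k" unfolding i0_def by (rule Least_le)
        with False have "i0 < k" by simp
        then have "\<exists>j<k. c j = 1" using \<open>c i0 = 1\<close> by blast
        then show ?thesis using False by (simp add: pr)
      qed (use False c[of k] in auto)
    qed
    then show ?thesis using True \<open>i0 \<le> i\<close> \<open>i < N\<close> by (simp add: i0_def)
  next
    case False
    then have "\<And>i. i < N \<Longrightarrow> c i = 0" using c by blast
    with False show ?thesis by (subst if_not_P) auto
  qed
qed

text \<open>The sets \<open>ball (x i) (1 / 2 ^ m)\<close> are used as binary digits of a real number, which transports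
  the measures to the Cantor set. A weak limit of the images is provided by Helly's selection
  theorem, and since the digits are restrictions of continuous functions of the real line, almost
  every real number decodes to a sequence of balls shrinking to a point.\<close>

lemma prokhorov_bounded_lipschitz:
  fixes \<mu> :: "nat \<Rightarrow> 'a::polish_space measure" and x :: "nat \<Rightarrow> 'a"
  assumes p: "\<And>n. prob_space (\<mu> n)" and sets: "\<And>n. sets (\<mu> n) = sets borel"
    and tight: "\<And>e d. 0 < e \<Longrightarrow> 0 < d \<Longrightarrow> \<exists>N. \<forall>n. 1 - e \<le> measure (\<mu> n) (\<Union>i<N. ball (x i) d)"
  shows "\<exists>r m. strict_mono (r :: nat \<Rightarrow> nat) \<and> prob_space m \<and> sets m = sets borel \<and>
    (\<forall>f\<in>bounded_lipschitz. (\<lambda>n. \<integral>y. f y \<partial>\<mu> (r n)) \<longlonglongrightarrow> (\<integral>y. f y \<partial>m))"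
proof -
  \<comment> \<open>\<open>prod_decode\<close> runs through all pairs of a scale and a centre, so a
    single sequence of bits records the balls of all dyadic radii.\<close>
  define B where "B j = ball (x (snd (prod_decode j))) (1 / 2 ^ fst (prod_decode j))" for j
  define b where "b j y = (indicator (B j) y :: real)" for j y
  define \<phi> where "\<phi> y = cantor_sum (\<lambda>j. b j y)" for y
  have b01: "b j y = 0 \<or> b j y = 1" for j y by (auto simp: b_def split: split_indicator)
  have dig: "digit3 j (\<phi> y) = b j y" for j y
    unfolding \<phi>_def by (rule digit3_cantor_sum) (rule b01)
  have [measurable]: "B j \<in> sets borel" for j by (simp add: B_def)
  have [measurable]: "b j \<in> borel_measurable borel" for j unfolding b_def by measurable
  have \<phi>_meas [measurable]: "\<phi> \<in> borel_measurable borel"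
    unfolding \<phi>_def cantor_sum_def by measurable
  have m\<mu>: "measurable (\<mu> n) K = measurable borel K" for n and K :: "real measure"
    by (rule measurable_cong_sets[OF sets refl])
  have sp: "space (\<mu> n) = UNIV" for n using sets_eq_imp_space_eq[OF sets] by simp
  define \<nu>n where "\<nu>n n = distr (\<mu> n) borel \<phi>" for n
  have rd: "real_distribution (\<nu>n n)" for n
    unfolding \<nu>n_def real_distribution_def real_distribution_axioms_def
    by (auto intro!: prob_space.prob_space_distr p simp: m\<mu>)
  \<comment> \<open>Codes lie in the unit interval, so the images are tight in any case. The
    tightness of \<open>\<mu>\<close> enters in \<open>Wsmall\<close>, where it keeps the limit from
    charging reals that decode to no point.\<close>
  have "Helly_Selection.tight \<nu>n"
    unfolding tight_def
  proof (intro conjI allI impI)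
    fix e :: real assume "0 < e"
    show "\<exists>a b. a < b \<and> (\<forall>n. 1 - e < measure (\<nu>n n) {a<..b})"
    proof (rule exI[of _ "-1"], rule exI[of _ 1], intro conjI allI)
      fix n
      have "\<phi> y \<in> {-1<..1}" for y
        using cantor_sum_bounds[of "\<lambda>j. b j y"] b01 unfolding \<phi>_def by fastforce
      then have "\<phi> -` {-1<..1} \<inter> space (\<mu> n) = space (\<mu> n)" by auto
      then have "measure (\<nu>n n) {-1<..1} = 1"
        unfolding \<nu>n_def by (subst measure_distr) (auto simp: m\<mu> prob_space.prob_space[OF p])
      then show "1 - e < measure (\<nu>n n) {-1<..1}" using \<open>0 < e\<close> by simp
    qed simp
  qed (rule rd)
  then obtain r \<nu> where r: "strict_mono (r :: nat \<Rightarrow> nat)" and \<nu>: "real_distribution \<nu>"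
    and wc: "weak_conv_m (\<nu>n \<circ> id \<circ> r) \<nu>"
    using tight_imp_convergent_subsubsequence[of \<nu>n id] by (auto simp: strict_mono_id)
  interpret \<nu>: real_distribution \<nu> by (rule \<nu>)
  have lim: "(\<lambda>n. \<integral>y. g (\<phi> y) \<partial>\<mu> (r n)) \<longlonglongrightarrow> (\<integral>u. g u \<partial>\<nu>)"
    if g: "\<And>u. isCont g u" "\<And>u. \<bar>g u\<bar> \<le> C" for g :: "real \<Rightarrow> real" and C
  proof -
    have gm: "g \<in> borel_measurable borel"
      using g(1) by (intro borel_measurable_continuous_onI continuous_at_imp_continuous_on) auto
    have "(\<lambda>n. \<integral>u. g u \<partial>(\<nu>n \<circ> id \<circ> r) n) \<longlonglongrightarrow> (\<integral>u. g u \<partial>\<nu>)"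
      using weak_conv_imp_integral_bdd_continuous_conv[where B=C, OF _ _ wc g(1)] g rd \<nu> by auto
    then show ?thesis using gm by (simp add: \<nu>n_def integral_distr m\<mu>)
  qed
  define D where "D m i = digit3 (prod_encode (m, i))" for m i :: nat
  have D_dig: "D m i (\<phi> y) = indicator (ball (x i) (1 / 2 ^ m)) y" for m i y
    by (simp add: D_def dig b_def B_def)
  have D_bd: "0 \<le> D m i u" "D m i u \<le> 1" for m i u by (simp_all add: D_def digit3_bounds)
  have D_cont: "isCont (D m i) u" for m i u by (simp add: D_def isCont_digit3)
  have [measurable]: "D m i \<in> borel_measurable borel" for m i by (simp add: D_def)
  \<comment> \<open>On codes, \<open>W m N\<close> indicates that none of the first \<open>N\<close>
    balls of radius \<open>1 / 2 ^ m\<close> contains the point.\<close>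
  define W where "W m N u = (\<Prod>i<N. 1 - D m i u)" for m N u
  have W_bd: "0 \<le> W m N u" "W m N u \<le> 1" for m N u
    unfolding W_def using D_bd by (auto intro!: prod_nonneg prod_le_1)
  have W_cont: "isCont (W m N) u" for m N u
    unfolding W_def by (intro continuous_intros D_cont)
  have [measurable]: "W m N \<in> borel_measurable borel" for m N
    unfolding W_def by measurable
  \<comment> \<open>The transfer principle: a nonnegative continuous function of the digits that
    vanishes on all codes has integral 0 under the limit. \<open>ae1\<close> and \<open>ae2\<close>
    use it for products expressing that digits are 0 or 1 and that disjoint balls are never both
    selected.\<close>
  have zero: "AE u in \<nu>. g u = 0"
    if g: "\<And>u. isCont g u" "\<And>u. \<bar>g u\<bar> \<le> 1" "\<And>u. 0 \<le> g u" "\<And>y. g (\<phi> y) = 0" for g :: "real \<Rightarrow> real"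
  proof -
    have gm: "g \<in> borel_measurable \<nu>"
      using g(1) by (simp add: borel_measurable_continuous_onI continuous_at_imp_continuous_on)
    have "(\<integral>u. g u \<partial>\<nu>) = 0"
      using lim[OF g(1,2)] g(4) by (simp add: LIMSEQ_const_iff)
    moreover have "integrable \<nu> g" using gm g(2) by (rule \<nu>.integrable_bounded)
    ultimately show ?thesis using g(3) by (subst (asm) integral_nonneg_eq_0_iff_AE) auto
  qed
  have ae1: "AE u in \<nu>. D m i u * (1 - D m i u) = 0" for m i
  proof (rule zero)
    show "isCont (\<lambda>u. D m i u * (1 - D m i u)) u" for u by (intro continuous_intros D_cont)
    show "\<bar>D m i u * (1 - D m i u)\<bar> \<le> 1" for u
      using D_bd[of m i u] by (simp add: abs_mult mult_le_one)
  qed (use D_bd in \<open>auto simp: D_dig split: split_indicator\<close>)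
  have ae2: "AE u in \<nu>. D m i u * D m' i' u = 0"
    if "ball (x i) (1 / 2 ^ m) \<inter> ball (x i') (1 / 2 ^ m') = {}" for m i m' i'
  proof (rule zero)
    show "isCont (\<lambda>u. D m i u * D m' i' u) u" for u by (intro continuous_intros D_cont)
    show "\<bar>D m i u * D m' i' u\<bar> \<le> 1" for u
      using D_bd[of m i u] D_bd[of m' i' u] by (simp add: abs_mult mult_le_one)
    show "D m i (\<phi> y) * D m' i' (\<phi> y) = 0" for y
      using that by (auto simp: D_dig split: split_indicator)
  qed (use D_bd in auto)
  have W_\<phi>: "W m N (\<phi> y) = indicator (- (\<Union>i<N. ball (x i) (1 / 2 ^ m))) y" for m N y
    unfolding W_def D_dig
    by (subst first_one_sum(2)) (auto split: split_indicator)
  have Wsmall: "\<exists>N. (\<forall>n. (\<integral>y. W m N (\<phi> y) \<partial>\<mu> n) \<le> e) \<and> (\<integral>u. W m N u \<partial>\<nu>) \<le> e" if "0 < e" for e m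
  proof -
    obtain N where N: "\<And>n. 1 - e \<le> measure (\<mu> n) (\<Union>i<N. ball (x i) (1 / 2 ^ m))"
      using tight[OF \<open>0 < e\<close>, of "1 / 2 ^ m"] by auto
    have le: "(\<integral>y. W m N (\<phi> y) \<partial>\<mu> n) \<le> e" for n
    proof -
      interpret prob_space "\<mu> n" by (rule p)
      have "(\<integral>y. W m N (\<phi> y) \<partial>\<mu> n) = measure (\<mu> n) (space (\<mu> n) - (\<Union>i<N. ball (x i) (1 / 2 ^ m)))"
        unfolding W_\<phi> by (simp add: sp Compl_eq_Diff_UNIV)
      also have "\<dots> = 1 - measure (\<mu> n) (\<Union>i<N. ball (x i) (1 / 2 ^ m))"
        by (rule prob_compl) (auto simp: sets)
      finally show ?thesis using N[of n] by linarith
    qed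
    have "(\<integral>u. W m N u \<partial>\<nu>) \<le> e"
      using lim[OF W_cont, of m N 1] W_bd le by (intro LIMSEQ_le_const2) auto
    with le show ?thesis by blast
  qed
  have ae3: "AE u in \<nu>. \<exists>i. D m i u = 1" for m
  proof -
    \<comment> \<open>On this exceptional set all digits of scale \<open>m\<close> are 0, so
      \<open>W m N\<close> equals 1 there for every \<open>N\<close>, while its integral is as small
      as desired.\<close>
    define E where "E = {u \<in> space \<nu>. (\<forall>i. D m i u \<noteq> 1) \<and> (\<forall>i. D m i u * (1 - D m i u) = 0)}"
    have E_sets [measurable]: "E \<in> sets \<nu>" unfolding E_def by measurable
    have "measure \<nu> E \<le> e" if "0 < e" for e
    proof -
      obtain N where N: "(\<integral>u. W m N u \<partial>\<nu>) \<le> e" using Wsmall[OF \<open>0 < e\<close>, of m] by blast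
      have "measure \<nu> E = (\<integral>u. indicator E u \<partial>\<nu>)" by simp
      also have "\<dots> \<le> (\<integral>u. W m N u \<partial>\<nu>)"
      proof (rule integral_mono)
        show "integrable \<nu> (W m N)"
          by (rule \<nu>.integrable_bounded[where C=1]) (use W_bd in auto)
        fix u
        show "indicator E u \<le> W m N u"
        proof (cases "u \<in> E")
          case True
          then have "D m i u = 0" for i by (auto simp: E_def)
          then show ?thesis using True by (simp add: W_def)
        qed (use W_bd in auto)
        show "integrable \<nu> (indicat_real E)"
          by (rule \<nu>.integrable_bounded[where C=1]) auto
      qed
      finally show ?thesis using N by simp
    qed
    then have "measure \<nu> E \<le> 0" by (rule field_le_epsilon) simp
    then have "measure \<nu> E = 0" by (simp add: measure_le_0_iff)
    then have "E \<in> null_sets \<nu>" using E_sets by (auto simp: null_sets_def \<nu>.emeasure_eq_measure)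
    then have "AE u in \<nu>. u \<notin> E" by (rule AE_not_in)
    moreover have "AE u in \<nu>. \<forall>i. D m i u * (1 - D m i u) = 0"
      using ae1 by (simp add: AE_all_countable)
    ultimately show ?thesis by eventually_elim (auto simp: E_def)
  qed
  \<comment> \<open>What decoding requires: at each scale some ball is selected, and any two
    selected balls meet, so that their centres form a Cauchy sequence.\<close>
  define good where "good u \<longleftrightarrow> (\<forall>m i. D m i u * (1 - D m i u) = 0) \<and> (\<forall>m. \<exists>i. D m i u = 1)
    \<and> (\<forall>m i m' i'. ball (x i) (1 / 2 ^ m) \<inter> ball (x i') (1 / 2 ^ m') = {} \<longrightarrow> D m i u * D m' i' u = 0)" for u
  have good_meas [measurable]: "Measurable.pred borel good"
    unfolding good_def by measurable
  have ae: "AE u in \<nu>. good u"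
    unfolding good_def using ae1 ae2 ae3 by (simp add: AE_all_countable AE_conj_iff)
  define I where "I m u = (LEAST i. D m i u = 1)" for m u
  \<comment> \<open>Outside \<open>good\<close> the constant value \<open>x 0\<close> keeps the
    sequence measurable and Cauchy for every real \<open>u\<close>.\<close>
  define pt where "pt m u = (if good u then x (I m u) else x 0)" for m u
  have DI: "D m (I m u) u = 1" if "good u" for m u
    using that unfolding I_def good_def by (meson LeastI_ex)
  have dpt: "dist (pt m u) (pt m' u) < 1 / 2 ^ m + 1 / 2 ^ m'" for m m' u
  proof (cases "good u")
    case True
    then have "ball (x (I m u)) (1 / 2 ^ m) \<inter> ball (x (I m' u)) (1 / 2 ^ m') \<noteq> {}"
      using DI[OF True, of m] DI[OF True, of m'] unfolding good_def by fastforce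
    then obtain y where "dist (x (I m u)) y < 1 / 2 ^ m" "dist (x (I m' u)) y < 1 / 2 ^ m'"
      by auto
    then show ?thesis using True dist_triangle2[of "x (I m u)" "x (I m' u)" y]
      by (simp add: pt_def)
  qed (simp add: pt_def add_pos_pos)
  have "Cauchy (\<lambda>m. pt m u)" for u
  proof (rule metric_CauchyI)
    fix e :: real assume "0 < e"
    then obtain M where M: "1 / 2 ^ M < e / 2"
      using real_arch_pow_inv[of "e / 2" "1 / 2"] by (auto simp: power_one_over)
    have "1 / 2 ^ m \<le> (1 / 2 ^ M :: real)" if "M \<le> m" for m
      using that by (intro divide_left_mono power_increasing) auto
    then show "\<exists>M. \<forall>m\<ge>M. \<forall>n\<ge>M. dist (pt m u) (pt n u) < e"
      using M dpt[of _ u] by (intro exI[of _ M]) (smt (verit) field_sum_of_halves)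
  qed
  then have "\<exists>z. (\<lambda>m. pt m u) \<longlonglongrightarrow> z" for u
    by (simp add: Cauchy_convergent_iff convergent_def)
  then obtain X where X: "\<And>u. (\<lambda>m. pt m u) \<longlonglongrightarrow> X u" by metis
  have I_meas [measurable]: "I m \<in> borel \<rightarrow>\<^sub>M count_space UNIV" for m
    unfolding I_def by measurable
  have pt_meas [measurable]: "pt m \<in> borel \<rightarrow>\<^sub>M borel" for m
    unfolding pt_def by measurable
  have X_meas [measurable]: "X \<in> borel \<rightarrow>\<^sub>M borel"
    by (rule borel_measurable_LIMSEQ_metric[OF pt_meas X])
  have dX: "dist (pt m u) (X u) \<le> 1 / 2 ^ m" for m u
  proof (rule LIMSEQ_le)
    show "(\<lambda>k. dist (pt m u) (pt k u)) \<longlonglongrightarrow> dist (pt m u) (X u)"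
      by (intro tendsto_intros X)
    have "(\<lambda>k. 1 / 2 ^ m + (1 / 2) ^ k :: real) \<longlonglongrightarrow> 1 / 2 ^ m + 0"
      by (intro tendsto_intros LIMSEQ_power_zero) auto
    then show "(\<lambda>k. 1 / 2 ^ m + 1 / 2 ^ k :: real) \<longlonglongrightarrow> 1 / 2 ^ m"
      by (simp add: power_one_over)
  qed (use dpt in \<open>auto intro!: exI less_imp_le\<close>)
  define m where "m = distr \<nu> borel X"
  show ?thesis
  proof (intro exI[of _ r] exI[of _ m] conjI ballI r)
    show "prob_space m" unfolding m_def by (rule \<nu>.prob_space_distr) simp
    show "sets m = sets borel" by (simp add: m_def)
    fix f :: "'a \<Rightarrow> real" assume f: "f \<in> bounded_lipschitz"
    then obtain C L where C: "0 \<le> C" "\<And>y. \<bar>f y\<bar> \<le> C" and L: "0 \<le> L" "\<And>y y'. \<bar>f y - f y'\<bar> \<le> L * dist y y'"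
      by (rule bounded_lipschitzE) blast
    have fm [measurable]: "f \<in> borel_measurable borel" by (rule bounded_lipschitz_measurable[OF f])
    show "(\<lambda>n. \<integral>y. f y \<partial>\<mu> (r n)) \<longlonglongrightarrow> (\<integral>y. f y \<partial>m)"
    proof (rule LIMSEQ_I)
      fix e :: real assume e: "0 < e"
      \<comment> \<open>The final error is twice \<open>(L + C) * e'\<close>, from the estimates
        \<open>1\<close> and \<open>2\<close>, plus \<open>e / 4\<close> from the convergence of the
        codes.\<close>
      define e' where "e' = e / (4 * (L + C + 1))"
      have e': "0 < e'" "(L + C) * e' < e / 4"
        using e C(1) L(1) by (auto simp: e'_def field_simps add_pos_nonneg)
      obtain k where k: "1 / 2 ^ k < e'"
        using real_arch_pow_inv[of e' "1 / 2"] e' by (auto simp: power_one_over)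
      obtain N where N: "\<And>n. (\<integral>y. W k N (\<phi> y) \<partial>\<mu> n) \<le> e'" "(\<integral>u. W k N u \<partial>\<nu>) \<le> e'"
        using Wsmall[OF e'(1), of k] by blast
      \<comment> \<open>On codes, \<open>F\<close> is the value of \<open>f\<close> at the centre of
        the first ball of radius \<open>1 / 2 ^ k\<close> containing the point, and 0 if the first
        \<open>N\<close> balls all miss it.\<close>
      define F where "F u = (\<Sum>i<N. f (x i) * D k i u * (\<Prod>j<i. 1 - D k j u))" for u
      have F_cont: "isCont F u" for u unfolding F_def by (intro continuous_intros D_cont)
      have [measurable]: "F \<in> borel_measurable borel" unfolding F_def by measurable
      have F_bd: "\<bar>F u\<bar> \<le> real N * C" for u
      proof -
        have "\<bar>F u\<bar> \<le> (\<Sum>i<N. \<bar>f (x i) * D k i u * (\<Prod>j<i. 1 - D k j u)\<bar>)"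
          unfolding F_def by (rule sum_abs)
        also have "\<dots> \<le> (\<Sum>i<N. C)"
        proof (rule sum_mono)
          fix i
          have "\<bar>f (x i)\<bar> * (D k i u * (\<Prod>j<i. 1 - D k j u)) \<le> C * 1"
            using C W_bd[of k i u] D_bd[of k i u] unfolding W_def
            by (intro mult_mono mult_le_one mult_nonneg_nonneg) auto
          then show "\<bar>f (x i) * D k i u * (\<Prod>j<i. 1 - D k j u)\<bar> \<le> C"
            using W_bd[of k i u] D_bd[of k i u] unfolding W_def by (simp add: abs_mult mult.assoc)
        qed
        finally show ?thesis by simp
      qed
      \<comment> \<open>Stated for a real \<open>u\<close> and a point \<open>y\<close> separately,
        since it serves twice: for the codes \<open>u = \<phi> y\<close> and for the decoded points
        \<open>y = X u\<close>.\<close>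
      have approx: "\<bar>f y - F u\<bar> \<le> L * e' + C * W k N u"
        if bits: "\<And>i. D k i u = 0 \<or> D k i u = 1"
          and near: "\<And>i. D k i u = 1 \<Longrightarrow> i = (LEAST i. D k i u = 1) \<Longrightarrow> dist y (x i) \<le> 1 / 2 ^ k" for u y
      proof (cases "\<exists>i<N. D k i u = 1")
        case True
        define i0 where "i0 = (LEAST i. D k i u = 1)"
        have "\<exists>i. D k i u = 1" using True by blast
        then have "D k i0 u = 1" unfolding i0_def by (rule LeastI_ex)
        then have "dist y (x i0) \<le> e'" using near[OF _ i0_def] k by linarith
        then have "L * dist y (x i0) \<le> L * e'" using L(1) by (rule mult_left_mono)
        moreover have "F u = f (x i0)" unfolding F_def i0_def
          by (subst first_one_sum(1)[of "\<lambda>i. D k i u", OF bits]) (rule if_P[OF True])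
        ultimately show ?thesis
          using L(2)[of y "x i0"] mult_nonneg_nonneg[OF C(1) W_bd(1)[of k N u]] by linarith
      next
        case False
        have "F u = 0" unfolding F_def 
          by (subst first_one_sum(1)[of "\<lambda>i. D k i u", OF bits]) (rule if_not_P[OF False])
        moreover have "W k N u = 1" unfolding W_def 
          by (subst first_one_sum(2)[of "\<lambda>i. D k i u", OF bits]) (rule if_not_P[OF False])
        moreover have "0 \<le> L * e'" using L(1) e'(1) by simp
        ultimately show ?thesis using C(2)[of y] by simp
      qed
      have 1: "\<bar>(\<integral>y. f y \<partial>\<mu> n) - (\<integral>y. F (\<phi> y) \<partial>\<mu> n)\<bar> \<le> (L + C) * e'" for n
      proof -
        interpret prob_space "\<mu> n" by (rule p)
        have i: "integrable (\<mu> n) f" "integrable (\<mu> n) (\<lambda>y. F (\<phi> y))" "integrable (\<mu> n) (\<lambda>y. W k N (\<phi> y))"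
          using C(2) F_bd W_bd
          by (rule_tac integrable_bounded[where C=C] integrable_bounded[where C="real N * C"]
              integrable_bounded[where C=1]; simp add: m\<mu>)+
        have "\<bar>(\<integral>y. f y \<partial>\<mu> n) - (\<integral>y. F (\<phi> y) \<partial>\<mu> n)\<bar> \<le> (\<integral>y. \<bar>f y - F (\<phi> y)\<bar> \<partial>\<mu> n)"
          unfolding Bochner_Integration.integral_diff[OF i(1,2), symmetric] by (rule integral_abs_bound)
        also have "\<dots> \<le> (\<integral>y. L * e' + C * W k N (\<phi> y) \<partial>\<mu> n)"
        proof (rule integral_mono)
          fix y
          show "\<bar>f y - F (\<phi> y)\<bar> \<le> L * e' + C * W k N (\<phi> y)"
            by (rule approx)
              (auto simp: D_dig dist_commute split: split_indicator split_indicator_asm)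
        qed (use i in auto)
        also have "\<dots> = L * e' + C * (\<integral>y. W k N (\<phi> y) \<partial>\<mu> n)"
          using i by (simp add: prob_space)
        also have "\<dots> \<le> L * e' + C * e'" using N(1)[of n] C(1) by (intro add_left_mono mult_left_mono)
        finally show ?thesis by (simp add: algebra_simps)
      qed
      have 2: "\<bar>(\<integral>y. f y \<partial>m) - (\<integral>u. F u \<partial>\<nu>)\<bar> \<le> (L + C) * e'"
      proof -
        have i: "integrable \<nu> (\<lambda>u. f (X u))" "integrable \<nu> F" "integrable \<nu> (W k N)"
          using C(2) F_bd W_bd
          by (rule_tac \<nu>.integrable_bounded[where C=C] \<nu>.integrable_bounded[where C="real N * C"]
              \<nu>.integrable_bounded[where C=1]; simp)+
        have "(\<integral>y. f y \<partial>m) = (\<integral>u. f (X u) \<partial>\<nu>)" unfolding m_def by (rule integral_distr) auto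
        then have "\<bar>(\<integral>y. f y \<partial>m) - (\<integral>u. F u \<partial>\<nu>)\<bar> = \<bar>\<integral>u. f (X u) - F u \<partial>\<nu>\<bar>" using i by simp
        also have "\<dots> \<le> (\<integral>u. \<bar>f (X u) - F u\<bar> \<partial>\<nu>)" by (rule integral_abs_bound)
        also have "\<dots> \<le> (\<integral>u. L * e' + C * W k N u \<partial>\<nu>)"
        proof (rule integral_mono_AE)
          show "AE u in \<nu>. \<bar>f (X u) - F u\<bar> \<le> L * e' + C * W k N u"
            using ae
          proof eventually_elim
            case (elim u)
            show ?case
            proof (rule approx)
              show "D k i u = 0 \<or> D k i u = 1" for i using elim unfolding good_def by fastforce
              show "dist (X u) (x i) \<le> 1 / 2 ^ k" if "i = (LEAST i. D k i u = 1)" for i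
                using dX[of k u] elim that by (simp add: pt_def I_def dist_commute)
            qed
          qed
        qed (use i in auto)
        also have "\<dots> = L * e' + C * (\<integral>u. W k N u \<partial>\<nu>)" using i \<nu>.prob_space by simp
        also have "\<dots> \<le> L * e' + C * e'" using N(2) C(1) by (intro add_left_mono mult_left_mono)
        finally show ?thesis by (simp add: algebra_simps)
      qed
      obtain M where M: "\<And>n. M \<le> n \<Longrightarrow> norm ((\<integral>y. F (\<phi> y) \<partial>\<mu> (r n)) - (\<integral>u. F u \<partial>\<nu>)) < e / 4"
        using LIMSEQ_D[OF lim[OF F_cont F_bd], of "e / 4"] e by auto
      show "\<exists>M. \<forall>n\<ge>M. norm ((\<integral>y. f y \<partial>\<mu> (r n)) - (\<integral>y. f y \<partial>m)) < e"
      proof (intro exI allI impI)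
        fix n assume "M \<le> n"
        from M[OF this] 1[of "r n"] 2 e'(2) show "norm ((\<integral>y. f y \<partial>\<mu> (r n)) - (\<integral>y. f y \<partial>m)) < e"
          unfolding real_norm_def by linarith
      qed
    qed
  qed
qed

section \<open>Feller semigroups and their averages\<close>

lemma integral_uniform_Icc:
  fixes g :: "real \<Rightarrow> real"
  assumes "0 < t" and [measurable]: "g \<in> borel_measurable borel"
  shows "(\<integral>s. g s \<partial>uniform_measure lborel {0..t}) = (LINT s:{0..t}|lborel. g s) / t"
proof -
  have "uniform_measure lborel {0..t} = density lborel (\<lambda>s. ennreal (indicator {0..t} s / t))"
    unfolding uniform_measure_def
    using assms(1) by (intro density_cong) (auto simp: divide_ennreal[of 1 t, symmetric] split: split_indicator)
  then have "(\<integral>s. g s \<partial>uniform_measure lborel {0..t}) = (\<integral>s. (indicator {0..t} s / t) *\<^sub>R g s \<partial>lborel)"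
    using assms(1) by (simp add: integral_density)
  also have "\<dots> = (LINT s:{0..t}|lborel. g s) / t"
    unfolding set_lebesgue_integral_def integral_divide_zero[symmetric]
    by (intro Bochner_Integration.integral_cong) auto
  finally show ?thesis .
qed

lemma prob_space_uniform_Icc: "0 < t \<Longrightarrow> prob_space (uniform_measure lborel {0..t::real})"
  by (rule prob_space_uniform_measure) auto

text \<open>The kernels are total in time because the process will enter as
  \<open>P (max 0 s)\<close>. Measurability is joint in time and state, as Fubini's theorem for time
  averages demands.\<close>

locale feller_semigroup =
  fixes P :: "real \<Rightarrow> 'a::polish_space \<Rightarrow> 'a measure"
  assumes kernel_pair: "(\<lambda>(s, y). P s y) \<in> borel \<Otimes>\<^sub>M borel \<rightarrow>\<^sub>M prob_algebra borel"
    and semigroup: "0 \<le> s \<Longrightarrow> 0 \<le> t \<Longrightarrow> P (s + t) x = P s x \<bind> P t"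
    and feller: "0 \<le> t \<Longrightarrow> continuous_on UNIV f \<Longrightarrow> (\<And>x. \<bar>f x :: real\<bar> \<le> C) \<Longrightarrow>
      continuous_on UNIV (\<lambda>y. \<integral>w. f w \<partial>P t y)"
begin

definition av :: "real \<Rightarrow> ('a \<Rightarrow> real) \<Rightarrow> 'a \<Rightarrow> real" where
  "av t f x = (LINT s:{0..t}|lborel. \<integral>y. f y \<partial>P s x) / t"

text \<open>The law of the process at an independent time uniform on \<open>{0..t}\<close>. It makes
  averages of bounded functions plain expectations; \<open>av\<close> stays an iterated time
  integral, the form that also fits unbounded observables.\<close>

definition Q :: "real \<Rightarrow> 'a \<Rightarrow> 'a measure" where
  "Q t x = uniform_measure lborel {0..t} \<bind> (\<lambda>s. P s x)"

lemma kernel_pair_subprob [measurable]: "(\<lambda>(s, y). P s y) \<in> borel \<Otimes>\<^sub>M borel \<rightarrow>\<^sub>M subprob_algebra borel"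
  by (rule measurable_prob_algebraD[OF kernel_pair])

lemma P_comp [measurable (raw)]:
  assumes [measurable]: "g \<in> M \<rightarrow>\<^sub>M borel" "h \<in> M \<rightarrow>\<^sub>M borel"
  shows "(\<lambda>x. P (g x) (h x)) \<in> M \<rightarrow>\<^sub>M subprob_algebra borel"
  using measurable_compose[OF measurable_Pair[OF assms] kernel_pair_subprob] by simp

lemma P_meas: "P s \<in> borel \<rightarrow>\<^sub>M subprob_algebra borel"
  by measurable

lemma P_space: "prob_space (P s x)" and sets_P [simp, measurable_cong]: "sets (P s x) = sets borel"
  using measurable_space[OF kernel_pair, of "(s, x)"] by (auto simp: space_prob_algebra space_pair_measure)

lemma space_P [simp]: "space (P s x) = UNIV"
  using sets_eq_imp_space_eq[OF sets_P] by simp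

lemma integral_P_measurable [measurable (raw)]:
  fixes f :: "'a \<Rightarrow> real"
  assumes [measurable]: "f \<in> borel_measurable borel" "g \<in> M \<rightarrow>\<^sub>M borel" "h \<in> M \<rightarrow>\<^sub>M borel"
  shows "(\<lambda>x. \<integral>y. f y \<partial>P (g x) (h x)) \<in> borel_measurable M"
  by (rule measurable_compose[OF P_comp integral_measurable_subprob_algebra]) auto

lemma nn_integral_P_measurable [measurable (raw)]:
  fixes f :: "'a \<Rightarrow> ennreal"
  assumes [measurable]: "f \<in> borel_measurable borel" "g \<in> M \<rightarrow>\<^sub>M borel" "h \<in> M \<rightarrow>\<^sub>M borel"
  shows "(\<lambda>x. \<integral>\<^sup>+y. f y \<partial>P (g x) (h x)) \<in> borel_measurable M"
  by (rule measurable_compose[OF P_comp nn_integral_measurable_subprob_algebra]) auto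

lemma av_measurable [measurable]:
  assumes [measurable]: "f \<in> borel_measurable borel"
  shows "av t f \<in> borel_measurable borel"
  unfolding av_def set_lebesgue_integral_def by measurable

lemma abs_integral_P_le: "(\<And>y. \<bar>f y :: real\<bar> \<le> C) \<Longrightarrow> \<bar>\<integral>y. f y \<partial>P s x\<bar> \<le> C"
  by (rule prob_space.abs_integral_le_const[OF P_space])

lemma integrable_P: "f \<in> borel_measurable borel \<Longrightarrow> (\<And>y. \<bar>f y :: real\<bar> \<le> C) \<Longrightarrow> integrable (P s x) f"
  by (rule finite_measure.integrable_bounded[OF prob_space.finite_measure[OF P_space]]) simp_all

lemma P_meas_uniform: "(\<lambda>s. P s x) \<in> uniform_measure lborel {0..t} \<rightarrow>\<^sub>M subprob_algebra borel"
  by measurable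

lemma sets_Q [simp, measurable_cong]: "sets (Q t x) = sets borel"
  unfolding Q_def by (rule sets_bind) auto

lemma space_Q [simp]: "space (Q t x) = UNIV"
  using sets_eq_imp_space_eq[OF sets_Q] by simp

lemma prob_space_Q: "0 < t \<Longrightarrow> prob_space (Q t x)"
  unfolding Q_def
  by (intro prob_space.prob_space_bind[OF prob_space_uniform_Icc _ P_meas_uniform]) (auto simp: P_space)

lemma integral_Q:
  assumes t: "0 < t" and [measurable]: "f \<in> borel_measurable borel" and bd: "\<And>y. \<bar>f y\<bar> \<le> C"
  shows "(\<integral>y. f y \<partial>Q t x) = av t f x"
proof -
  interpret u: prob_space "uniform_measure lborel {0..t}" by (rule prob_space_uniform_Icc[OF t])
  have "(\<integral>\<^sup>+s. \<integral>\<^sup>+y. ennreal \<bar>f y\<bar> \<partial>P s x \<partial>uniform_measure lborel {0..t})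
      \<le> (\<integral>\<^sup>+s. \<integral>\<^sup>+y. ennreal C \<partial>P s x \<partial>uniform_measure lborel {0..t})"
    using bd by (intro nn_integral_mono ennreal_leI)
  also have "\<dots> = ennreal C"
    using prob_space.emeasure_space_1[OF P_space] u.emeasure_space_1 by simp
  finally have fin: "(\<integral>\<^sup>+s. \<integral>\<^sup>+y. ennreal \<bar>f y\<bar> \<partial>P s x \<partial>uniform_measure lborel {0..t}) < \<infinity>"
    by (rule le_less_trans) simp
  show ?thesis
    unfolding Q_def av_def
    by (subst integral_bind_of_finite[OF P_meas_uniform _ fin]) (auto simp: integral_uniform_Icc[OF t])
qed

lemma integrable_Q: "0 < t \<Longrightarrow> f \<in> borel_measurable borel \<Longrightarrow> (\<And>y. \<bar>f y :: real\<bar> \<le> C) \<Longrightarrow> integrable (Q t x) f"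
  by (rule finite_measure.integrable_bounded[OF prob_space.finite_measure[OF prob_space_Q]]) simp_all

lemma measure_Q:
  assumes "0 < t" and [measurable]: "A \<in> sets borel"
  shows "measure (Q t x) A = av t (indicator A) x"
  using integral_Q[OF assms(1), of "indicator A" 1 x] by simp

lemma abs_av_le:
  assumes "0 \<le> t" "f \<in> borel_measurable borel" "\<And>y. \<bar>f y\<bar> \<le> C"
  shows "\<bar>av t f x\<bar> \<le> C"
proof (cases "t = 0")
  case True
  \<comment> \<open>Division by 0 yields 0, so \<open>av 0 f x\<close> is 0 and the index
    \<open>n = 0\<close> of \<open>av (real n)\<close> does no harm.\<close>
  then show ?thesis using assms(3)[of undefined] by (simp add: av_def)
next
  case False
  then show ?thesis
    using assms prob_space.abs_integral_le_const[OF prob_space_Q[of t x], of f C] integral_Q[of t f C x]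
    by auto
qed

lemma av_mono:
  assumes "0 < t" "f \<in> borel_measurable borel" "g \<in> borel_measurable borel"
    "\<And>y. \<bar>f y\<bar> \<le> C" "\<And>y. \<bar>g y\<bar> \<le> D" "\<And>y. f y \<le> g y"
  shows "av t f x \<le> av t g x"
proof -
  have "(\<integral>y. f y \<partial>Q t x) \<le> (\<integral>y. g y \<partial>Q t x)"
    using assms by (intro integral_mono integrable_Q) auto
  then show ?thesis
    using integral_Q[OF assms(1,2,4)] integral_Q[OF assms(1,3,5)] by simp
qed

lemma continuous_av:
  assumes f: "continuous_on UNIV f" "\<And>x. \<bar>f x\<bar> \<le> C" and t: "0 < t"
  shows "continuous_on UNIV (av t f)"
proof -
  have [measurable]: "f \<in> borel_measurable borel" by (rule borel_measurable_continuous_onI[OF f(1)])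
  have C: "0 \<le> C" using f(2)[of undefined] by linarith
  have "(\<lambda>n. av t f (xs n)) \<longlonglongrightarrow> av t f x" if xs: "xs \<longlonglongrightarrow> x" for xs x
    unfolding av_def set_lebesgue_integral_def
  proof (intro tendsto_divide tendsto_const)
    show "(\<lambda>n. \<integral>s. indicator {0..t} s *\<^sub>R (\<integral>y. f y \<partial>P s (xs n)) \<partial>lborel)
      \<longlonglongrightarrow> (\<integral>s. indicator {0..t} s *\<^sub>R (\<integral>y. f y \<partial>P s x) \<partial>lborel)"
    proof (rule integral_dominated_convergence[where w="\<lambda>s. indicator {0..t} s * C"])
      show "AE s in lborel. (\<lambda>n. indicator {0..t} s *\<^sub>R (\<integral>y. f y \<partial>P s (xs n)))
        \<longlonglongrightarrow> indicator {0..t} s *\<^sub>R (\<integral>y. f y \<partial>P s x)"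
      proof (rule AE_I2)
        fix s
        show "(\<lambda>n. indicator {0..t} s *\<^sub>R (\<integral>y. f y \<partial>P s (xs n)))
          \<longlonglongrightarrow> indicator {0..t} s *\<^sub>R (\<integral>y. f y \<partial>P s x)"
        proof (cases "s \<in> {0..t}")
          case True
          then have "continuous_on UNIV (\<lambda>y. \<integral>w. f w \<partial>P s y)" using feller[OF _ f] by simp
          then have "isCont (\<lambda>y. \<integral>w. f w \<partial>P s y) x" by (simp add: continuous_on_eq_continuous_at)
          then have "(\<lambda>n. \<integral>w. f w \<partial>P s (xs n)) \<longlonglongrightarrow> (\<integral>w. f w \<partial>P s x)"
            using xs by (rule isCont_tendsto_compose)
          then show ?thesis using True by simp
        qed simp
      qed
      show "integrable lborel (\<lambda>s. indicator {0..t} s * C)"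
        using t by (intro integrable_mult_left integrable_real_indicator) auto
      show "AE s in lborel. norm (indicator {0..t} s *\<^sub>R (\<integral>y. f y \<partial>P s (xs n))) \<le> indicator {0..t} s * C" for n
        using abs_integral_P_le[OF f(2)] by (auto split: split_indicator)
    qed measurable
  qed (use t in simp)
  then show ?thesis
    by (simp add: continuous_on_sequentially o_def)
qed

section \<open>Averages tested against a subprobability law\<close>

context
  fixes \<nu> :: "'a measure" and f :: "'a \<Rightarrow> real" and C :: real
  assumes \<nu>: "subprob_space \<nu>" "sets \<nu> = sets borel"
    and f [measurable]: "f \<in> borel_measurable borel"
    and C: "0 \<le> C"
    and bd: "\<And>r. 0 \<le> r \<Longrightarrow> (\<integral>\<^sup>+y. \<integral>\<^sup>+w. ennreal \<bar>f w\<bar> \<partial>P r y \<partial>\<nu>) \<le> ennreal C"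
begin

lemma mean_P_meas_\<nu>: "P r \<in> \<nu> \<rightarrow>\<^sub>M subprob_algebra borel"
  using P_meas by (subst measurable_cong_sets[OF \<nu>(2) refl])

lemma mean_space_\<nu>: "space \<nu> \<noteq> {}"
  using sets_eq_imp_space_eq[OF \<nu>(2)] by simp

lemma mean_fin:
  assumes "0 \<le> r"
  shows "(\<integral>\<^sup>+y. \<integral>\<^sup>+w. ennreal \<bar>f w\<bar> \<partial>P r y \<partial>\<nu>) < \<infinity>"
  using bd[OF assms] by (rule le_less_trans) simp

lemma mean_P_le: 
  assumes "0 \<le> r"
  shows "\<bar>\<integral>w. f w \<partial>(\<nu> \<bind> P r)\<bar> \<le> C"
proof -
  have "integrable (\<nu> \<bind> P r) f"
    by (rule integrable_bind_of_finite[OF mean_P_meas_\<nu> f mean_fin[OF assms] mean_space_\<nu>])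
  then have "ennreal \<bar>\<integral>w. f w \<partial>(\<nu> \<bind> P r)\<bar> \<le> (\<integral>\<^sup>+w. ennreal \<bar>f w\<bar> \<partial>(\<nu> \<bind> P r))"
    using integral_norm_bound_ennreal by fastforce
  also have "\<dots> \<le> ennreal C"
    using bd[OF assms] by (subst nn_integral_bind[OF _ mean_P_meas_\<nu>]) auto
  finally show ?thesis using C by simp
qed

text \<open>Fubini's theorem, with \<open>C\<close> times the indicator of \<open>{0..t}\<close>
  bounding the inner means. Bounding the absolute means along the flow, instead of \<open>f\<close>
  itself, covers bounded observables, invariant laws and killed laws alike.\<close>

lemma
  assumes t: "0 \<le> t"
  shows integrable_av: "integrable \<nu> (av t f)"
    and integral_av: "(\<integral>y. av t f y \<partial>\<nu>) = (LINT r:{0..t}|lborel. \<integral>w. f w \<partial>(\<nu> \<bind> P r)) / t"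
proof -
  note \<nu>(2) [measurable_cong]
  interpret \<nu>: subprob_space \<nu> by (rule \<nu>(1))
  interpret pair_sigma_finite lborel \<nu> ..
  define h where "h r y = indicator {0..t} r *\<^sub>R (\<integral>w. f w \<partial>P r y)" for r y
  have hm [measurable]: "case_prod h \<in> borel_measurable (lborel \<Otimes>\<^sub>M \<nu>)"
    unfolding h_def by measurable
  have "(\<integral>\<^sup>+p. ennreal (norm (case_prod h p)) \<partial>(lborel \<Otimes>\<^sub>M \<nu>)) = (\<integral>\<^sup>+r. \<integral>\<^sup>+y. ennreal (norm (h r y)) \<partial>\<nu> \<partial>lborel)"
    by (subst \<nu>.nn_integral_fst[symmetric]) auto
  also have "\<dots> \<le> (\<integral>\<^sup>+r. ennreal C * indicator {0..t} r \<partial>lborel)"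
  proof (rule nn_integral_mono)
    fix r
    show "(\<integral>\<^sup>+y. ennreal (norm (h r y)) \<partial>\<nu>) \<le> ennreal C * indicator {0..t} r"
    proof (cases "r \<in> {0..t}")
      case True
      have "ennreal \<bar>\<integral>w. f w \<partial>P r y\<bar> \<le> (\<integral>\<^sup>+w. ennreal \<bar>f w\<bar> \<partial>P r y)" for y
      proof (cases "integrable (P r y) f")
        case True
        then show ?thesis using integral_norm_bound_ennreal by fastforce
      qed (simp add: not_integrable_integral_eq)
      then have "(\<integral>\<^sup>+y. ennreal (norm (h r y)) \<partial>\<nu>) \<le> (\<integral>\<^sup>+y. \<integral>\<^sup>+w. ennreal \<bar>f w\<bar> \<partial>P r y \<partial>\<nu>)"
        using True by (intro nn_integral_mono) (simp add: h_def)
      also have "\<dots> \<le> ennreal C" using bd True by simp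
      finally show ?thesis using True by simp
    qed (simp add: h_def)
  qed
  also have "\<dots> < \<infinity>" using t by (simp add: nn_integral_cmult ennreal_mult_less_top)
  finally have int: "integrable (lborel \<Otimes>\<^sub>M \<nu>) (case_prod h)"
    by (intro integrableI_bounded) auto
  have av_h: "av t f y = (\<integral>r. h r y \<partial>lborel) / t" for y
    by (simp add: av_def h_def set_lebesgue_integral_def)
  show "integrable \<nu> (av t f)"
    unfolding av_h using integrable_snd[OF int] by simp
  have "(\<integral>y. av t f y \<partial>\<nu>) = (\<integral>y. \<integral>r. h r y \<partial>lborel \<partial>\<nu>) / t"
    unfolding av_h by simp
  also have "(\<integral>y. \<integral>r. h r y \<partial>lborel \<partial>\<nu>) = (\<integral>r. \<integral>y. h r y \<partial>\<nu> \<partial>lborel)"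
    by (rule Fubini_integral[OF int])
  also have "\<dots> = (LINT r:{0..t}|lborel. \<integral>w. f w \<partial>(\<nu> \<bind> P r))"
    unfolding set_lebesgue_integral_def
  proof (rule Bochner_Integration.integral_cong[OF refl])
    fix r
    show "(\<integral>y. h r y \<partial>\<nu>) = indicator {0..t} r *\<^sub>R (\<integral>w. f w \<partial>(\<nu> \<bind> P r))"
      unfolding h_def using integral_bind_of_finite[OF mean_P_meas_\<nu> f mean_fin mean_space_\<nu>]
      by (auto split: split_indicator)
  qed
  finally show "(\<integral>y. av t f y \<partial>\<nu>) = (LINT r:{0..t}|lborel. \<integral>w. f w \<partial>(\<nu> \<bind> P r)) / t" .
qed

end

lemma subprob_bind_P: "subprob_space \<nu> \<Longrightarrow> sets \<nu> = sets borel \<Longrightarrow> subprob_space (\<nu> \<bind> P s)"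
  using P_meas by (intro subprob_space_bind[where N=borel]) (auto cong: measurable_cong_sets)

lemma sets_bind_P: "sets \<nu> = sets borel \<Longrightarrow> sets (\<nu> \<bind> P s) = sets borel"
  using sets_eq_imp_space_eq[of \<nu> borel] by (intro sets_bind) auto

lemma P_meas_cong: "sets \<nu> = sets borel \<Longrightarrow> P s \<in> \<nu> \<rightarrow>\<^sub>M subprob_algebra borel"
  using P_meas measurable_cong_sets by blast

lemma bind_P_P:
  assumes "sets \<nu> = sets borel" "0 \<le> s" "0 \<le> r"
  shows "(\<nu> \<bind> P s) \<bind> P r = \<nu> \<bind> P (s + r)"
  unfolding bind_assoc[OF P_meas_cong[OF assms(1)] P_meas] semigroup[OF assms(2,3), abs_def] ..

lemma nn_integral_bind_P:
  assumes "sets \<nu> = sets borel" "0 \<le> s" "0 \<le> r" and [measurable]: "g \<in> borel_measurable borel"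
  shows "(\<integral>\<^sup>+y. \<integral>\<^sup>+w. g w \<partial>P r y \<partial>(\<nu> \<bind> P s)) = (\<integral>\<^sup>+y. \<integral>\<^sup>+w. g w \<partial>P (s + r) y \<partial>\<nu>)"
proof -
  have "(\<integral>\<^sup>+y. \<integral>\<^sup>+w. g w \<partial>P r y \<partial>(\<nu> \<bind> P s)) = (\<integral>\<^sup>+w. g w \<partial>((\<nu> \<bind> P s) \<bind> P r))"
    by (subst nn_integral_bind[OF _ P_meas_cong[OF sets_bind_P[OF assms(1)]]]) auto
  also have "\<dots> = (\<integral>\<^sup>+w. g w \<partial>(\<nu> \<bind> P (s + r)))" by (simp add: bind_P_P assms)
  also have "\<dots> = (\<integral>\<^sup>+y. \<integral>\<^sup>+w. g w \<partial>P (s + r) y \<partial>\<nu>)"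
    by (subst nn_integral_bind[OF _ P_meas_cong[OF assms(1)]]) auto
  finally show ?thesis .
qed

text \<open>Letting the initial law evolve for a time \<open>s\<close> shifts the window of the time
  average by \<open>s\<close>. This is the source of the subinvariance of the merging error.\<close>

lemma integral_av_bind_P_diff_le:
  assumes \<nu>: "subprob_space \<nu>" "sets \<nu> = sets borel" and f [measurable]: "f \<in> borel_measurable borel"
    and C: "0 \<le> C"
    and bd: "\<And>r. 0 \<le> r \<Longrightarrow> (\<integral>\<^sup>+y. \<integral>\<^sup>+w. ennreal \<bar>f w\<bar> \<partial>P r y \<partial>\<nu>) \<le> ennreal C"
    and s: "0 \<le> s" and t: "0 < t"
  shows "\<bar>(\<integral>y. av t f y \<partial>(\<nu> \<bind> P s)) - (\<integral>y. av t f y \<partial>\<nu>)\<bar> \<le> 2 * C * s / t"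
proof -
  note \<nu>(2) [measurable_cong]
  have bd': "(\<integral>\<^sup>+y. \<integral>\<^sup>+w. ennreal \<bar>f w\<bar> \<partial>P r y \<partial>(\<nu> \<bind> P s)) \<le> ennreal C" if "0 \<le> r" for r
    using bd[of "s + r"] that s by (simp add: nn_integral_bind_P[OF \<nu>(2)])
  define \<phi> where "\<phi> r = (\<integral>w. f w \<partial>(\<nu> \<bind> P r))" for r
  have [measurable]: "\<phi> \<in> borel_measurable borel"
  proof -
    have "(\<lambda>r. \<nu> \<bind> P r) \<in> borel \<rightarrow>\<^sub>M subprob_algebra borel"
      by (rule measurable_bind[where N=borel])
        (use \<nu> in \<open>auto simp: space_subprob_algebra intro!: measurable_const\<close>)
    then show ?thesis unfolding \<phi>_def
      by (rule measurable_compose[OF _ integral_measurable_subprob_algebra]) simp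
  qed
  have "(\<integral>y. av t f y \<partial>(\<nu> \<bind> P s)) = (LINT r:{0..t}|lborel. \<phi> (s + r)) / t"
  proof -
    have "(LINT r:{0..t}|lborel. \<integral>w. f w \<partial>((\<nu> \<bind> P s) \<bind> P r)) = (LINT r:{0..t}|lborel. \<phi> (s + r))"
      unfolding \<phi>_def using s bind_P_P[OF \<nu>(2)] by (intro set_lebesgue_integral_cong) auto
    then show ?thesis
      using integral_av[OF subprob_bind_P[OF \<nu>] sets_bind_P[OF \<nu>(2)] f C bd'] t by simp
  qed
  moreover have "(\<integral>y. av t f y \<partial>\<nu>) = (LINT r:{0..t}|lborel. \<phi> r) / t"
    unfolding \<phi>_def using t by (intro integral_av[OF \<nu> f C bd]) auto
  ultimately show ?thesis
    using average_shift_diff_le[of \<phi> C s t] mean_P_le[OF \<nu> f C bd] s t by (simp add: \<phi>_def)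
qed

lemma integral_av_P_diff_le:
  assumes [measurable]: "f \<in> borel_measurable borel" and bd: "\<And>y. \<bar>f y\<bar> \<le> C" and s: "0 \<le> s" and t: "0 < t"
  shows "\<bar>(\<integral>y. av t f y \<partial>P s x) - av t f x\<bar> \<le> 2 * C * s / t"
proof -
  have "(\<integral>\<^sup>+w. ennreal \<bar>f w\<bar> \<partial>P r y) \<le> ennreal C" for r y
  proof -
    interpret prob_space "P r y" by (rule P_space)
    have "(\<integral>\<^sup>+w. ennreal \<bar>f w\<bar> \<partial>P r y) \<le> (\<integral>\<^sup>+w. ennreal C \<partial>P r y)"
      using bd by (intro nn_integral_mono ennreal_leI)
    then show ?thesis using emeasure_space_1 by simp
  qed
  moreover have "0 \<le> C" using bd[of undefined] by linarith
  moreover have "return borel x \<bind> P s = P s x"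
    using P_meas by (rule bind_return) simp
  moreover have "(\<integral>y. av t f y \<partial>return borel x) = av t f x"
    by (rule integral_return) auto
  ultimately show ?thesis
    using integral_av_bind_P_diff_le[of "return borel x" f C s t] s t
    by (simp add: nn_integral_return subprob_space_return)
qed

text \<open>Starting anywhere, the process reaches \<open>ball z r\<close> with probability at least \<open>c\<close>, and there the
  averages are within \<open>e\<close> of those at \<open>z\<close>; iterating \<open>k\<close> times leaves an error \<open>(1 - c) ^ k\<close>.\<close>

lemma averages_merge_bounded:
  assumes fm [measurable]: "f \<in> borel_measurable borel" and bd: "\<And>y. \<bar>f y\<bar> \<le> C"
    and ec: "\<And>e. 0 < e \<Longrightarrow> \<exists>r>0. \<forall>x\<in>ball z r. \<forall>\<^sub>F n in sequentially. \<bar>av (real n) f x - av (real n) f z\<bar> < e"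
    and lb: "\<And>r. 0 < r \<Longrightarrow> \<exists>c>0. \<forall>x. \<exists>s\<ge>0. c \<le> measure (P s x) (ball z r)"
  shows "(\<lambda>n. av (real n) f x - av (real n) f z) \<longlonglongrightarrow> 0"
proof -
  define u where "u n x = \<bar>av (real n) f x - av (real n) f z\<bar>" for n x
  have C: "0 \<le> C" using bd[of undefined] by linarith
  have [measurable]: "u n \<in> borel_measurable borel" for n unfolding u_def by measurable
  have u0: "0 \<le> u n x" for n x by (simp add: u_def)
  have u2: "u n x \<le> 2 * C" for n x
    using abs_av_le[OF _ fm bd, of "real n" x] abs_av_le[OF _ fm bd, of "real n" z] unfolding u_def by simp
  have "\<forall>\<^sub>F n in sequentially. u n x < 3 * e" if "0 < e" for e
  proof -
    obtain r where r: "0 < r" "\<And>x. x \<in> ball z r \<Longrightarrow> \<forall>\<^sub>F n in sequentially. u n x < e"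
      using ec[OF \<open>0 < e\<close>] unfolding u_def by blast
    obtain c where c: "0 < c" "\<And>x. \<exists>s\<ge>0. c \<le> measure (P s x) (ball z r)"
      using lb[OF r(1)] by blast
    have c1: "c \<le> 1"
    proof -
      obtain s where "c \<le> measure (P s z) (ball z r)" using c(2) by blast
      then show ?thesis using prob_space.prob_le_1[OF P_space, of s z "ball z r"] by linarith
    qed
    \<comment> \<open>\<open>2 * C\<close> is the trivial bound on \<open>u\<close>; each round
      shrinks the excess over \<open>e\<close> by the factor \<open>1 - c\<close>.
      \<open>\<delta>\<close> makes room for terms that are only eventually small.\<close>
    have iter: "\<forall>\<^sub>F n in sequentially. u n x < e + (1 - c) ^ k * (2 * C) + \<delta>" if "0 < \<delta>" for k x \<delta>
      using that
    proof (induction k arbitrary: x \<delta>)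
      case 0
      have "u n x < e + (1 - c) ^ 0 * (2 * C) + \<delta>" for n
        using u2[of n x] \<open>0 < e\<close> 0 by simp
      then show ?case by simp
    next
      case (Suc k)
      define w where "w = e + (1 - c) ^ k * (2 * C)"
      have we: "e \<le> w" using c1 C by (simp add: w_def)
      obtain s where s: "0 \<le> s" "c \<le> measure (P s x) (ball z r)" using c(2) by blast
      interpret p: prob_space "P s x" by (rule P_space)
      \<comment> \<open>The eventual bound on \<open>u n\<close>: \<open>e\<close> on the ball, the
        induction bound \<open>w\<close> elsewhere. The index from which it holds depends on the
        point, so it is integrated through the positive part of \<open>u n - h\<close>, which is
        dominated and tends to 0 pointwise.\<close>
      define h where "h y = (if y \<in> ball z r then e else w)" for y
      have [measurable]: "h \<in> borel_measurable borel" unfolding h_def by (intro measurable_If_set) auto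
      have hw: "0 \<le> h y" "h y \<le> w" for y using we \<open>0 < e\<close> by (auto simp: h_def)
      have lim: "(\<lambda>n. max 0 (u n y - h y)) \<longlonglongrightarrow> 0" for y
      proof (rule LIMSEQ_I)
        fix \<eta> :: real assume "0 < \<eta>"
        have "\<forall>\<^sub>F n in sequentially. u n y < h y + \<eta>"
        proof (cases "y \<in> ball z r")
          case True
          then show ?thesis using r(2)[OF True] \<open>0 < \<eta>\<close> by (auto simp: h_def elim: eventually_mono)
        next
          case False
          then show ?thesis using Suc.IH[OF \<open>0 < \<eta>\<close>, of y] by (simp add: h_def w_def)
        qed
        then show "\<exists>N. \<forall>n\<ge>N. norm (max 0 (u n y - h y) - 0) < \<eta>"
          using \<open>0 < \<eta>\<close> unfolding eventually_sequentially by (auto simp: max_def algebra_simps)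
      qed
      have "(\<lambda>n. \<integral>y. max 0 (u n y - h y) \<partial>P s x) \<longlonglongrightarrow> (\<integral>y. 0 \<partial>P s x)"
      proof (rule integral_dominated_convergence[where w="\<lambda>_. 2 * C"])
        show "AE y in P s x. norm (max 0 (u n y - h y)) \<le> 2 * C" for n
        proof (rule AE_I2)
          fix y show "norm (max 0 (u n y - h y)) \<le> 2 * C"
            using u2[of n y] u0[of n y] hw(1)[of y] C by (auto simp: max_def)
        qed
      qed (use lim in auto)
      then have "\<forall>\<^sub>F n in sequentially. (\<integral>y. max 0 (u n y - h y) \<partial>P s x) < \<delta> / 2"
        using Suc.prems by (intro order_tendstoD) auto
      moreover have "(\<lambda>n. 2 * C * s / real n) \<longlonglongrightarrow> 0"
        by (intro tendsto_divide_0[OF tendsto_const] filterlim_at_top_imp_at_infinity filterlim_real_sequentially)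
      then have "\<forall>\<^sub>F n in sequentially. 2 * C * s / real n < \<delta> / 2"
        using Suc.prems by (intro order_tendstoD) auto
      ultimately show ?case
        using eventually_gt_at_top[of 0]
      proof eventually_elim
        case (elim n)
        have iu: "integrable (P s x) (u n)" by (rule integrable_P[where C="2 * C"]) (use u2 u0 in auto)
        have ih: "integrable (P s x) h" by (rule integrable_P[where C=w]) (use hw in auto)
        have ia: "integrable (P s x) (av (real n) f)"
          by (rule integrable_P[where C=C]) (use abs_av_le[OF _ fm bd] in auto)
        have im: "integrable (P s x) (\<lambda>y. max 0 (u n y - h y))"
          using iu ih by auto
        have "u n x \<le> \<bar>(\<integral>y. av (real n) f y \<partial>P s x) - av (real n) f z\<bar> + 2 * C * s / real n"
          using integral_av_P_diff_le[OF fm bd s(1), of "real n" x] elim(3) unfolding u_def by linarith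
        also have "(\<integral>y. av (real n) f y \<partial>P s x) - av (real n) f z = (\<integral>y. av (real n) f y - av (real n) f z \<partial>P s x)"
          using ia p.prob_space by simp
        also have "\<bar>\<dots>\<bar> \<le> (\<integral>y. u n y \<partial>P s x)"
          unfolding u_def by (rule integral_abs_bound)
        also have "(\<integral>y. u n y \<partial>P s x) \<le> (\<integral>y. h y + max 0 (u n y - h y) \<partial>P s x)"
          by (rule integral_mono) (use iu ih im in auto)
        also have "\<dots> = (\<integral>y. h y \<partial>P s x) + (\<integral>y. max 0 (u n y - h y) \<partial>P s x)"
          using ih im by simp
        also have "(\<integral>y. h y \<partial>P s x) = (\<integral>y. w - (w - e) * indicator (ball z r) y \<partial>P s x)"
          by (rule Bochner_Integration.integral_cong) (auto simp: h_def split: split_indicator)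
        also have "\<dots> = w - (w - e) * measure (P s x) (ball z r)"
          using p.prob_space by (subst Bochner_Integration.integral_diff)
            (auto intro!: integrable_P[where C="1"] integrable_mult_right borel_measurable_indicator)
        also have "\<dots> \<le> w - (w - e) * c"
          using we s(2) by (simp add: mult_left_mono)
        also have "\<dots> = e + (1 - c) ^ Suc k * (2 * C)" by (simp add: w_def algebra_simps)
        finally show ?case using elim(1,2) by linarith
      qed
    qed
    have "(\<lambda>k. (1 - c) ^ k * (2 * C)) \<longlonglongrightarrow> 0 * (2 * C)"
      using c(1) c1 by (intro tendsto_intros LIMSEQ_power_zero) auto
    then have "\<forall>\<^sub>F k in sequentially. (1 - c) ^ k * (2 * C) < e"
      using \<open>0 < e\<close> by (intro order_tendstoD) auto
    then obtain k where k: "(1 - c) ^ k * (2 * C) < e" by (auto simp: eventually_sequentially)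
    show ?thesis
      using iter[OF \<open>0 < e\<close>, of x k] by (rule eventually_mono) (use k in linarith)
  qed
  from this[of "e / 3" for e] have "\<forall>\<^sub>F n in sequentially. u n x < e" if "0 < e" for e
    using that by simp
  then show ?thesis
    unfolding u_def tendsto_iff by (simp add: dist_real_def)
qed

end

section \<open>Separated families of bumps and the Baire category argument\<close>

lemma bump_posD:
  assumes "0 < bump A d x" "0 < d" "A \<noteq> {}"
  obtains a where "a \<in> A" "dist x a < d"
proof -
  have "infdist x A < d" using assms bump_pos_iff by blast
  then have "\<exists>a\<in>A. dist x a < d"
    using assms(3) by (auto simp: infdist_def cINF_less_iff[OF _ bdd_belowI2[where m=0]])
  then show ?thesis using that by blast
qed

lemma bump_ball_le_indicator:
  assumes "0 < r"
  shows "bump (ball z (r / 2)) (r / 2) y \<le> indicator (ball z r) y"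
proof (cases "0 < bump (ball z (r / 2)) (r / 2) y")
  case True
  then obtain w where "w \<in> ball z (r / 2)" "dist y w < r / 2"
    by (rule bump_posD) (use assms in auto)
  then have "dist z y < r" using dist_triangle2[of z y w] by simp
  then show ?thesis using assms by simp
next
  case False
  then have "bump (ball z (r / 2)) (r / 2) y = 0" using bump_nonneg[of "ball z (r / 2)" "r / 2" y] by linarith
  then show ?thesis by simp
qed

definition bump_sum :: "(nat \<Rightarrow> 'a::metric_space set) \<Rightarrow> real \<Rightarrow> nat set \<Rightarrow> 'a \<Rightarrow> real" where
  "bump_sum A d J x = (\<Sum>k. if k \<in> J then bump (A k) d x else 0)"

context
  fixes A :: "nat \<Rightarrow> 'a::metric_space set" and d :: real
  assumes d: "0 < d" and ne: "\<And>k. A k \<noteq> {}"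
    and sep: "\<And>j k a b. j \<noteq> k \<Longrightarrow> a \<in> A j \<Longrightarrow> b \<in> A k \<Longrightarrow> 2 * d \<le> dist a b"
begin

text \<open>Points of \<open>A j\<close> and of \<open>A k\<close> that both lie within
  \<open>d\<close> of \<open>x\<close> would be less than \<open>2 * d\<close> apart.\<close>

lemma bump_disjoint:
  assumes "0 < bump (A j) d x" "0 < bump (A k) d x"
  shows "j = k"
proof (rule ccontr)
  assume "j \<noteq> k"
  obtain a where a: "a \<in> A j" "dist x a < d" using bump_posD[OF assms(1) d ne] .
  obtain b where b: "b \<in> A k" "dist x b < d" using bump_posD[OF assms(2) d ne] .
  have "dist a b \<le> dist x a + dist x b" using dist_triangle3[of a b x] by simp
  then show False using sep[OF \<open>j \<noteq> k\<close> a(1) b(1)] a b by linarith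
qed

lemma finite_bump_support: "finite {k. bump (A k) d x \<noteq> 0}"
proof (cases "\<exists>k. bump (A k) d x \<noteq> 0")
  case True
  then obtain k where "bump (A k) d x \<noteq> 0" by blast
  then have k: "0 < bump (A k) d x" by (simp add: less_le)
  have "{k. bump (A k) d x \<noteq> 0} \<subseteq> {k}"
  proof
    fix j assume "j \<in> {k. bump (A k) d x \<noteq> 0}"
    then have "0 < bump (A j) d x" by (simp add: less_le)
    then show "j \<in> {k}" using bump_disjoint[OF _ k] by simp
  qed
  then show ?thesis by (rule finite_subset) simp
qed simp

lemma summable_bump_sum: "summable (\<lambda>k. if k \<in> J then bump (A k) d x else 0)"
  by (rule summable_finite[OF finite_bump_support[of x]]) auto

lemma bump_sum_ge: "k \<in> J \<Longrightarrow> bump (A k) d x \<le> bump_sum A d J x"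
  using sum_le_suminf[OF summable_bump_sum[of J x], of "{k}"] by (simp add: bump_sum_def)

lemma bump_sum_nonneg: "0 \<le> bump_sum A d J x"
  unfolding bump_sum_def by (rule suminf_nonneg[OF summable_bump_sum]) simp

lemma bump_sum_cases:
  obtains "bump_sum A d J x = 0" | k where "k \<in> J" "bump_sum A d J x = bump (A k) d x"
proof (cases "\<exists>k\<in>J. 0 < bump (A k) d x")
  case True
  then obtain k where k: "k \<in> J" "0 < bump (A k) d x" by blast
  have "bump (A j) d x = 0" if "j \<noteq> k" for j
    using bump_disjoint[OF k(2), of j] that bump_nonneg[of "A j" d x] by (auto simp: less_le)
  then have "bump_sum A d J x = bump (A k) d x"
    unfolding bump_sum_def using k by (subst suminf_finite[of "{k}"]) auto
  with k that(2) show ?thesis by blast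
next
  case False
  then have "\<And>k. k \<in> J \<Longrightarrow> bump (A k) d x = 0"
    by (meson bump_nonneg antisym not_less)
  then have "bump_sum A d J x = 0" unfolding bump_sum_def by (subst suminf_finite[of "{}"]) auto
  then show ?thesis by (rule that(1))
qed

lemma bump_sum_le_1: "bump_sum A d J x \<le> 1"
  by (rule bump_sum_cases[of J x]) (use d in auto)

text \<open>The constant \<open>1 / d\<close> is the same for every \<open>J\<close>: at most one
  bump is positive at \<open>x\<close>, and the sum at \<open>y\<close> is at least that same bump
  at \<open>y\<close>.\<close>

lemma bump_sum_bounded_lipschitz: "bump_sum A d J \<in> bounded_lipschitz"
proof (rule bounded_lipschitzI[where C=1 and L="1/d"])
  fix x y :: 'a
  show "\<bar>bump_sum A d J x\<bar> \<le> 1" using bump_sum_nonneg[of J x] bump_sum_le_1[of J x] by simp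
  show "bump_sum A d J x - bump_sum A d J y \<le> 1 / d * dist x y"
  proof (rule bump_sum_cases[of J x])
    assume "bump_sum A d J x = 0"
    moreover have "0 \<le> 1 / d * dist x y" using d by simp
    ultimately show ?thesis using bump_sum_nonneg[of J y] by linarith
  next
    fix k assume "k \<in> J" "bump_sum A d J x = bump (A k) d x"
    then show ?thesis using bump_sum_ge[of k J y] bump_diff_le[OF d, of "A k" x y] by simp
  qed
qed (use d in simp)

lemma sum_bump_le_1: "(\<Sum>k\<in>J. bump (A k) d x) \<le> 1" if "finite J"
proof -
  have "(\<Sum>k\<in>J. bump (A k) d x) = bump_sum A d J x"
    unfolding bump_sum_def using that by (subst suminf_finite[of J]) auto
  then show ?thesis using bump_sum_le_1 by simp
qed

lemma bump_sum_integral: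
  assumes M: "prob_space M" and s: "sets M = sets borel"
  shows "summable (\<lambda>k. \<integral>x. bump (A k) d x \<partial>M)"
    and "(\<integral>x. bump_sum A d J x \<partial>M) = (\<Sum>k. if k \<in> J then \<integral>x. bump (A k) d x \<partial>M else 0)"
proof -
  interpret prob_space M by fact
  have i: "integrable M (bump (A k) d)" for k
    using bounded_lipschitz_measurable[OF bump_bounded_lipschitz[OF d]] d measurable_cong_sets[OF s refl]
    by (intro integrable_bounded[where C=1]) auto
  have nn: "0 \<le> (\<integral>x. bump (A k) d x \<partial>M)" for k by simp
  show sm: "summable (\<lambda>k. \<integral>x. bump (A k) d x \<partial>M)"
  proof (rule bounded_imp_summable[where B=1])
    fix n
    have "(\<Sum>k\<le>n. \<integral>x. bump (A k) d x \<partial>M) = (\<integral>x. (\<Sum>k\<le>n. bump (A k) d x) \<partial>M)"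
      using i by (intro Bochner_Integration.integral_sum[symmetric])
    also have "\<dots> \<le> (\<integral>x. 1 \<partial>M)"
      using i sum_bump_le_1 by (intro integral_mono) auto
    finally show "(\<Sum>k\<le>n. \<integral>x. bump (A k) d x \<partial>M) \<le> 1" by (simp add: prob_space)
  qed (rule nn)
  have "(\<integral>x. (\<Sum>k. if k \<in> J then bump (A k) d x else 0) \<partial>M) = (\<Sum>k. \<integral>x. (if k \<in> J then bump (A k) d x else 0) \<partial>M)"
  proof (rule integral_suminf)
    show "integrable M (\<lambda>x. if k \<in> J then bump (A k) d x else 0)" for k using i[of k] by (cases "k \<in> J") auto
    show "AE x in M. summable (\<lambda>k. norm (if k \<in> J then bump (A k) d x else 0))"
    proof (rule AE_I2)
      fix x
      have "(\<lambda>k. norm (if k \<in> J then bump (A k) d x else 0)) = (\<lambda>k. if k \<in> J then bump (A k) d x else 0)"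
        by auto
      then show "summable (\<lambda>k. norm (if k \<in> J then bump (A k) d x else 0))"
        using summable_bump_sum[of J x] by simp
    qed
    show "summable (\<lambda>k. \<integral>x. norm (if k \<in> J then bump (A k) d x else 0) \<partial>M)"
    proof (rule summable_comparison_test[OF _ sm], intro exI allI impI)
      fix k show "norm (\<integral>x. norm (if k \<in> J then bump (A k) d x else 0) \<partial>M) \<le> (\<integral>x. bump (A k) d x \<partial>M)"
        using nn[of k] by (cases "k \<in> J") auto
    qed
  qed
  also have "\<dots> = (\<Sum>k. if k \<in> J then \<integral>x. bump (A k) d x \<partial>M else 0)"
    by (rule suminf_cong) simp
  finally show "(\<integral>x. bump_sum A d J x \<partial>M) = (\<Sum>k. if k \<in> J then \<integral>x. bump (A k) d x \<partial>M else 0)"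
    by (simp add: bump_sum_def)
qed

end

text \<open>The sets \<open>C m\<close>, where the bound holds from index \<open>m\<close> on, are
  closed and exhaust \<open>S\<close>, so one of them has interior. The interior is relative to
  \<open>S\<close>, whence the two conditions on \<open>y\<close>.\<close>

lemma Baire_eventually_uniform:
  fixes S :: "'a::complete_space set" and g :: "nat \<Rightarrow> 'a \<Rightarrow> real"
  assumes S: "closed S" "S \<noteq> {}" and g: "\<And>k. continuous_on UNIV (g k)"
    and ev: "\<And>x. x \<in> S \<Longrightarrow> \<forall>\<^sub>F k in sequentially. c \<le> g k x"
  obtains x U m where "x \<in> S" "x \<in> U" "open U" "\<And>y k. y \<in> U \<Longrightarrow> y \<in> S \<Longrightarrow> m \<le> k \<Longrightarrow> c \<le> g k y"
proof -
  define C where "C m = S \<inter> (\<Inter>k\<in>{m..}. {x. c \<le> g k x})" for m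
  have cl: "closed (C m)" for m
  proof -
    have "closed {x. c \<le> g k x}" for k
      by (intro closed_Collect_le continuous_on_const g)
    then show ?thesis unfolding C_def using S(1) by (intro closed_Int closed_INT) auto
  qed
  have "\<exists>m. top_of_set S interior_of C m \<noteq> {}"
  proof (rule ccontr)
    assume no: "\<not> ?thesis"
    have "top_of_set S interior_of (\<Union>(range C)) = {}"
    proof (intro Baire_category_alt)
      show "completely_metrizable_space (top_of_set S) \<or> locally_compact_space (top_of_set S) \<and> regular_space (top_of_set S)"
        using completely_metrizable_space_closedin[OF completely_metrizable_space_euclidean, of S] S by simp
      fix T assume "T \<in> range C"
      then show "closedin (top_of_set S) T \<and> top_of_set S interior_of T = {}"
        using cl no by (auto intro!: closed_subset simp: C_def)
    qed auto
    moreover have "\<Union>(range C) = S"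
    proof
      show "S \<subseteq> \<Union>(range C)"
      proof
        fix x assume "x \<in> S"
        then obtain N where "\<And>k. N \<le> k \<Longrightarrow> c \<le> g k x" using ev by (auto simp: eventually_sequentially)
        then have "x \<in> C N" using \<open>x \<in> S\<close> by (simp add: C_def)
        then show "x \<in> \<Union>(range C)" by blast
      qed
    qed (auto simp: C_def)
    ultimately show False using S(2) interior_of_topspace[of "top_of_set S"] by simp
  qed
  then obtain m x where x: "x \<in> top_of_set S interior_of C m" by blast
  then obtain T where T: "openin (top_of_set S) T" "x \<in> T" "T \<subseteq> C m"
    by (auto simp: interior_of_def)
  then obtain U where U: "open U" "T = S \<inter> U" by (auto simp: openin_open)
  show ?thesis
  proof (rule that[of x U m])
    fix y k assume "y \<in> U" "y \<in> S" "m \<le> k"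
    then have "y \<in> C m" using T U by blast
    then show "c \<le> g k y" using \<open>m \<le> k\<close> by (simp add: C_def)
  qed (use T U in auto)
qed

section \<open>Shifted observables, repeated averages and reachable points\<close>

context feller_semigroup
begin

lemma av_set_integrable:
  assumes "f \<in> borel_measurable borel" "\<And>y. \<bar>f y :: real\<bar> \<le> C"
  shows "set_integrable lborel {a..b} (\<lambda>s. \<integral>y. f y \<partial>P s x)"
  using assms by (intro set_integrable_bounded_Icc[where C=C] abs_integral_P_le) auto

text \<open>Bounds coming from Baire's theorem hold on the reachable set only, so the comparison is
  asked almost everywhere for each law \<open>P s x\<close>.\<close>

lemma av_mono_AE:
  assumes t: "0 < t" and f: "f \<in> borel_measurable borel" "\<And>y. \<bar>f y\<bar> \<le> C"
    and g: "g \<in> borel_measurable borel" "\<And>y. \<bar>g y\<bar> \<le> D"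
    and le: "\<And>s. 0 \<le> s \<Longrightarrow> AE y in P s x. f y \<le> g y"
  shows "av t f x \<le> av t g x"
  unfolding av_def
proof (intro divide_right_mono set_integral_mono)
  show "set_integrable lborel {0..t} (\<lambda>s. \<integral>y. f y \<partial>P s x)" by (rule av_set_integrable[OF f])
  show "set_integrable lborel {0..t} (\<lambda>s. \<integral>y. g y \<partial>P s x)" by (rule av_set_integrable[OF g])
  fix s assume "s \<in> {0..t}"
  then show "(\<integral>y. f y \<partial>P s x) \<le> (\<integral>y. g y \<partial>P s x)"
    using le[of s] integrable_P[OF f] integrable_P[OF g] by (intro integral_mono_AE) auto
qed (use t in simp)

text \<open>Here \<open>P s\<close> acts on the observable rather than on the initial law; by the
  semigroup property the window is again shifted by \<open>s\<close>.\<close>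

lemma av_P_diff_le:
  assumes t: "0 < t" and s: "0 \<le> s" and f [measurable]: "f \<in> borel_measurable borel" and bd: "\<And>y. \<bar>f y\<bar> \<le> C"
  shows "\<bar>av t (\<lambda>y. \<integral>w. f w \<partial>P s y) x - av t f x\<bar> \<le> 2 * C * s / t"
proof -
  define \<phi> where "\<phi> r = (\<integral>w. f w \<partial>P r x)" for r
  have "(\<integral>y. \<integral>w. f w \<partial>P s y \<partial>P r x) = \<phi> (s + r)" if r: "0 \<le> r" for r
  proof -
    interpret prob_space "P r x" by (rule P_space)
    have "(\<integral>\<^sup>+y. \<integral>\<^sup>+w. ennreal \<bar>f w\<bar> \<partial>P s y \<partial>P r x) \<le> (\<integral>\<^sup>+y. \<integral>\<^sup>+w. ennreal C \<partial>P s y \<partial>P r x)"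
      using bd by (intro nn_integral_mono ennreal_leI)
    also have "\<dots> = ennreal C"
      using prob_space.emeasure_space_1[OF P_space] by simp
    finally have "(\<integral>\<^sup>+y. \<integral>\<^sup>+w. ennreal \<bar>f w\<bar> \<partial>P s y \<partial>P r x) < \<infinity>"
      by (rule le_less_trans) simp
    from integral_bind_of_finite[OF P_meas_cong f this] semigroup[OF r s, of x] show ?thesis
      by (simp add: \<phi>_def add.commute)
  qed
  then have "av t (\<lambda>y. \<integral>w. f w \<partial>P s y) x = (LINT r:{0..t}|lborel. \<phi> (s + r)) / t"
    unfolding av_def by (subst set_lebesgue_integral_cong[where g="\<lambda>r. \<phi> (s + r)"]) auto
  moreover have "av t f x = (LINT r:{0..t}|lborel. \<phi> r) / t" by (simp add: av_def \<phi>_def)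
  moreover have "\<phi> \<in> borel_measurable borel" unfolding \<phi>_def by measurable
  ultimately show ?thesis
    using average_shift_diff_le[of \<phi> C s t] abs_integral_P_le[OF bd] s t by (simp add: \<phi>_def)
qed

text \<open>By Fubini's theorem the left average is the mean over \<open>r\<close> in
  \<open>{0..u}\<close> of averages shifted by \<open>r\<close>, each of which obeys
  \<open>av_P_diff_le\<close>.\<close>

lemma av_av_diff_le:
  assumes t: "0 < t" and u: "0 < u" and f [measurable]: "f \<in> borel_measurable borel" and bd: "\<And>y. \<bar>f y\<bar> \<le> C"
  shows "\<bar>av t (av u f) x - av t f x\<bar> \<le> 2 * C * u / t"
proof -
  interpret q: prob_space "Q t x" by (rule prob_space_Q[OF t])
  have C: "0 \<le> C" using bd[of undefined] by linarith
  have le: "(\<integral>\<^sup>+y. \<integral>\<^sup>+w. ennreal \<bar>f w\<bar> \<partial>P r y \<partial>Q t x) \<le> ennreal C" for r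
  proof -
    have "(\<integral>\<^sup>+y. \<integral>\<^sup>+w. ennreal \<bar>f w\<bar> \<partial>P r y \<partial>Q t x) \<le> (\<integral>\<^sup>+y. \<integral>\<^sup>+w. ennreal C \<partial>P r y \<partial>Q t x)"
      using bd by (intro nn_integral_mono ennreal_leI)
    then show ?thesis
      using prob_space.emeasure_space_1[OF P_space] q.emeasure_space_1 by simp
  qed
  have sub: "subprob_space (Q t x)" by (rule prob_space_imp_subprob_space) unfold_locales
  define \<phi> where "\<phi> r = av t (\<lambda>y. \<integral>w. f w \<partial>P r y) x - av t f x" for r
  have eq: "(\<integral>w. f w \<partial>(Q t x \<bind> P r)) = av t (\<lambda>y. \<integral>w. f w \<partial>P r y) x" for r
  proof -
    have "(\<integral>w. f w \<partial>(Q t x \<bind> P r)) = (\<integral>y. \<integral>w. f w \<partial>P r y \<partial>Q t x)"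
      using le[of r] by (intro integral_bind_of_finite[OF P_meas_cong f])
        (auto intro: le_less_trans[OF _ ennreal_less_top])
    also have "\<dots> = av t (\<lambda>y. \<integral>w. f w \<partial>P r y) x"
      by (rule integral_Q[OF t _ abs_integral_P_le[OF bd]]) measurable
    finally show ?thesis .
  qed
  have [measurable]: "\<phi> \<in> borel_measurable borel"
  proof -
    have "(\<lambda>r. Q t x \<bind> P r) \<in> borel \<rightarrow>\<^sub>M subprob_algebra borel"
      by (rule measurable_bind[where N=borel])
        (use sub in \<open>auto simp: space_subprob_algebra intro!: measurable_const\<close>)
    then have "(\<lambda>r. \<integral>w. f w \<partial>(Q t x \<bind> P r)) \<in> borel_measurable borel"
      by (rule measurable_compose[OF _ integral_measurable_subprob_algebra]) simp
    then show ?thesis unfolding eq \<phi>_def by simp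
  qed
  have \<phi>le: "\<bar>\<phi> r\<bar> \<le> 2 * C * u / t" if "r \<in> {0..u}" for r
  proof -
    have "2 * C * r / t \<le> 2 * C * u / t"
      using that C t by (intro divide_right_mono mult_left_mono) auto
    then show ?thesis using av_P_diff_le[OF t _ f bd, of r x] that unfolding \<phi>_def by auto
  qed
  have b1: "\<bar>av t (\<lambda>y. \<integral>w. f w \<partial>P r y) x\<bar> \<le> C" for r
    using t by (intro abs_av_le abs_integral_P_le bd) auto
  have m1: "(\<lambda>r. av t (\<lambda>y. \<integral>w. f w \<partial>P r y) x) \<in> borel_measurable borel"
  proof -
    have "(\<lambda>r. \<phi> r + av t f x) \<in> borel_measurable borel" by measurable
    then show ?thesis by (simp add: \<phi>_def)
  qed
  have "av t (av u f) x = (\<integral>y. av u f y \<partial>Q t x)"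
    using u by (intro integral_Q[OF t _ abs_av_le[OF _ f bd], symmetric]) auto
  also have "\<dots> = (LINT r:{0..u}|lborel. av t (\<lambda>y. \<integral>w. f w \<partial>P r y) x) / u"
    using integral_av[OF sub sets_Q f C le, of u] u eq by simp
  finally have "av t (av u f) x - av t f x
      = (LINT r:{0..u}|lborel. av t (\<lambda>y. \<integral>w. f w \<partial>P r y) x) / u - (LINT r:{0..u}|lborel. av t f x) / u"
    using u by (simp add: set_integral_const)
  also have "\<dots> = (LINT r:{0..u}|lborel. \<phi> r) / u"
    unfolding diff_divide_distrib[symmetric] \<phi>_def
  proof (subst set_integral_diff)
    show "set_integrable lborel {0..u} (\<lambda>r. av t (\<lambda>y. \<integral>w. f w \<partial>P r y) x)"
      by (rule set_integrable_bounded_Icc[OF m1 b1])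
    show "set_integrable lborel {0..u} (\<lambda>r. av t f x)"
      by (rule set_integrable_bounded_Icc[where C="\<bar>av t f x\<bar>"]) auto
  qed simp
  finally have eq2: "av t (av u f) x - av t f x = (LINT r:{0..u}|lborel. \<phi> r) / u" .
  have "\<bar>LINT r:{0..u}|lborel. \<phi> r\<bar> \<le> (LINT r:{0..u}|lborel. \<bar>\<phi> r\<bar>)"
    using set_integral_norm_bound[OF set_integrable_bounded_Icc[of \<phi> 0 u "2 * C * u / t"]] \<phi>le by simp
  also have "\<dots> \<le> (LINT r:{0..u}|lborel. 2 * C * u / t)"
    using \<phi>le C t u by (intro set_integral_mono set_integrable_bounded_Icc[where C="2 * C * u / t"]) auto
  also have "\<dots> = (2 * C * u / t) * u" using u by (simp add: set_integral_const)
  finally show ?thesis unfolding eq2 using u by (simp add: field_simps)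
qed

text \<open>The closure of the union of the supports of the laws \<open>P s z\<close> with
  \<open>0 \<le> s\<close>.\<close>

definition reach :: "'a \<Rightarrow> 'a set" where
  "reach z = {y. \<forall>U. open U \<longrightarrow> y \<in> U \<longrightarrow> (\<exists>s\<ge>0. 0 < measure (P s z) U)}"

lemma closed_reach: "closed (reach z)"
proof -
  have "- reach z = \<Union>{U. open U \<and> (\<forall>s\<ge>0. measure (P s z) U \<le> 0)}"
  proof (rule set_eqI)
    fix y
    have "y \<in> - reach z \<longleftrightarrow> (\<exists>U. open U \<and> y \<in> U \<and> (\<forall>s\<ge>0. \<not> 0 < measure (P s z) U))"
      unfolding reach_def by blast
    then show "y \<in> - reach z \<longleftrightarrow> y \<in> \<Union>{U. open U \<and> (\<forall>s\<ge>0. measure (P s z) U \<le> 0)}"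
      unfolding not_less by blast
  qed
  moreover have "open (\<Union>{U. open U \<and> (\<forall>s\<ge>0. measure (P s z) U \<le> 0)})" by auto
  ultimately show ?thesis unfolding closed_def by simp
qed

text \<open>Every point outside has a neighbourhood that is null for all these laws; a countable
  base covers the complement by countably many of them.\<close>

lemma AE_reach:
  assumes s: "0 \<le> s"
  shows "AE y in P s z. y \<in> reach z"
proof -
  interpret prob_space "P s z" by (rule P_space)
  obtain \<B> :: "'a set set" where \<B>: "countable \<B>" "topological_basis \<B>"
    using ex_countable_basis by blast
  define \<N> where "\<N> = {U \<in> \<B>. \<forall>s\<ge>0. measure (P s z) U \<le> 0}"
  have "\<Union>\<N> \<in> null_sets (P s z)"
  proof (rule null_sets_UN'[of \<N> "\<lambda>U. U", simplified])
    show "countable \<N>" using \<B>(1) by (auto simp: \<N>_def intro: countable_subset)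
    fix U assume U: "U \<in> \<N>"
    then have "open U" using topological_basis_open[OF \<B>(2)] by (auto simp: \<N>_def)
    moreover have "measure (P s z) U \<le> 0" using U s by (auto simp: \<N>_def)
    ultimately show "U \<in> null_sets (P s z)"
      by (auto simp: null_sets_def emeasure_eq_measure measure_le_0_iff)
  qed
  moreover have "y \<in> \<Union>\<N>" if y: "y \<notin> reach z" for y
  proof -
    obtain U where U: "open U" "y \<in> U" "\<And>s. 0 \<le> s \<Longrightarrow> measure (P s z) U \<le> 0"
      using y by (auto simp: reach_def not_less)
    obtain V where V: "V \<in> \<B>" "y \<in> V" "V \<subseteq> U" using topological_basisE[OF \<B>(2) U(1,2)] .
    have "measure (P s z) V \<le> 0" if "0 \<le> s" for s
    proof -
      have "measure (P s z) V \<le> measure (P s z) U"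
        using V U(1) by (intro finite_measure.finite_measure_mono prob_space.finite_measure P_space) auto
      then show ?thesis using U(3)[OF that] by linarith
    qed
    then show ?thesis using V by (auto simp: \<N>_def)
  qed
  ultimately show ?thesis by (intro AE_I'[of "\<Union>\<N>"]) auto
qed

end

section \<open>Existence of an invariant probability measure\<close>

context feller_semigroup
begin

lemma hits_of_av:
  assumes t: "0 < t" and B [measurable]: "B \<in> sets borel" and c: "c < av t (indicator B) x"
  shows "\<exists>s\<ge>0. c \<le> measure (P s x) B"
proof (rule ccontr)
  assume "\<not> ?thesis"
  then have lt: "\<And>s. 0 \<le> s \<Longrightarrow> measure (P s x) B \<le> c" by (meson not_le less_imp_le)
  have eq: "(\<integral>y. indicator B y \<partial>P s x) = measure (P s x) B" for s by simp
  have "(LINT s:{0..t}|lborel. \<integral>y. indicator B y \<partial>P s x) \<le> (LINT s:{0..t}|lborel. c)"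
  proof (intro set_integral_mono av_set_integrable[where C=1] set_integrable_bounded_Icc[where C="\<bar>c\<bar>"])
    show "(\<integral>y. indicator B y \<partial>P s x) \<le> c" if "s \<in> {0..t}" for s
      unfolding eq using lt that by simp
  qed (auto split: split_indicator)
  then have "av t (indicator B) x \<le> c"
    unfolding av_def using t by (simp add: set_integral_const field_simps)
  then show False using c by simp
qed

lemma no_escaping_bumps:
  fixes A :: "nat \<Rightarrow> 'a set" and t :: "nat \<Rightarrow> nat"
  assumes merge: "\<And>f x. f \<in> bounded_lipschitz \<Longrightarrow> (\<lambda>n. av (real n) f x - av (real n) f z) \<longlonglongrightarrow> 0"
    and c2: "\<And>r. 0 < r \<Longrightarrow> \<exists>c>0. \<exists>\<^sub>F t in at_top. c < av t (indicator (ball z r)) z"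
    and d: "0 < d" and ne: "\<And>k. A k \<noteq> {}"
    and sep: "\<And>j k a b. j \<noteq> k \<Longrightarrow> a \<in> A j \<Longrightarrow> b \<in> A k \<Longrightarrow> 2 * d \<le> dist a b"
    and t: "strict_mono t" "\<And>k. 0 < t k"
    and e: "0 < e" and big: "\<And>k. e \<le> av (real (t k)) (bump (A k) d) z"
  shows False
proof -
  define h where "h k = bump (A k) d" for k
  have h01: "0 \<le> h k y" "h k y \<le> 1" "\<bar>h k y\<bar> \<le> 1" for k y using d by (auto simp: h_def)
  have hbl: "h k \<in> bounded_lipschitz" for k unfolding h_def by (rule bump_bounded_lipschitz[OF d])
  have hm [measurable]: "h k \<in> borel_measurable borel" for k by (rule bounded_lipschitz_measurable[OF hbl])
  have tpos: "0 < real (t k)" for k using t(2) by simp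
  have avh: "av u (h k) x = (\<integral>y. h k y \<partial>Q u x)" if "0 < u" for u k x
    by (rule integral_Q[OF that hm h01(3), symmetric])
  have ev: "\<forall>\<^sub>F k in sequentially. e / 2 \<le> av (real (t k)) (h k) x" for x
  proof -
    \<comment> \<open>Rows are the times \<open>t k\<close>, columns the bumps. Merging for every
      subset sum of bumps is the hypothesis of \<open>gliding_hump\<close>; its conclusion transfers
      the bound \<open>big\<close> from \<open>z\<close> to \<open>x\<close> at the cost of
      \<open>e / 2\<close>.\<close>
    define a where "a k j = av (real (t k)) (h j) x - av (real (t k)) (h j) z" for k j
    have sq: "summable (\<lambda>j. av (real (t k)) (h j) y)" for k y
      unfolding avh[OF tpos] unfolding h_def
      by (rule bump_sum_integral(1)[OF d ne sep prob_space_Q[OF tpos] sets_Q]) auto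
    have avJ: "av (real (t k)) (bump_sum A d J) y = (\<Sum>j. if j \<in> J then av (real (t k)) (h j) y else 0)" for k J y
    proof -
      have "\<bar>bump_sum A d J y\<bar> \<le> 1" for y
        using bump_sum_nonneg[where J=J and x=y, OF d ne sep] bump_sum_le_1[where J=J and x=y, OF d ne sep] by simp
      then have "av (real (t k)) (bump_sum A d J) y = (\<integral>w. bump_sum A d J w \<partial>Q (real (t k)) y)"
        by (intro integral_Q[OF tpos, symmetric] bounded_lipschitz_measurable
            bump_sum_bounded_lipschitz[OF d ne sep]) auto
      also have "\<dots> = (\<Sum>j. if j \<in> J then \<integral>w. bump (A j) d w \<partial>Q (real (t k)) y else 0)"
        by (rule bump_sum_integral(2)[OF d ne sep prob_space_Q[OF tpos] sets_Q]) auto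
      also have "\<dots> = (\<Sum>j. if j \<in> J then av (real (t k)) (h j) y else 0)"
        unfolding avh[OF tpos] unfolding h_def ..
      finally show ?thesis .
    qed
    have av0: "0 \<le> av (real (t k)) (h j) y" for k j y
      unfolding avh[OF tpos] by (intro Bochner_Integration.integral_nonneg h01)
    have "(\<lambda>k. a k k) \<longlonglongrightarrow> 0"
    proof (rule gliding_hump[of a])
      fix k
      show "summable (\<lambda>j. \<bar>a k j\<bar>)"
      proof (rule summable_comparison_test[OF _ summable_add[OF sq[of k x] sq[of k z]]], intro exI allI impI)
        fix j show "norm \<bar>a k j\<bar> \<le> av (real (t k)) (h j) x + av (real (t k)) (h j) z"
          using av0[of k j x] av0[of k j z] by (simp add: a_def)
      qed
    next
      fix J
      have s: "summable (\<lambda>j. if j \<in> J then av (real (t k)) (h j) y else 0)" for k y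
        by (rule summable_comparison_test[OF _ sq[of k y]]) (auto intro!: exI[of _ 0] simp: av0)
      have "(\<Sum>j. if j \<in> J then a k j else 0) = av (real (t k)) (bump_sum A d J) x - av (real (t k)) (bump_sum A d J) z" for k
        unfolding avJ suminf_diff[OF s s] a_def by (rule suminf_cong) simp
      moreover have "(\<lambda>k. av (real (t k)) (bump_sum A d J) x - av (real (t k)) (bump_sum A d J) z) \<longlonglongrightarrow> 0"
        using LIMSEQ_subseq_LIMSEQ[OF merge[where x=x, OF bump_sum_bounded_lipschitz[where J=J, OF d ne sep]] t(1)]
        by (simp add: o_def)
      ultimately show "(\<lambda>k. \<Sum>j. if j \<in> J then a k j else 0) \<longlonglongrightarrow> 0" by simp
    qed
    then have "\<forall>\<^sub>F k in sequentially. - (e / 2) < a k k"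
      using e by (intro order_tendstoD) auto
    then show ?thesis
    proof eventually_elim
      case (elim k)
      then show ?case using big[of k] unfolding a_def h_def by simp
    qed
  qed
  have "reach z \<noteq> {}"
  proof
    assume "reach z = {}"
    then have "AE y in P 0 z. False" using AE_reach[of 0 z] by simp
    then show False using prob_space.AE_False[OF P_space] by simp
  qed
  then obtain x U m where x: "x \<in> reach z" "x \<in> U" "open U"
    and unif: "\<And>y k. y \<in> U \<Longrightarrow> y \<in> reach z \<Longrightarrow> m \<le> k \<Longrightarrow> e / 2 \<le> av (real (t k)) (h k) y"
    using Baire_eventually_uniform[OF closed_reach, of z "\<lambda>k. av (real (t k)) (h k)" "e / 2"]
      continuous_av[OF bounded_lipschitz_continuous[OF hbl] h01(3) tpos] ev by blast
  obtain \<rho> where \<rho>: "0 < \<rho>" "ball x \<rho> \<subseteq> U" using x by (meson open_contains_ball)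
  \<comment> \<open>A continuous minorant of the indicator of \<open>U\<close>, since the Feller
    property acts on continuous functions.\<close>
  define \<psi> where "\<psi> = bump (ball x (\<rho> / 2)) (\<rho> / 2)"
  have \<psi>bl: "\<psi> \<in> bounded_lipschitz" unfolding \<psi>_def using \<rho> by (intro bump_bounded_lipschitz) simp
  have \<psi>m [measurable]: "\<psi> \<in> borel_measurable borel" by (rule bounded_lipschitz_measurable[OF \<psi>bl])
  have \<psi>01: "0 \<le> \<psi> y" "\<psi> y \<le> 1" "\<bar>\<psi> y\<bar> \<le> 1" for y using \<rho> by (auto simp: \<psi>_def)
  have \<psi>U: "y \<in> U" if "0 < \<psi> y" for y
  proof -
    have "0 < bump (ball x (\<rho> / 2)) (\<rho> / 2) y" using that by (simp add: \<psi>_def)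
    then obtain w where "w \<in> ball x (\<rho> / 2)" "dist y w < \<rho> / 2"
      by (rule bump_posD) (use \<rho>(1) in auto)
    then have "dist x y < \<rho>" using dist_triangle2[of x y w] by simp
    then show ?thesis using \<rho>(2) by auto
  qed
  obtain s where s: "0 \<le> s" "0 < measure (P s z) (ball x (\<rho> / 2))"
    using x(1) \<rho>(1) unfolding reach_def by (auto dest!: spec[of _ "ball x (\<rho> / 2)"])
  \<comment> \<open>Half of the hitting probability, so that \<open>q < \<Psi> z\<close> strictly
    and, by continuity of \<open>\<Psi>\<close>, on a whole ball around \<open>z\<close>.\<close>
  define q where "q = measure (P s z) (ball x (\<rho> / 2)) / 2"
  have q: "0 < q" using s by (simp add: q_def)
  define \<Psi> where "\<Psi> y = (\<integral>w. \<psi> w \<partial>P s y)" for y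
  have \<Psi>m [measurable]: "\<Psi> \<in> borel_measurable borel" unfolding \<Psi>_def by measurable
  have \<Psi>01: "0 \<le> \<Psi> y" "\<bar>\<Psi> y\<bar> \<le> 1" for y
    unfolding \<Psi>_def using abs_integral_P_le[OF \<psi>01(3)] \<psi>01 by auto
  have "q < \<Psi> z"
  proof -
    have "measure (P s z) (ball x (\<rho> / 2)) = (\<integral>w. indicator (ball x (\<rho> / 2)) w \<partial>P s z)" by simp
    also have "\<dots> \<le> \<Psi> z" unfolding \<Psi>_def
    proof (rule integral_mono)
      show "integrable (P s z) (indicat_real (ball x (\<rho> / 2)))"
        by (rule integrable_P[where C=1]) (auto intro!: borel_measurable_indicator split: split_indicator)
      show "integrable (P s z) \<psi>" by (rule integrable_P[OF \<psi>m \<psi>01(3)])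
      show "indicator (ball x (\<rho> / 2)) w \<le> \<psi> w" for w
        using \<psi>01(1)[of w] by (cases "w \<in> ball x (\<rho> / 2)") (auto simp: \<psi>_def)
    qed
    finally show ?thesis using s by (simp add: q_def)
  qed
  moreover have "continuous_on UNIV \<Psi>" unfolding \<Psi>_def
    by (rule feller[OF s(1) bounded_lipschitz_continuous[OF \<psi>bl] \<psi>01(3)])
  then have "open {y. q < \<Psi> y}" by (intro open_Collect_less continuous_on_const)
  ultimately obtain r where r: "0 < r" "ball z r \<subseteq> {y. q < \<Psi> y}"
    by (meson mem_Collect_eq open_contains_ball)
  obtain c where c: "0 < c" "\<exists>\<^sub>F t in at_top. c < av t (indicator (ball z r)) z" using c2[OF r(1)] by blast
  \<comment> \<open>A product of three lower bounds: \<open>c\<close> for the frequency of visits to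
    the ball, \<open>q\<close> for the passage from there to \<open>U\<close> in time
    \<open>s\<close>, and \<open>e / 2\<close> for the average of \<open>h k\<close> started in
    \<open>U\<close>.\<close>
  define b where "b = e / 2 * (q * c)"
  have b: "0 < b" using e q c by (simp add: b_def)
  \<comment> \<open>The error terms come from shifting by \<open>s\<close> and from averaging twice
    with inner window \<open>t k\<close>. Both vanish as \<open>u\<close> grows, simultaneously for
    finitely many \<open>k\<close>.\<close>
  have lower: "b - e / 2 * (2 * s / u) - 2 * real (t k) / u \<le> av u (h k) z"
    if u: "0 < u" and cu: "c < av u (indicator (ball z r)) z" and k: "m \<le> k" for u k
  proof -
    have "q * av u (indicator (ball z r)) z = av u (\<lambda>y. q * indicator (ball z r) y) z"
      by (simp add: av_def)
    also have "\<dots> \<le> av u \<Psi> z"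
    proof (rule av_mono[OF u _ _ _ \<Psi>01(2)])
      show "\<bar>q * indicator (ball z r) y\<bar> \<le> q" for y using q by (auto split: split_indicator)
      show "q * indicator (ball z r) y \<le> \<Psi> y" for y
        using r(2) \<Psi>01(1)[of y] by (cases "y \<in> ball z r") (auto simp: subset_iff intro: less_imp_le)
    qed (auto intro!: borel_measurable_times borel_measurable_indicator)
    finally have 1: "q * av u (indicator (ball z r)) z \<le> av u \<Psi> z" .
    have 2: "av u \<Psi> z - 2 * s / u \<le> av u \<psi> z"
      using av_P_diff_le[OF u s(1) \<psi>m \<psi>01(3), of z] unfolding \<Psi>_def by (simp add: abs_le_iff)
    have "e / 2 * av u \<psi> z = av u (\<lambda>y. e / 2 * \<psi> y) z"
      by (simp add: av_def)
    also have "\<dots> \<le> av u (av (real (t k)) (h k)) z"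
    proof (rule av_mono_AE[OF u])
      show "\<bar>e / 2 * \<psi> y\<bar> \<le> e / 2" for y using e \<psi>01[of y] by (simp add: abs_mult)
      show "\<bar>av (real (t k)) (h k) y\<bar> \<le> 1" for y
        using tpos[of k] by (intro abs_av_le hm h01) auto
      fix s' :: real assume "0 \<le> s'"
      from AE_reach[OF this, of z] show "AE y in P s' z. e / 2 * \<psi> y \<le> av (real (t k)) (h k) y"
      proof eventually_elim
        case (elim y)
        show ?case
        proof (cases "0 < \<psi> y")
          case True
          have "e / 2 * \<psi> y \<le> e / 2 * 1" using e \<psi>01 by (intro mult_left_mono) auto
          then show ?thesis using unif[OF \<psi>U[OF True] elim k] by simp
        next
          case False
          then have "\<psi> y = 0" using \<psi>01(1)[of y] by simp
          moreover have "0 \<le> av (real (t k)) (h k) y"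
            unfolding avh[OF tpos] by (intro Bochner_Integration.integral_nonneg h01)
          ultimately show ?thesis by simp
        qed
      qed
    qed (auto intro!: av_measurable hm)
    finally have 3: "e / 2 * av u \<psi> z \<le> av u (av (real (t k)) (h k)) z" .
    have 4: "av u (av (real (t k)) (h k)) z - 2 * real (t k) / u \<le> av u (h k) z"
      using av_av_diff_le[OF u tpos[of k] hm h01(3), of k z] by (simp add: abs_le_iff)
    have "q * c \<le> q * av u (indicator (ball z r)) z" using q cu by (intro mult_left_mono) auto
    then have "q * c - 2 * s / u \<le> av u \<psi> z" using 1 2 by linarith
    then have "e / 2 * (q * c - 2 * s / u) \<le> e / 2 * av u \<psi> z" using e by (intro mult_left_mono) auto
    then show ?thesis using 3 4 unfolding b_def right_diff_distrib by linarith
  qed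
  \<comment> \<open>With \<open>R\<close> bumps and total error below 1, the averages add up to more
    than \<open>R * b - 1 > 1\<close>, although the bumps add up to at most 1.\<close>
  obtain R where R: "2 / b < real R" using reals_Archimedean2 by blast
  define err where "err u = (\<Sum>k\<in>{m..<m+R}. e / 2 * (2 * s / u) + 2 * real (t k) / u)" for u
  have "(err \<longlongrightarrow> (\<Sum>k\<in>{m..<m+R}. e / 2 * 0 + 0)) at_top"
    unfolding err_def
    by (intro tendsto_sum tendsto_add tendsto_mult tendsto_const
        tendsto_divide_0[OF tendsto_const filterlim_at_top_imp_at_infinity[OF filterlim_ident]])
  then have "\<forall>\<^sub>F u in at_top. err u < 1" by (intro order_tendstoD) auto
  then have "\<forall>\<^sub>F u in at_top. c < av u (indicator (ball z r)) z \<longrightarrow>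
      c < av u (indicator (ball z r)) z \<and> err u < 1 \<and> 0 < u"
    using eventually_gt_at_top[of 0] by eventually_elim simp
  with c(2) have "\<exists>\<^sub>F u in at_top. c < av u (indicator (ball z r)) z \<and> err u < 1 \<and> 0 < u"
    by (rule frequently_rev_mp)
  then obtain u where u: "c < av u (indicator (ball z r)) z" "err u < 1" "0 < u"
    using frequently_ex by blast
  have "real R * b - err u = (\<Sum>k\<in>{m..<m+R}. b - e / 2 * (2 * s / u) - 2 * real (t k) / u)"
    by (simp add: err_def sum_subtractf sum.distrib right_diff_distrib)
  also have "\<dots> \<le> (\<Sum>k\<in>{m..<m+R}. av u (h k) z)"
    by (intro sum_mono lower u) auto
  also have "\<dots> = (\<integral>y. (\<Sum>k\<in>{m..<m+R}. h k y) \<partial>Q u z)"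
    unfolding avh[OF u(3)]
    by (intro Bochner_Integration.integral_sum[symmetric] integrable_Q[OF u(3) hm h01(3)])
  also have "\<dots> \<le> 1"
  proof -
    have "\<bar>\<Sum>k\<in>{m..<m+R}. h k y\<bar> \<le> 1" for y
      using sum_bump_le_1[where J="{m..<m+R}" and x=y, OF d ne sep] sum_nonneg[of "{m..<m+R}" "\<lambda>k. h k y"] h01
      by (simp add: h_def)
    then show ?thesis
      using prob_space.abs_integral_le_const[OF prob_space_Q[OF u(3), of z],
          where f="\<lambda>y. \<Sum>k\<in>{m..<m+R}. h k y"] by (simp add: abs_le_iff)
  qed
  finally have "real R * b < 2" using u(2) by simp
  then show False using R b by (simp add: field_simps)
qed

lemma tight_averages:
  fixes x :: "nat \<Rightarrow> 'a"
  assumes merge: "\<And>f x. f \<in> bounded_lipschitz \<Longrightarrow> (\<lambda>n. av (real n) f x - av (real n) f z) \<longlonglongrightarrow> 0"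
    and c2: "\<And>r. 0 < r \<Longrightarrow> \<exists>c>0. \<exists>\<^sub>F t in at_top. c < av t (indicator (ball z r)) z"
    and dense: "\<And>y r. 0 < r \<Longrightarrow> \<exists>i. dist (x i) y < r"
    and e: "0 < e" and \<eta>: "0 < \<eta>"
  shows "\<exists>N. \<forall>n. 1 - e \<le> measure (Q (real (Suc n)) z) (\<Union>i<N. ball (x i) \<eta>)"
proof (rule ccontr)
  assume no: "\<not> ?thesis"
  define \<mu> where "\<mu> n = Q (real (Suc n)) z" for n
  define G where "G N r = (\<Union>i<N. ball (x i) r)" for N r
  have P: "prob_space (\<mu> n)" for n unfolding \<mu>_def by (rule prob_space_Q) simp
  have [simp]: "sets (\<mu> n) = sets borel" for n by (simp add: \<mu>_def)
  have [measurable]: "G N r \<in> sets borel" for N r by (auto simp: G_def)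
  have mono: "measure (\<mu> n) (G N r) \<le> measure (\<mu> n) (G N' r)" if "N \<le> N'" for n N N' r
  proof (rule finite_measure.finite_measure_mono[OF prob_space.finite_measure[OF P]])
    show "G N r \<subseteq> G N' r" unfolding G_def using that by (intro UN_mono) auto
  qed simp
  have capture: "\<exists>N0. \<forall>N\<ge>N0. a < measure (\<mu> n) (G N r)" if "0 < r" "a < 1" for n r a
  proof -
    interpret prob_space "\<mu> n" by (rule P)
    have "(\<Union>N. G N r) = UNIV"
    proof -
      have "\<exists>N. y \<in> G N r" for y
      proof -
        obtain i where "dist (x i) y < r" using dense[OF \<open>0 < r\<close>] by blast
        then have "y \<in> G (Suc i) r" unfolding G_def by (intro UN_I[of i]) auto
        then show ?thesis by blast
      qed
      then show ?thesis by blast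
    qed
    then have "measure (\<mu> n) (\<Union>N. G N r) = 1"
      using prob_space sets_eq_imp_space_eq[of "\<mu> n" borel] by simp
    moreover have "(\<lambda>N. measure (\<mu> n) (G N r)) \<longlonglongrightarrow> measure (\<mu> n) (\<Union>N. G N r)"
    proof (rule finite_Lim_measure_incseq)
      show "incseq (\<lambda>N. G N r)" unfolding G_def by (intro monoI UN_mono) auto
    qed auto
    ultimately have "\<forall>\<^sub>F N in sequentially. a < measure (\<mu> n) (G N r)"
      using \<open>a < 1\<close> by (auto intro: order_tendstoD)
    then show ?thesis by (simp add: eventually_sequentially)
  qed
  \<comment> \<open>Finitely many averages are captured by one finite union of balls, so tightness
    must fail at arbitrarily late times.\<close>
  have esc: "\<exists>n>n0. measure (\<mu> n) (G N \<eta>) < 1 - e" for N n0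
  proof -
    have "\<exists>N'\<ge>N. \<forall>n\<le>n0. 1 - e < measure (\<mu> n) (G N' \<eta>)"
    proof (induction n0)
      case 0
      then show ?case using capture[OF \<eta>, of "1 - e" 0] e by (metis diff_less_eq le_zero_eq less_add_same_cancel1 nle_le)
    next
      case (Suc n0)
      then obtain N' where N': "N \<le> N'" "\<And>n. n \<le> n0 \<Longrightarrow> 1 - e < measure (\<mu> n) (G N' \<eta>)" by blast
      obtain N0 where N0: "\<And>N. N0 \<le> N \<Longrightarrow> 1 - e < measure (\<mu> (Suc n0)) (G N \<eta>)"
        using capture[OF \<eta>, of "1 - e" "Suc n0"] e by auto
      show ?case
      proof (intro exI[of _ "max N' N0"] conjI allI impI)
        fix n assume "n \<le> Suc n0"
        then consider "n \<le> n0" | "n = Suc n0" by linarith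
        then show "1 - e < measure (\<mu> n) (G (max N' N0) \<eta>)"
        proof cases
          case 1
          then show ?thesis using N'(2)[OF 1] mono[of N' "max N' N0" n \<eta>] by linarith
        qed (use N0 in auto)
      qed (use N' in simp)
    qed
    then obtain N' where N': "N \<le> N'" "\<And>n. n \<le> n0 \<Longrightarrow> 1 - e < measure (\<mu> n) (G N' \<eta>)" by blast
    obtain n where n: "measure (\<mu> n) (G N' \<eta>) < 1 - e"
      using no unfolding \<mu>_def G_def by (meson not_le)
    then have "n0 < n" using N'(2)[of n] by (meson not_le less_asym)
    then show ?thesis using n mono[OF N'(1), of n \<eta>] by (intro exI[of _ n]) linarith
  qed
  \<comment> \<open>A pair consists of a time index and a number of balls. At the next time more
    than \<open>e\<close> of the mass lies outside the old balls of radius \<open>\<eta>\<close>,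
    while all but \<open>e / 2\<close> lies in the new balls of radius
    \<open>\<eta> / 4\<close>.\<close>
  define R where "R p p' \<longleftrightarrow> fst p < fst p' \<and> snd p \<le> snd p' \<and> measure (\<mu> (fst p')) (G (snd p) \<eta>) < 1 - e
    \<and> 1 - e / 2 < measure (\<mu> (fst p')) (G (snd p') (\<eta> / 4))" for p p' :: "nat \<times> nat"
  have "\<exists>p'. R p p'" for p
  proof -
    obtain n where n: "fst p < n" "measure (\<mu> n) (G (snd p) \<eta>) < 1 - e" using esc by blast
    obtain N0 where N0: "\<And>N. N0 \<le> N \<Longrightarrow> 1 - e / 2 < measure (\<mu> n) (G N (\<eta> / 4))"
      using capture[of "\<eta> / 4" "1 - e / 2" n] e \<eta> by auto
    have "R p (n, max (snd p) N0)" unfolding R_def using n N0 by auto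
    then show ?thesis by blast
  qed
  then obtain s where s: "\<And>k. R (s k) (s (Suc k))"
    using dependent_nat_choice[of "\<lambda>_ _. True" "\<lambda>_. R"] by auto
  have step: "snd (s k) \<le> snd (s (Suc k))" for k using s[of k] by (simp add: R_def)
  have smono: "snd (s j) \<le> snd (s k)" if "j \<le> k" for j k
    by (rule lift_Suc_mono_le[of "\<lambda>k. snd (s k)", OF step that])
  define A where "A k = G (snd (s (Suc k))) (\<eta> / 4) - G (snd (s k)) \<eta>" for k
  \<comment> \<open>The successor appears because \<open>\<mu> n\<close> averages over the time
    \<open>Suc n\<close>.\<close>
  define t where "t k = Suc (fst (s (Suc k)))" for k
  have big: "e / 2 \<le> measure (\<mu> (fst (s (Suc k)))) (A k)" for k
  proof -
    interpret prob_space "\<mu> (fst (s (Suc k)))" by (rule P)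
    have "prob (G (snd (s (Suc k))) (\<eta> / 4)) \<le> prob (A k \<union> G (snd (s k)) \<eta>)"
      by (intro finite_measure_mono) (auto simp: A_def)
    also have "\<dots> \<le> prob (A k) + prob (G (snd (s k)) \<eta>)"
      by (intro measure_Un_le) (auto simp: A_def)
    finally show ?thesis using s[of k] by (simp add: R_def)
  qed
  have ne: "A k \<noteq> {}" for k using big[of k] e by auto
  \<comment> \<open>A point of \<open>A j\<close> is within \<open>\<eta> / 4\<close> of a centre
    that all points of the later \<open>A k\<close> avoid by \<open>\<eta>\<close>. The gap is at
    least three quarters of \<open>\<eta>\<close>, more than twice the bump width.\<close>
  have sep1: "2 * (\<eta> / 4) \<le> dist a b" if ab: "j < k" "a \<in> A j" "b \<in> A k" for j k a b
  proof -
    obtain i where i: "i < snd (s (Suc j))" "dist (x i) a < \<eta> / 4" using ab by (auto simp: A_def G_def)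
    have "snd (s (Suc j)) \<le> snd (s k)" using ab by (intro smono) simp
    then have "i < snd (s k)" using i by simp
    then have "\<eta> \<le> dist (x i) b" using ab(3) by (auto simp: A_def G_def not_less)
    then show ?thesis using i dist_triangle[of "x i" b a] \<eta> by linarith
  qed
  show False
  proof (rule no_escaping_bumps[OF merge c2, of "\<eta> / 4" A t "e / 2"])
    show "2 * (\<eta> / 4) \<le> dist a b" if "j \<noteq> k" "a \<in> A j" "b \<in> A k" for j k a b
      using sep1[of j k a b] sep1[of k j b a] that by (cases "j < k") (auto simp: dist_commute)
    have "t k < t (Suc k)" for k using s[of "Suc k"] by (simp add: t_def R_def)
    then show "strict_mono t" by (simp add: strict_mono_Suc_iff)
    show "e / 2 \<le> av (real (t k)) (bump (A k) (\<eta> / 4)) z" for k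
    proof -
      have "e / 2 \<le> measure (Q (real (t k)) z) (A k)" using big[of k] by (simp add: \<mu>_def t_def)
      also have "\<dots> = av (real (t k)) (indicator (A k)) z"
        by (rule measure_Q) (auto simp: t_def A_def)
      also have "\<dots> \<le> av (real (t k)) (bump (A k) (\<eta> / 4)) z"
      proof (rule av_mono[where C=1 and D=1])
        show "indicator (A k) y \<le> bump (A k) (\<eta> / 4) y" for y by (auto split: split_indicator)
        show "bump (A k) (\<eta> / 4) \<in> borel_measurable borel"
          using \<eta> by (intro bounded_lipschitz_measurable bump_bounded_lipschitz) simp
      qed (use \<eta> in \<open>auto simp: t_def A_def split: split_indicator\<close>)
      finally show ?thesis .
    qed
  qed (use ne \<eta> e in \<open>auto simp: t_def\<close>)
qed

definition invariant :: "'a measure \<Rightarrow> bool" where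
  "invariant m \<longleftrightarrow> prob_space m \<and> sets m = sets borel \<and> (\<forall>t\<ge>0. m \<bind> P t = m)"

lemma integral_bind_P_bounded:
  fixes f :: "'a \<Rightarrow> real"
  assumes m: "prob_space m" "sets m = sets borel" and f [measurable]: "f \<in> borel_measurable borel"
    and bd: "\<And>y. \<bar>f y\<bar> \<le> C"
  shows "(\<integral>w. f w \<partial>(m \<bind> P t)) = (\<integral>y. \<integral>w. f w \<partial>P t y \<partial>m)"
proof (rule integral_bind_of_finite[OF P_meas_cong[OF m(2)] f])
  interpret m: prob_space m by (rule m)
  have "(\<integral>\<^sup>+y. \<integral>\<^sup>+w. ennreal \<bar>f w\<bar> \<partial>P t y \<partial>m) \<le> (\<integral>\<^sup>+y. \<integral>\<^sup>+w. ennreal C \<partial>P t y \<partial>m)"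
    using bd by (intro nn_integral_mono ennreal_leI)
  also have "\<dots> = ennreal C"
    using prob_space.emeasure_space_1[OF P_space] m.emeasure_space_1 by simp
  finally show "(\<integral>\<^sup>+y. \<integral>\<^sup>+w. ennreal \<bar>f w\<bar> \<partial>P t y \<partial>m) < \<infinity>" by (rule le_less_trans) simp
  show "space m \<noteq> {}" by (rule m.not_empty)
qed

lemma prob_space_bind_P:
  assumes "prob_space m" "sets m = sets borel"
  shows "prob_space (m \<bind> P t)"
  using prob_space.prob_space_bind[OF assms(1) _ P_meas_cong[OF assms(2)]] by (auto simp: P_space)

text \<open>The Krylov-Bogoliubov argument: evolving an averaged law by \<open>t\<close> changes it
  by an amount of order \<open>t / n\<close>, so weak limit points are invariant.\<close>

lemma invariant_exists:
  assumes merge: "\<And>f x. f \<in> bounded_lipschitz \<Longrightarrow> (\<lambda>n. av (real n) f x - av (real n) f z) \<longlonglongrightarrow> 0"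
    and c2: "\<And>r. 0 < r \<Longrightarrow> \<exists>c>0. \<exists>\<^sub>F t in at_top. c < av t (indicator (ball z r)) z"
  shows "\<exists>m. invariant m"
proof -
  obtain D :: "'a set" where D: "countable D" "\<And>X. open X \<Longrightarrow> X \<noteq> {} \<Longrightarrow> \<exists>d\<in>D. d \<in> X"
    using countable_dense_setE by blast
  have "D \<noteq> {}" using D(2)[of UNIV] by auto
  define x where "x = from_nat_into D"
  have dense: "\<exists>i. dist (x i) y < r" if r: "0 < r" for y r
  proof -
    obtain d where d: "d \<in> D" "d \<in> ball y r" using D(2)[of "ball y r"] r by auto
    then obtain i where "d = x i" using from_nat_into_surj[OF D(1)] unfolding x_def by metis
    then show ?thesis using d by (auto simp: dist_commute)
  qed
  define \<mu> where "\<mu> n = Q (real (Suc n)) z" for n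
  have p: "prob_space (\<mu> n)" "sets (\<mu> n) = sets borel" for n
    by (auto simp: \<mu>_def intro: prob_space_Q)
  have tt: "\<exists>N. \<forall>n. 1 - e \<le> measure (\<mu> n) (\<Union>i<N. ball (x i) d)" if "0 < e" "0 < d" for e d
    unfolding \<mu>_def by (rule tight_averages[OF merge c2 dense that])
  obtain r m where r: "strict_mono (r :: nat \<Rightarrow> nat)" and m: "prob_space m" "sets m = sets borel"
    and conv: "\<And>f. f \<in> bounded_lipschitz \<Longrightarrow> (\<lambda>n. \<integral>y. f y \<partial>\<mu> (r n)) \<longlonglongrightarrow> (\<integral>y. f y \<partial>m)"
    using prokhorov_bounded_lipschitz[where x=x, OF p tt] by blast
  have "m \<bind> P t = m" if t: "0 \<le> t" for t
  proof (rule measure_eqI_bounded_lipschitz)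
    show "prob_space (m \<bind> P t)" by (rule prob_space_bind_P[OF m])
    show "sets (m \<bind> P t) = sets borel" by (rule sets_bind_P[OF m(2)])
    fix f :: "'a \<Rightarrow> real" assume f: "f \<in> bounded_lipschitz"
    then obtain C where C: "0 \<le> C" "\<And>y. \<bar>f y\<bar> \<le> C" by (rule bounded_lipschitzE) blast
    have fm [measurable]: "f \<in> borel_measurable borel" by (rule bounded_lipschitz_measurable[OF f])
    define g where "g y = (\<integral>w. f w \<partial>P t y)" for y
    have gm [measurable]: "g \<in> borel_measurable borel" unfolding g_def by measurable
    have gC: "\<bar>g y\<bar> \<le> C" for y unfolding g_def by (rule abs_integral_P_le[OF C(2)])
    have gc: "continuous_on UNIV g" unfolding g_def
      by (rule feller[OF t bounded_lipschitz_continuous[OF f] C(2)])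
    \<comment> \<open>\<open>g\<close> is continuous but in general not Lipschitz, so this
      convergence does not follow from \<open>conv\<close> directly.\<close>
    have 1: "(\<lambda>n. \<integral>y. g y \<partial>\<mu> (r n)) \<longlonglongrightarrow> (\<integral>y. g y \<partial>m)"
      by (rule weak_conv_bounded_lipschitz_continuous[OF p m conv gc gC])
    have 2: "\<bar>(\<integral>y. g y \<partial>\<mu> (r n)) - (\<integral>y. f y \<partial>\<mu> (r n))\<bar> \<le> 2 * C * t / real (Suc (r n))" for n
      unfolding \<mu>_def
      by (subst integral_Q[OF _ gm gC], simp, subst integral_Q[OF _ fm C(2)], simp, unfold g_def)
        (rule av_P_diff_le[OF _ t fm C(2)], simp)
    have "filterlim (\<lambda>n. real (Suc (r n))) at_top sequentially"
      using filterlim_compose[OF filterlim_real_sequentially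
          filterlim_compose[OF filterlim_Suc filterlim_subseq[OF r]]] .
    then have "(\<lambda>n. 2 * C * t / real (Suc (r n))) \<longlonglongrightarrow> 0"
      by (intro tendsto_divide_0[OF tendsto_const] filterlim_at_top_imp_at_infinity)
    then have "(\<lambda>n. (\<integral>y. g y \<partial>\<mu> (r n)) - (\<integral>y. f y \<partial>\<mu> (r n))) \<longlonglongrightarrow> 0"
      by (rule Lim_null_comparison[rotated]) (use 2 in simp)
    from tendsto_diff[OF 1 this] have "(\<lambda>n. \<integral>y. f y \<partial>\<mu> (r n)) \<longlonglongrightarrow> (\<integral>y. g y \<partial>m)" by simp
    with conv[OF f] have "(\<integral>y. f y \<partial>m) = (\<integral>y. g y \<partial>m)" by (metis LIMSEQ_unique)
    then show "(\<integral>w. f w \<partial>(m \<bind> P t)) = (\<integral>y. f y \<partial>m)"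
      using integral_bind_P_bounded[OF m fm C(2)] by (simp add: g_def)
  qed (use m in auto)
  then show ?thesis using m unfolding invariant_def by blast
qed

end

section \<open>Uniqueness, and hitting uniformly over initial laws\<close>

context feller_semigroup
begin

lemma av_tendsto_real:
  assumes f [measurable]: "f \<in> borel_measurable borel"
    and bd: "\<And>r. 0 \<le> r \<Longrightarrow> \<bar>\<integral>w. f w \<partial>P r x\<bar> \<le> C"
    and lim: "(\<lambda>n. av (real n) f x) \<longlonglongrightarrow> L"
  shows "((\<lambda>t. av t f x) \<longlongrightarrow> L) at_top"
proof -
  have C: "0 \<le> C" using bd[of 0] by linarith
  have fl: "filterlim (\<lambda>t::real. nat \<lfloor>t\<rfloor>) sequentially at_top"
    by (intro filterlim_compose[OF filterlim_nat_sequentially filterlim_floor_sequentially])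
  have 1: "((\<lambda>t::real. av (real (nat \<lfloor>t\<rfloor>)) f x) \<longlongrightarrow> L) at_top"
    using filterlim_compose[OF lim fl] .
  have "((\<lambda>t. av t f x - av (real (nat \<lfloor>t\<rfloor>)) f x) \<longlongrightarrow> 0) at_top"
  proof (rule Lim_null_comparison)
    show "((\<lambda>t::real. 2 * C / t) \<longlongrightarrow> 0) at_top"
      by (intro tendsto_divide_0[OF tendsto_const] filterlim_at_top_imp_at_infinity filterlim_ident)
    show "\<forall>\<^sub>F t in at_top. norm (av t f x - av (real (nat \<lfloor>t\<rfloor>)) f x) \<le> 2 * C / t"
      using eventually_ge_at_top[of "1::real"]
    proof eventually_elim
      case (elim t)
      then have u: "0 < real (nat \<lfloor>t\<rfloor>)" "real (nat \<lfloor>t\<rfloor>) \<le> t" "t - real (nat \<lfloor>t\<rfloor>) \<le> 1"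
        by linarith+
      have "\<bar>av t f x - av (real (nat \<lfloor>t\<rfloor>)) f x\<bar> \<le> 2 * C * (t - real (nat \<lfloor>t\<rfloor>)) / t"
        unfolding av_def by (rule average_diff_le[OF _ bd u(1,2)]) measurable
      also have "\<dots> \<le> 2 * C * 1 / t"
        using C elim u by (intro divide_right_mono mult_left_mono) auto
      finally show ?case by simp
    qed
  qed
  from tendsto_add[OF this 1] show ?thesis by simp
qed

lemma nn_integral_invariant:
  assumes m: "invariant m" and t: "0 \<le> t" and [measurable]: "g \<in> borel_measurable borel"
  shows "(\<integral>\<^sup>+y. \<integral>\<^sup>+w. g w \<partial>P t y \<partial>m) = (\<integral>\<^sup>+w. g w \<partial>m)"
proof -
  have "(\<integral>\<^sup>+w. g w \<partial>(m \<bind> P t)) = (\<integral>\<^sup>+y. \<integral>\<^sup>+w. g w \<partial>P t y \<partial>m)"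
    using m by (intro nn_integral_bind[where B=borel] P_meas_cong) (auto simp: invariant_def)
  then show ?thesis using m t by (simp add: invariant_def)
qed

lemma
  assumes m: "invariant m" and t: "0 < t" and f [measurable]: "f \<in> borel_measurable borel" and int: "integrable m f"
  shows integrable_av_invariant: "integrable m (av t f)"
    and integral_av_invariant: "(\<integral>y. av t f y \<partial>m) = (\<integral>y. f y \<partial>m)"
proof -
  have p: "prob_space m" "sets m = sets borel" and inv: "\<And>r. 0 \<le> r \<Longrightarrow> m \<bind> P r = m"
    using m by (auto simp: invariant_def)
  have fin: "(\<integral>\<^sup>+w. ennreal \<bar>f w\<bar> \<partial>m) < \<infinity>" using int by (simp add: integrable_iff_bounded)
  define C where "C = enn2real (\<integral>\<^sup>+w. ennreal \<bar>f w\<bar> \<partial>m)"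
  have bd: "(\<integral>\<^sup>+y. \<integral>\<^sup>+w. ennreal \<bar>f w\<bar> \<partial>P r y \<partial>m) \<le> ennreal C" if "0 \<le> r" for r
    using nn_integral_invariant[OF m that, of "\<lambda>w. ennreal \<bar>f w\<bar>"] fin by (simp add: C_def)
  have C: "0 \<le> C" by (simp add: C_def)
  note s = prob_space_imp_subprob_space[OF p(1)]
  show "integrable m (av t f)" using t by (intro integrable_av[OF s p(2) f C bd]) auto
  have "(\<integral>y. av t f y \<partial>m) = (LINT r:{0..t}|lborel. \<integral>w. f w \<partial>(m \<bind> P r)) / t"
    using t by (intro integral_av[OF s p(2) f C bd]) auto
  also have "(LINT r:{0..t}|lborel. \<integral>w. f w \<partial>(m \<bind> P r)) = (LINT r:{0..t}|lborel. \<integral>w. f w \<partial>m)"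
    using inv by (intro set_lebesgue_integral_cong) auto
  finally show "(\<integral>y. av t f y \<partial>m) = (\<integral>y. f y \<partial>m)" using t by (simp add: set_integral_const)
qed

text \<open>Integrating the merging property against \<open>m\<close> identifies the limit, as the
  \<open>m\<close>-mean of \<open>av (real n) f\<close> equals that of \<open>f\<close> for every
  positive \<open>n\<close>.\<close>

lemma av_tendsto_bounded:
  assumes m: "invariant m" and f [measurable]: "f \<in> borel_measurable borel" and bd: "\<And>y. \<bar>f y\<bar> \<le> C"
    and merge: "\<And>x. (\<lambda>n. av (real n) f x - av (real n) f z) \<longlonglongrightarrow> 0"
  shows "(\<lambda>n. av (real n) f x) \<longlonglongrightarrow> (\<integral>y. f y \<partial>m)"
proof -
  have p: "prob_space m" and s: "sets m = sets borel" using m by (auto simp: invariant_def)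
  note s [measurable_cong]
  interpret prob_space m by (rule p)
  have int: "integrable m f" by (rule integrable_bounded[OF _ bd]) measurable
  have ab: "\<bar>av (real n) f y\<bar> \<le> C" for n y by (rule abs_av_le[OF _ f bd]) simp
  have "(\<lambda>n. \<integral>y. av (real n) f y - av (real n) f z \<partial>m) \<longlonglongrightarrow> (\<integral>y. 0 \<partial>m)"
  proof (rule integral_dominated_convergence[where w="\<lambda>_. 2 * C"])
    show "AE y in m. norm (av (real n) f y - av (real n) f z) \<le> 2 * C" for n
    proof (rule AE_I2)
      fix y show "norm (av (real n) f y - av (real n) f z) \<le> 2 * C"
        using ab[of n y] ab[of n z] by simp
    qed
  qed (use merge in auto)
  then have 0: "(\<lambda>n. \<integral>y. av (real n) f y - av (real n) f z \<partial>m) \<longlonglongrightarrow> 0" by simp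
  have "\<forall>\<^sub>F n in sequentially. (\<integral>y. av (real n) f y - av (real n) f z \<partial>m) = (\<integral>y. f y \<partial>m) - av (real n) f z"
    using eventually_gt_at_top[of 0]
  proof eventually_elim
    case (elim n)
    then have "0 < real n" by simp
    then show ?case
      using integrable_av_invariant[OF m _ f int, of "real n"] integral_av_invariant[OF m _ f int, of "real n"]
      by (simp add: prob_space)
  qed
  with 0 have "(\<lambda>n. (\<integral>y. f y \<partial>m) - av (real n) f z) \<longlonglongrightarrow> 0" by (rule Lim_transform_eventually)
  from tendsto_diff[OF merge[of x] this] have "(\<lambda>n. av (real n) f x - (\<integral>y. f y \<partial>m)) \<longlonglongrightarrow> 0" by simp
  then show ?thesis by (simp add: LIM_zero_iff)
qed

lemma invariant_unique:
  assumes merge: "\<And>f x. f \<in> bounded_lipschitz \<Longrightarrow> (\<lambda>n. av (real n) f x - av (real n) f z) \<longlonglongrightarrow> 0"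
    and m: "invariant m" "invariant m'"
  shows "m = m'"
proof (rule measure_eqI_bounded_lipschitz)
  fix f :: "'a \<Rightarrow> real" assume f: "f \<in> bounded_lipschitz"
  then obtain C where C: "\<And>y. \<bar>f y\<bar> \<le> C" by (rule bounded_lipschitzE) blast
  show "(\<integral>y. f y \<partial>m) = (\<integral>y. f y \<partial>m')"
    using av_tendsto_bounded[OF m(1) bounded_lipschitz_measurable[OF f] C merge[OF f]]
      av_tendsto_bounded[OF m(2) bounded_lipschitz_measurable[OF f] C merge[OF f]]
    by (rule LIMSEQ_unique)
qed (use m in \<open>auto simp: invariant_def\<close>)

lemma measure_bind_P_UNIV:
  assumes "subprob_space \<nu>" "sets \<nu> = sets borel"
  shows "measure (\<nu> \<bind> P s) UNIV = measure \<nu> UNIV"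
proof -
  have sp: "space \<nu> = UNIV" using sets_eq_imp_space_eq[OF assms(2)] by simp
  have "emeasure (P s y) UNIV = 1" for y using prob_space.emeasure_space_1[OF P_space, of s y] by simp
  then have "emeasure (\<nu> \<bind> P s) UNIV = emeasure \<nu> UNIV"
    using emeasure_bind[OF _ P_meas_cong[OF assms(2)], of UNIV s] sp by simp
  then show ?thesis by (simp add: measure_def)
qed

text \<open>The lower bound condition provides hitting times that depend on the starting point,
  whereas killing needs one time for a whole law and a \<open>c\<close> independent of that law.
  Averages of \<open>g\<close> converge to the same positive \<open>b\<close> from everywhere, hence
  also under any \<open>\<nu>\<close>, and a time average above the level \<open>b / 2\<close> per
  unit of mass forces a single time above it.\<close>

lemma uniform_hitting:
  assumes m: "invariant m" and r: "0 < r"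
    and merge: "\<And>f x. f \<in> bounded_lipschitz \<Longrightarrow> (\<lambda>n. av (real n) f x - av (real n) f z) \<longlonglongrightarrow> 0"
    and c2: "\<And>r. 0 < r \<Longrightarrow> \<exists>c>0. \<exists>\<^sub>F t in at_top. c < av t (indicator (ball z r)) z"
  shows "\<exists>c>0. \<forall>\<nu>. subprob_space \<nu> \<longrightarrow> sets \<nu> = sets borel \<longrightarrow>
    (\<exists>s\<ge>0. c * measure \<nu> UNIV \<le> measure (\<nu> \<bind> P s) (ball z r))"
proof -
  define g where "g = bump (ball z (r / 2)) (r / 2)"
  have gbl: "g \<in> bounded_lipschitz" unfolding g_def using r by (intro bump_bounded_lipschitz) simp
  have gm [measurable]: "g \<in> borel_measurable borel" by (rule bounded_lipschitz_measurable[OF gbl])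
  have g01: "0 \<le> g y" "g y \<le> 1" "\<bar>g y\<bar> \<le> 1" for y using r by (auto simp: g_def)
  have gball: "g y \<le> indicator (ball z r) y" for y
    unfolding g_def using r by (rule bump_ball_le_indicator)
  define b where "b = (\<integral>y. g y \<partial>m)"
  have lim: "(\<lambda>n. av (real n) g x) \<longlonglongrightarrow> b" for x
    unfolding b_def by (rule av_tendsto_bounded[OF m gm g01(3) merge[OF gbl]])
  \<comment> \<open>The averages of \<open>g\<close> from \<open>z\<close> converge to
    \<open>b\<close> and frequently exceed the constant \<open>c\<close> belonging to radius
    \<open>r / 2\<close>, so \<open>b\<close> is at least \<open>c\<close>.\<close>
  have b: "0 < b"
  proof -
    obtain c where c: "0 < c" "\<exists>\<^sub>F t in at_top. c < av t (indicator (ball z (r / 2))) z"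
      using c2[of "r / 2"] r by auto
    have "((\<lambda>t. av t g z) \<longlongrightarrow> b) at_top"
      by (rule av_tendsto_real[OF gm abs_integral_P_le[OF g01(3)] lim])
    moreover have "\<not> b < c"
    proof
      assume "b < c"
      with calculation have "\<forall>\<^sub>F t in at_top. av t g z < c" by (rule order_tendstoD)
      then have "\<forall>\<^sub>F t in at_top. \<not> c < av t (indicator (ball z (r / 2))) z"
        using eventually_gt_at_top[of 0]
      proof eventually_elim
        case (elim t)
        have "av t (indicator (ball z (r / 2))) z \<le> av t g z"
        proof (rule av_mono[where C=1 and D=1])
          show "indicator (ball z (r / 2)) y \<le> g y" for y
            using g01(1)[of y] by (cases "y \<in> ball z (r / 2)") (auto simp: g_def)
          show "\<bar>indicator (ball z (r / 2)) y\<bar> \<le> (1::real)" for y by (auto split: split_indicator)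
        qed (use elim g01(3) in \<open>auto intro!: borel_measurable_indicator\<close>)
        then show ?case using elim by linarith
      qed
      then show False using c(2) by (simp add: frequently_def)
    qed
    ultimately show ?thesis using c(1) by linarith
  qed
  show ?thesis
  proof (rule exI[of _ "b / 2"], intro conjI allI impI)
    show "0 < b / 2" using b by simp
    fix \<nu> :: "'a measure" assume \<nu>: "subprob_space \<nu>" "sets \<nu> = sets borel"
    interpret \<nu>: subprob_space \<nu> by (rule \<nu>)
    note \<nu>(2) [measurable_cong]
    have sp: "space \<nu> = UNIV" using sets_eq_imp_space_eq[OF \<nu>(2)] by simp
    show "\<exists>s\<ge>0. b / 2 * measure \<nu> UNIV \<le> measure (\<nu> \<bind> P s) (ball z r)"
    \<comment> \<open>The null law admits no strict inequality, but any time works for it.\<close>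
    proof (cases "measure \<nu> UNIV = 0")
      case True
      then show ?thesis by (intro exI[of _ 0]) simp
    next
      case False
      then have pos: "0 < measure \<nu> UNIV" by (simp add: zero_less_measure_iff)
      have "(\<lambda>n. \<integral>y. av (real n) g y \<partial>\<nu>) \<longlonglongrightarrow> (\<integral>y. b \<partial>\<nu>)"
        by (rule integral_dominated_convergence[where w="\<lambda>_. 1"]) (use lim abs_av_le[OF _ gm g01(3)] in auto)
      then have "(\<lambda>n. \<integral>y. av (real n) g y \<partial>\<nu>) \<longlonglongrightarrow> b * measure \<nu> UNIV" by (simp add: sp mult.commute)
      moreover have "b / 2 * measure \<nu> UNIV < b * measure \<nu> UNIV" using b pos by simp
      ultimately have "\<forall>\<^sub>F n in sequentially. b / 2 * measure \<nu> UNIV < (\<integral>y. av (real n) g y \<partial>\<nu>)"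
        by (rule order_tendstoD)
      then have "\<forall>\<^sub>F n in sequentially. b / 2 * measure \<nu> UNIV < (\<integral>y. av (real n) g y \<partial>\<nu>) \<and> 0 < n"
        using eventually_gt_at_top[of 0] by eventually_elim simp
      then obtain n where n: "b / 2 * measure \<nu> UNIV < (\<integral>y. av (real n) g y \<partial>\<nu>)" "0 < n"
        by (auto simp: eventually_sequentially)
      have bd: "(\<integral>\<^sup>+y. \<integral>\<^sup>+w. ennreal \<bar>g w\<bar> \<partial>P r y \<partial>\<nu>) \<le> ennreal 1" for r
      proof -
        have "(\<integral>\<^sup>+y. \<integral>\<^sup>+w. ennreal \<bar>g w\<bar> \<partial>P r y \<partial>\<nu>) \<le> (\<integral>\<^sup>+y. \<integral>\<^sup>+w. ennreal 1 \<partial>P r y \<partial>\<nu>)"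
          using g01(3) by (intro nn_integral_mono ennreal_leI)
        then show ?thesis
          using prob_space.emeasure_space_1[OF P_space] \<nu>.emeasure_space_le_1 by (simp add: order_trans)
      qed
      have eq: "(\<integral>y. av (real n) g y \<partial>\<nu>) = (LINT r:{0..real n}|lborel. \<integral>w. g w \<partial>(\<nu> \<bind> P r)) / real n"
        by (rule integral_av[OF \<nu> gm _ bd]) auto
      have "\<exists>s\<ge>0. b / 2 * measure \<nu> UNIV < (\<integral>w. g w \<partial>(\<nu> \<bind> P s))"
      proof (rule ccontr)
        assume "\<not> ?thesis"
        then have le: "\<And>s. 0 \<le> s \<Longrightarrow> (\<integral>w. g w \<partial>(\<nu> \<bind> P s)) \<le> b / 2 * measure \<nu> UNIV" by (meson not_less)
        have "(LINT r:{0..real n}|lborel. \<integral>w. g w \<partial>(\<nu> \<bind> P r)) \<le> (LINT r:{0..real n}|lborel. b / 2 * measure \<nu> UNIV)"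
        proof (rule set_integral_mono)
          have "(\<lambda>r. \<nu> \<bind> P r) \<in> borel \<rightarrow>\<^sub>M subprob_algebra borel"
            by (rule measurable_bind[where N=borel])
              (use \<nu> in \<open>auto simp: space_subprob_algebra intro!: measurable_const\<close>)
          then have "(\<lambda>r. \<integral>w. g w \<partial>(\<nu> \<bind> P r)) \<in> borel_measurable borel"
            by (rule measurable_compose[OF _ integral_measurable_subprob_algebra]) simp
          then show "set_integrable lborel {0..real n} (\<lambda>r. \<integral>w. g w \<partial>(\<nu> \<bind> P r))"
            by (rule set_integrable_bounded_Icc) (use mean_P_le[OF \<nu> gm _ bd] in auto)
          show "set_integrable lborel {0..real n} (\<lambda>r. b / 2 * measure \<nu> UNIV)"
            by (rule set_integrable_bounded_Icc[where C="\<bar>b / 2 * measure \<nu> UNIV\<bar>"]) auto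
        qed (use le in auto)
        then have "(\<integral>y. av (real n) g y \<partial>\<nu>) \<le> b / 2 * measure \<nu> UNIV"
          unfolding eq using n(2) by (simp add: set_integral_const field_simps)
        then show False using n(1) by simp
      qed
      then obtain s where s: "0 \<le> s" "b / 2 * measure \<nu> UNIV < (\<integral>w. g w \<partial>(\<nu> \<bind> P s))" by blast
      interpret \<nu>': subprob_space "\<nu> \<bind> P s" by (rule subprob_bind_P[OF \<nu>])
      note sets_bind_P[OF \<nu>(2), of s, measurable_cong]
      have "(\<integral>w. g w \<partial>(\<nu> \<bind> P s)) \<le> (\<integral>w. indicator (ball z r) w \<partial>(\<nu> \<bind> P s))"
      proof (rule integral_mono)
        show "integrable (\<nu> \<bind> P s) g" by (rule \<nu>'.integrable_bounded[OF _ g01(3)]) measurable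
        show "integrable (\<nu> \<bind> P s) (indicat_real (ball z r))"
          by (rule \<nu>'.integrable_bounded[where C=1]) (auto intro!: borel_measurable_indicator split: split_indicator)
      qed (rule gball)
      also have "\<dots> = measure (\<nu> \<bind> P s) (ball z r)"
        using sets_eq_imp_space_eq[OF sets_bind_P[OF \<nu>(2), of s]] by simp
      finally show ?thesis using s by (intro exI[of _ s]) auto
    qed
  qed
qed

section \<open>Laws with a common modulus of uniform integrability\<close>

definition tail :: "('a \<Rightarrow> real) \<Rightarrow> real \<Rightarrow> 'a \<Rightarrow> ennreal" where
  "tail f K w = ennreal \<bar>f w\<bar> * indicator {w. K \<le> \<bar>f w\<bar>} w"

definition tail_bounded :: "('a \<Rightarrow> real) \<Rightarrow> (real \<Rightarrow> ennreal) \<Rightarrow> 'a measure \<Rightarrow> bool" where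
  "tail_bounded f \<kappa> \<nu> \<longleftrightarrow> subprob_space \<nu> \<and> sets \<nu> = sets borel \<and>
    (\<forall>K. \<forall>t\<ge>0. (\<integral>\<^sup>+y. \<integral>\<^sup>+w. tail f K w \<partial>P t y \<partial>\<nu>) \<le> \<kappa> K)"

lemma tail_measurable [measurable]:
  assumes [measurable]: "f \<in> borel_measurable borel"
  shows "tail f K \<in> borel_measurable borel"
proof -
  have [measurable]: "{w. K \<le> \<bar>f w\<bar>} \<in> sets borel" by measurable
  show ?thesis unfolding tail_def by measurable
qed

lemma abs_le_tail: "0 \<le> K \<Longrightarrow> ennreal \<bar>f w\<bar> \<le> ennreal K + tail f K w"
  by (cases "K \<le> \<bar>f w\<bar>") (auto simp: tail_def intro: ennreal_leI)

lemma tail_bounded_bind: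
  assumes \<nu>: "tail_bounded f \<kappa> \<nu>" and s: "0 \<le> s" and [measurable]: "f \<in> borel_measurable borel"
  shows "tail_bounded f \<kappa> (\<nu> \<bind> P s)"
  using \<nu> s unfolding tail_bounded_def
  by (auto simp: subprob_bind_P sets_bind_P nn_integral_bind_P)

lemma tail_bounded_restrict:
  assumes \<nu>: "tail_bounded f \<kappa> \<nu>" and [measurable]: "B \<in> sets borel" "f \<in> borel_measurable borel"
  shows "tail_bounded f \<kappa> (density \<nu> (indicator B))"
proof -
  have s: "subprob_space \<nu>" "sets \<nu> = sets borel"
    and le: "\<And>K t. 0 \<le> t \<Longrightarrow> (\<integral>\<^sup>+y. \<integral>\<^sup>+w. tail f K w \<partial>P t y \<partial>\<nu>) \<le> \<kappa> K"
    using \<nu> by (auto simp: tail_bounded_def)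
  interpret subprob_space \<nu> by (rule s)
  note s(2) [measurable_cong]
  have B: "B \<in> sets \<nu>" using s by simp
  have "emeasure (density \<nu> (indicator B)) (space \<nu>) = emeasure \<nu> B"
    using B by (simp add: emeasure_density sets.Int_space_eq2)
  then have "subprob_space (density \<nu> (indicator B))"
    using subprob_not_empty by (intro subprob_spaceI) (auto intro: subprob_emeasure_le_1)
  moreover have "(\<integral>\<^sup>+y. \<integral>\<^sup>+w. tail f K w \<partial>P t y \<partial>density \<nu> (indicator B)) \<le> \<kappa> K" if "0 \<le> t" for K t
  proof -
    have "(\<integral>\<^sup>+y. \<integral>\<^sup>+w. tail f K w \<partial>P t y \<partial>density \<nu> (indicator B))
        = (\<integral>\<^sup>+y. indicator B y * (\<integral>\<^sup>+w. tail f K w \<partial>P t y) \<partial>\<nu>)"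
      by (rule nn_integral_density) measurable
    also have "\<dots> \<le> (\<integral>\<^sup>+y. (\<integral>\<^sup>+w. tail f K w \<partial>P t y) \<partial>\<nu>)"
      by (intro nn_integral_mono) (auto split: split_indicator)
    finally show ?thesis using le[OF that, of K] by (rule order_trans)
  qed
  ultimately show ?thesis using s unfolding tail_bounded_def by simp
qed

lemma tail_bounded_abs:
  assumes \<nu>: "tail_bounded f \<kappa> \<nu>" and K: "0 \<le> K" and r: "0 \<le> r" and [measurable]: "f \<in> borel_measurable borel"
  shows "(\<integral>\<^sup>+y. \<integral>\<^sup>+w. ennreal \<bar>f w\<bar> \<partial>P r y \<partial>\<nu>) \<le> ennreal K + \<kappa> K"
proof -
  have s: "subprob_space \<nu>" "sets \<nu> = sets borel" using \<nu> by (auto simp: tail_bounded_def)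
  interpret subprob_space \<nu> by (rule s)
  note s(2) [measurable_cong]
  have "(\<integral>\<^sup>+y. \<integral>\<^sup>+w. ennreal \<bar>f w\<bar> \<partial>P r y \<partial>\<nu>) \<le> (\<integral>\<^sup>+y. \<integral>\<^sup>+w. ennreal K + tail f K w \<partial>P r y \<partial>\<nu>)"
    by (intro nn_integral_mono abs_le_tail K)
  also have "\<dots> = (\<integral>\<^sup>+y. ennreal K + (\<integral>\<^sup>+w. tail f K w \<partial>P r y) \<partial>\<nu>)"
    using prob_space.emeasure_space_1[OF P_space] by (intro nn_integral_cong) (simp add: nn_integral_add)
  also have "\<dots> = ennreal K * emeasure \<nu> (space \<nu>) + (\<integral>\<^sup>+y. \<integral>\<^sup>+w. tail f K w \<partial>P r y \<partial>\<nu>)"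
    by (subst nn_integral_add) auto
  also have "\<dots> \<le> ennreal K * 1 + \<kappa> K"
    using \<nu> r by (intro add_mono mult_left_mono emeasure_space_le_1) (auto simp: tail_bounded_def)
  finally show ?thesis by simp
qed

lemma tail_small:
  fixes \<kappa> :: "real \<Rightarrow> ennreal"
  assumes "(\<kappa> \<longlongrightarrow> (0::ennreal)) at_top" "0 < (e::real)"
  shows "\<exists>K\<ge>0. \<kappa> K \<le> ennreal e"
proof -
  have "\<forall>\<^sub>F K in at_top. \<kappa> K < ennreal e"
    using assms by (intro order_tendstoD) auto
  then have "\<forall>\<^sub>F K in at_top. \<kappa> K < ennreal e \<and> 0 \<le> K"
    using eventually_ge_at_top[of 0] by eventually_elim simp
  then obtain K where "\<kappa> K < ennreal e \<and> 0 \<le> K" 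
    using eventually_happens'[OF trivial_limit_at_top_linorder] by blast
  then show ?thesis by (auto intro: less_imp_le)
qed

end

section \<open>Unbounded observables\<close>

lemma ennreal_abs_integral_le:
  "ennreal \<bar>\<integral>x. f x \<partial>M :: real\<bar> \<le> (\<integral>\<^sup>+x. ennreal \<bar>f x\<bar> \<partial>M)"
proof (cases "integrable M f")
  case True
  then show ?thesis using integral_norm_bound_ennreal[OF True] by simp
qed (simp add: not_integrable_integral_eq)

context feller_semigroup
begin

lemma nn_abs_av_le:
  assumes t: "0 < t" and f [measurable]: "f \<in> borel_measurable borel"
  shows "ennreal \<bar>av t f y\<bar> \<le> (\<integral>\<^sup>+s. \<integral>\<^sup>+w. ennreal \<bar>f w\<bar> \<partial>P s y \<partial>uniform_measure lborel {0..t})"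
proof -
  have "av t f y = (\<integral>s. \<integral>w. f w \<partial>P s y \<partial>uniform_measure lborel {0..t})"
    unfolding av_def by (rule integral_uniform_Icc[OF t, symmetric]) measurable
  then have "ennreal \<bar>av t f y\<bar> \<le> (\<integral>\<^sup>+s. ennreal \<bar>\<integral>w. f w \<partial>P s y\<bar> \<partial>uniform_measure lborel {0..t})"
    by (simp add: ennreal_abs_integral_le)
  also have "\<dots> \<le> (\<integral>\<^sup>+s. \<integral>\<^sup>+w. ennreal \<bar>f w\<bar> \<partial>P s y \<partial>uniform_measure lborel {0..t})"
    by (intro nn_integral_mono ennreal_abs_integral_le)
  finally show ?thesis .
qed

text \<open>Cutting \<open>f\<close> at level \<open>K\<close> shows that the functions
  \<open>av t f\<close> are uniformly integrable under \<open>\<nu>\<close>: the bound does not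
  involve \<open>t\<close>.\<close>

lemma nn_av_restrict_le:
  assumes \<nu>: "tail_bounded f \<kappa> \<nu>" and K: "0 \<le> K" and t: "0 < t" and f [measurable]: "f \<in> borel_measurable borel"
    and E: "E \<in> sets borel"
  shows "(\<integral>\<^sup>+y. ennreal \<bar>av t f y\<bar> * indicator E y \<partial>\<nu>) \<le> ennreal K * emeasure \<nu> E + \<kappa> K"
proof -
  have s: "subprob_space \<nu>" "sets \<nu> = sets borel"
    and le: "\<And>t. 0 \<le> t \<Longrightarrow> (\<integral>\<^sup>+y. \<integral>\<^sup>+w. tail f K w \<partial>P t y \<partial>\<nu>) \<le> \<kappa> K"
    using \<nu> by (auto simp: tail_bounded_def)
  note s(2) [measurable_cong]
  let ?u = "uniform_measure lborel {0..t}"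
  interpret \<nu>: subprob_space \<nu> by (rule s)
  interpret u: prob_space ?u by (rule prob_space_uniform_Icc[OF t])
  interpret pair_sigma_finite ?u \<nu> ..
  have [measurable]: "E \<in> sets \<nu>" using E s by simp
  have "(\<integral>\<^sup>+y. ennreal \<bar>av t f y\<bar> * indicator E y \<partial>\<nu>)
      \<le> (\<integral>\<^sup>+y. ennreal K * indicator E y + (\<integral>\<^sup>+s. \<integral>\<^sup>+w. tail f K w \<partial>P s y \<partial>?u) \<partial>\<nu>)"
  proof (rule nn_integral_mono)
    fix y
    have "ennreal \<bar>av t f y\<bar> \<le> (\<integral>\<^sup>+s. \<integral>\<^sup>+w. ennreal \<bar>f w\<bar> \<partial>P s y \<partial>?u)" by (rule nn_abs_av_le[OF t f])
    also have "\<dots> \<le> (\<integral>\<^sup>+s. \<integral>\<^sup>+w. ennreal K + tail f K w \<partial>P s y \<partial>?u)"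
      by (intro nn_integral_mono abs_le_tail K)
    also have "\<dots> = (\<integral>\<^sup>+s. ennreal K + (\<integral>\<^sup>+w. tail f K w \<partial>P s y) \<partial>?u)"
      using prob_space.emeasure_space_1[OF P_space] by (intro nn_integral_cong) (simp add: nn_integral_add)
    also have "\<dots> = ennreal K + (\<integral>\<^sup>+s. \<integral>\<^sup>+w. tail f K w \<partial>P s y \<partial>?u)"
      using u.emeasure_space_1 by (subst nn_integral_add) auto
    finally show "ennreal \<bar>av t f y\<bar> * indicator E y
        \<le> ennreal K * indicator E y + (\<integral>\<^sup>+s. \<integral>\<^sup>+w. tail f K w \<partial>P s y \<partial>?u)"
      by (auto split: split_indicator)
  qed
  also have "\<dots> = ennreal K * emeasure \<nu> E + (\<integral>\<^sup>+y. \<integral>\<^sup>+s. \<integral>\<^sup>+w. tail f K w \<partial>P s y \<partial>?u \<partial>\<nu>)"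
    by (subst nn_integral_add) (auto simp: nn_integral_cmult)
  also have "(\<integral>\<^sup>+y. \<integral>\<^sup>+s. \<integral>\<^sup>+w. tail f K w \<partial>P s y \<partial>?u \<partial>\<nu>) = (\<integral>\<^sup>+s. \<integral>\<^sup>+y. \<integral>\<^sup>+w. tail f K w \<partial>P s y \<partial>\<nu> \<partial>?u)"
    by (rule Fubini') measurable
  also have "\<dots> \<le> (\<integral>\<^sup>+s. \<kappa> K \<partial>?u)"
    by (intro nn_integral_mono_AE AE_uniform_measureI) (auto intro: le)
  also have "\<dots> = \<kappa> K" using u.emeasure_space_1 by simp
  finally show ?thesis by (simp add: add_left_mono)
qed

lemma integral_abs_av_restrict_le:
  assumes \<nu>: "tail_bounded f \<kappa> \<nu>" and K: "0 \<le> K" "\<kappa> K \<le> ennreal k" "0 \<le> k" and t: "0 < t"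
    and f [measurable]: "f \<in> borel_measurable borel" and E: "E \<in> sets borel"
  shows "(\<integral>y. \<bar>av t f y\<bar> * indicator E y \<partial>\<nu>) \<le> K * measure \<nu> E + k"
proof -
  have s: "subprob_space \<nu>" "sets \<nu> = sets borel" using \<nu> by (auto simp: tail_bounded_def)
  interpret \<nu>: subprob_space \<nu> by (rule s)
  note s(2) [measurable_cong]
  have [measurable]: "E \<in> sets \<nu>" using E s by simp
  have "(\<integral>\<^sup>+y. ennreal (\<bar>av t f y\<bar> * indicator E y) \<partial>\<nu>) = (\<integral>\<^sup>+y. ennreal \<bar>av t f y\<bar> * indicator E y \<partial>\<nu>)"
    by (intro nn_integral_cong) (auto split: split_indicator)
  also have "\<dots> \<le> ennreal K * emeasure \<nu> E + \<kappa> K" by (rule nn_av_restrict_le[OF \<nu> K(1) t f E])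
  also have "\<dots> \<le> ennreal (K * measure \<nu> E + k)"
    using K by (simp add: \<nu>.emeasure_eq_measure ennreal_mult add_left_mono)
  finally show ?thesis
    using K by (subst integral_eq_nn_integral) (auto intro!: enn2real_leI)
qed

text \<open>\<open>C\<close> depends on \<open>\<kappa>\<close> alone, so it serves all laws met in
  the iteration.\<close>

lemma tail_bounded_const:
  assumes "(\<kappa> \<longlongrightarrow> 0) at_top" and f [measurable]: "f \<in> borel_measurable borel"
  shows "\<exists>C\<ge>0. \<forall>\<nu>. tail_bounded f \<kappa> \<nu> \<longrightarrow> (\<forall>r\<ge>0. (\<integral>\<^sup>+y. \<integral>\<^sup>+w. ennreal \<bar>f w\<bar> \<partial>P r y \<partial>\<nu>) \<le> ennreal C)"
proof -
  obtain K where K: "0 \<le> K" "\<kappa> K \<le> ennreal 1" using tail_small[OF assms(1), of 1] by auto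
  show ?thesis
  proof (rule exI[of _ "K + 1"], intro conjI allI impI)
    fix \<nu> and r :: real assume "tail_bounded f \<kappa> \<nu>" "0 \<le> r"
    then have "(\<integral>\<^sup>+y. \<integral>\<^sup>+w. ennreal \<bar>f w\<bar> \<partial>P r y \<partial>\<nu>) \<le> ennreal K + \<kappa> K"
      using K by (intro tail_bounded_abs) auto
    also have "\<dots> \<le> ennreal K + ennreal 1" using K by (intro add_left_mono)
    finally show "(\<integral>\<^sup>+y. \<integral>\<^sup>+w. ennreal \<bar>f w\<bar> \<partial>P r y \<partial>\<nu>) \<le> ennreal (K + 1)" using K by simp
  qed (use K in simp)
qed

text \<open>An Egorov-Vitali argument: the sets \<open>D N\<close>, on which the bound holds from
  index \<open>N\<close> on, exhaust \<open>B\<close>, and uniform integrability controls the small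
  remainder.\<close>

lemma av_diff_restrict_small:
  fixes a :: "nat \<Rightarrow> real"
  assumes \<nu>: "tail_bounded f \<kappa> \<nu>" and \<kappa>: "(\<kappa> \<longlongrightarrow> 0) at_top" and f [measurable]: "f \<in> borel_measurable borel"
    and a: "\<And>n. \<bar>a n\<bar> \<le> A" and B: "B \<in> sets borel"
    and near: "\<And>y. y \<in> B \<Longrightarrow> \<forall>\<^sub>F n in sequentially. \<bar>av (real n) f y - a n\<bar> \<le> e" and e: "0 \<le> e" and \<eta>: "0 < \<eta>"
  shows "\<forall>\<^sub>F n in sequentially. (\<integral>y. \<bar>av (real n) f y - a n\<bar> * indicator B y \<partial>\<nu>) \<le> e * measure \<nu> B + \<eta>"
proof -
  have s: "subprob_space \<nu>" "sets \<nu> = sets borel" using \<nu> by (auto simp: tail_bounded_def)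
  interpret \<nu>: subprob_space \<nu> by (rule s)
  note s(2) [measurable_cong]
  have [measurable]: "B \<in> sets \<nu>" using B s by simp
  have A0: "0 \<le> A" using a[of 0] by linarith
  obtain C where C: "0 \<le> C" "\<And>r. 0 \<le> r \<Longrightarrow> (\<integral>\<^sup>+y. \<integral>\<^sup>+w. ennreal \<bar>f w\<bar> \<partial>P r y \<partial>\<nu>) \<le> ennreal C"
    using tail_bounded_const[OF \<kappa> f] \<nu> by blast
  have int: "integrable \<nu> (av (real n) f)" for n by (rule integrable_av[OF s f C]) auto
  obtain K where K: "0 \<le> K" "\<kappa> K \<le> ennreal (\<eta> / 2)" using tail_small[OF \<kappa>, of "\<eta> / 2"] \<eta> by auto
  define D where "D N = {y \<in> space \<nu>. y \<in> B \<and> (\<forall>n\<ge>N. \<bar>av (real n) f y - a n\<bar> \<le> e)}" for N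
  have Dm [measurable]: "D N \<in> sets \<nu>" for N unfolding D_def by measurable
  have "(\<Union>N. D N) = B"
    using near sets_eq_imp_space_eq[OF s(2)] by (auto simp: D_def eventually_sequentially)
  moreover have "(\<lambda>N. measure \<nu> (D N)) \<longlonglongrightarrow> measure \<nu> (\<Union>N. D N)"
    by (rule \<nu>.finite_Lim_measure_incseq) (auto simp: incseq_def D_def)
  ultimately have lim: "(\<lambda>N. measure \<nu> (D N)) \<longlonglongrightarrow> measure \<nu> B" by simp
  have sub: "D N \<subseteq> B" for N by (auto simp: D_def)
  have "(\<lambda>N. (K + A) * (measure \<nu> B - measure \<nu> (D N))) \<longlonglongrightarrow> (K + A) * (measure \<nu> B - measure \<nu> B)"
    by (intro tendsto_intros lim)
  then have "\<forall>\<^sub>F N in sequentially. (K + A) * (measure \<nu> B - measure \<nu> (D N)) < \<eta> / 2"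
    using \<eta> by (intro order_tendstoD) auto
  \<comment> \<open>\<open>K + A\<close> is the price per unit of remaining mass, \<open>K\<close>
    for the averages and \<open>A\<close> for \<open>a n\<close>; the other half of
    \<open>\<eta>\<close> pays for the tail \<open>\<kappa> K\<close>.\<close>
  then obtain N where N: "(K + A) * (measure \<nu> B - measure \<nu> (D N)) < \<eta> / 2"
    by (auto simp: eventually_sequentially)
  define E where "E = B - D N"
  have Em [measurable]: "E \<in> sets \<nu>" unfolding E_def by measurable
  have Eb: "E \<in> sets borel" using Em s by simp
  have mE: "measure \<nu> E = measure \<nu> B - measure \<nu> (D N)"
    unfolding E_def by (rule \<nu>.finite_measure_Diff) (use sub in auto)
  show ?thesis
    using eventually_ge_at_top[of "max N 1"]
  proof eventually_elim
    case (elim n)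
    have ii: "integrable \<nu> (\<lambda>y. \<bar>av (real n) f y\<bar> * indicator E y)"
      "integrable \<nu> (\<lambda>y. \<bar>av (real n) f y - a n\<bar> * indicator B y)"
      using int[of n] by (auto intro!: integrable_real_mult_indicator)
    have ii': "integrable \<nu> (indicat_real (D N))" "integrable \<nu> (indicat_real E)"
      by (auto intro!: \<nu>.integrable_bounded[where C=1])
    have "(\<integral>y. \<bar>av (real n) f y - a n\<bar> * indicator B y \<partial>\<nu>)
        \<le> (\<integral>y. e * indicator (D N) y + (\<bar>av (real n) f y\<bar> * indicator E y + A * indicator E y) \<partial>\<nu>)"
    proof (rule integral_mono)
      show "integrable \<nu> (\<lambda>y. e * indicator (D N) y + (\<bar>av (real n) f y\<bar> * indicator E y + A * indicator E y))"
        using ii ii' by auto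
      fix y
      show "\<bar>av (real n) f y - a n\<bar> * indicator B y
          \<le> e * indicator (D N) y + (\<bar>av (real n) f y\<bar> * indicator E y + A * indicator E y)"
      proof (cases "y \<in> D N")
        case True
        then have "\<bar>av (real n) f y - a n\<bar> \<le> e" using elim by (auto simp: D_def)
        then show ?thesis using True sub[of N] A0 by (auto simp: E_def)
      next
        case False
        then show ?thesis using a[of n] by (auto simp: E_def split: split_indicator)
      qed
    qed (rule ii)
    also have "\<dots> = e * measure \<nu> (D N) + ((\<integral>y. \<bar>av (real n) f y\<bar> * indicator E y \<partial>\<nu>) + A * measure \<nu> E)"
      using ii ii' by (simp add: sets_eq_imp_space_eq[OF s(2)])
    also have "\<dots> \<le> e * measure \<nu> B + ((K * measure \<nu> E + \<eta> / 2) + A * measure \<nu> E)"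
    proof (intro add_mono mult_left_mono e)
      show "measure \<nu> (D N) \<le> measure \<nu> B" using sub by (intro \<nu>.finite_measure_mono) auto
      show "(\<integral>y. \<bar>av (real n) f y\<bar> * indicator E y \<partial>\<nu>) \<le> K * measure \<nu> E + \<eta> / 2"
        using elim \<eta> by (intro integral_abs_av_restrict_le[OF \<nu> K _ _ f Eb]) auto
    qed (use A0 in simp_all)
    also have "\<dots> = e * measure \<nu> B + ((K + A) * measure \<nu> E + \<eta> / 2)" by (simp add: algebra_simps)
    also have "\<dots> \<le> e * measure \<nu> B + \<eta>" using N mE by simp
    finally show ?case .
  qed
qed

text \<open>In each round the law evolves until a fraction \<open>c\<close> of its mass lies in
  \<open>B\<close>; that part is settled at price \<open>e\<close> per unit of mass, and the rest is
  treated in the next round. What remains after \<open>k\<close> rounds has mass of order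
  \<open>(1 - c) ^ k\<close> and is estimated crudely.\<close>

lemma av_merge_tail_bounded:
  fixes a :: "nat \<Rightarrow> real"
  assumes \<kappa>: "(\<kappa> \<longlongrightarrow> 0) at_top" and f [measurable]: "f \<in> borel_measurable borel"
    and a: "\<And>n. \<bar>a n\<bar> \<le> A" and B: "B \<in> sets borel"
    and near: "\<And>y. y \<in> B \<Longrightarrow> \<forall>\<^sub>F n in sequentially. \<bar>av (real n) f y - a n\<bar> \<le> e" and e: "0 \<le> e"
    and c: "0 < c" and hit: "\<And>\<nu>. subprob_space \<nu> \<Longrightarrow> sets \<nu> = sets borel \<Longrightarrow>
      \<exists>s\<ge>0. c * measure \<nu> UNIV \<le> measure (\<nu> \<bind> P s) B"
    and \<nu>: "tail_bounded f \<kappa> \<nu>" and \<eta>: "0 < \<eta>"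
  shows "\<forall>\<^sub>F n in sequentially. \<bar>\<integral>y. av (real n) f y - a n \<partial>\<nu>\<bar> \<le> e + \<eta>"
proof -
  have A0: "0 \<le> A" using a[of 0] by linarith
  obtain C where C: "0 \<le> C" "\<And>\<nu> r. tail_bounded f \<kappa> \<nu> \<Longrightarrow> 0 \<le> r \<Longrightarrow>
      (\<integral>\<^sup>+y. \<integral>\<^sup>+w. ennreal \<bar>f w\<bar> \<partial>P r y \<partial>\<nu>) \<le> ennreal C"
    using tail_bounded_const[OF \<kappa> f] by blast
  have sub: "subprob_space \<nu>" "sets \<nu> = sets borel" if "tail_bounded f \<kappa> \<nu>" for \<nu>
    using that by (auto simp: tail_bounded_def)
  have int: "integrable \<nu> (av (real n) f)" if "tail_bounded f \<kappa> \<nu>" for n \<nu>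
    by (rule integrable_av[OF sub[OF that] f C(1) C(2)[OF that]]) auto
  obtain K where K: "0 \<le> K" "\<kappa> K \<le> ennreal (\<eta> / 3)" using tail_small[OF \<kappa>, of "\<eta> / 3"] \<eta> by auto
  have c1: "c \<le> 1"
  proof -
    have r: "subprob_space (return borel undefined :: 'a measure)" by (rule subprob_space_return) simp
    obtain s where "c * measure (return borel undefined :: 'a measure) UNIV \<le> measure (return borel undefined \<bind> P s) B"
      using hit[OF r] by auto
    then show ?thesis
      using subprob_space.subprob_measure_le_1[OF subprob_bind_P[OF r], of s B] by (simp add: measure_return)
  qed
  \<comment> \<open>The term \<open>\<eta> / 3\<close> pays for \<open>\<kappa> K\<close> and is
    charged once, in the base case, rather than once per round. This works because all killed laws
    share the same \<open>\<kappa>\<close>.\<close>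
  have iter: "\<forall>\<^sub>F n in sequentially. \<bar>\<integral>y. av (real n) f y - a n \<partial>\<nu>\<bar>
      \<le> (e + (1 - c) ^ k * (K + A)) * measure \<nu> UNIV + \<eta> / 3 + \<delta>"
    if "tail_bounded f \<kappa> \<nu>" "0 < \<delta>" for k \<nu> \<delta>
    using that
  proof (induction k arbitrary: \<nu> \<delta>)
    case 0
    note s = sub[OF 0(1)]
    interpret \<nu>: subprob_space \<nu> by (rule s)
    note s(2) [measurable_cong]
    have sp: "space \<nu> = UNIV" using sets_eq_imp_space_eq[OF s(2)] by simp
    show ?case using eventually_gt_at_top[of 0]
    proof eventually_elim
      case (elim n)
      have "\<bar>\<integral>y. av (real n) f y - a n \<partial>\<nu>\<bar> \<le> (\<integral>y. \<bar>av (real n) f y - a n\<bar> \<partial>\<nu>)"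
        by (rule integral_abs_bound)
      also have "\<dots> \<le> (\<integral>y. \<bar>av (real n) f y\<bar> * indicator UNIV y + A \<partial>\<nu>)"
      proof (rule integral_mono)
        fix y show "\<bar>av (real n) f y - a n\<bar> \<le> \<bar>av (real n) f y\<bar> * indicator UNIV y + A"
          using a[of n] by simp
      qed (use int[OF 0(1), of n] in auto)
      also have "\<dots> = (\<integral>y. \<bar>av (real n) f y\<bar> * indicator UNIV y \<partial>\<nu>) + A * measure \<nu> UNIV"
        using int[OF 0(1), of n] by (simp add: sp mult.commute)
      also have "\<dots> \<le> (K * measure \<nu> UNIV + \<eta> / 3) + A * measure \<nu> UNIV"
        using elim \<eta> by (intro add_right_mono integral_abs_av_restrict_le[OF 0(1) K _ _ f]) auto
      also have "\<dots> \<le> (e + (1 - c) ^ 0 * (K + A)) * measure \<nu> UNIV + \<eta> / 3 + \<delta>"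
        using e 0(2) by (simp add: algebra_simps)
      finally show ?case .
    qed
  next
    case (Suc k)
    note s = sub[OF Suc.prems(1)]
    obtain u where u: "0 \<le> u" "c * measure \<nu> UNIV \<le> measure (\<nu> \<bind> P u) B" using hit[OF s] by blast
    define \<nu>' where "\<nu>' = \<nu> \<bind> P u"
    \<comment> \<open>The killed law: the mass that is outside \<open>B\<close> at time
      \<open>u\<close>.\<close>
    define \<rho> where "\<rho> = density \<nu>' (indicator (- B))"
    have t': "tail_bounded f \<kappa> \<nu>'" unfolding \<nu>'_def by (rule tail_bounded_bind[OF Suc.prems(1) u(1) f])
    have t\<rho>: "tail_bounded f \<kappa> \<rho>" unfolding \<rho>_def using B by (intro tail_bounded_restrict[OF t']) auto
    note s' = sub[OF t']
    interpret \<nu>: subprob_space \<nu> by (rule s)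
    interpret \<nu>': subprob_space \<nu>' by (rule s')
    note s(2) [measurable_cong] s'(2) [measurable_cong]
    have sp: "space \<nu> = UNIV" "space \<nu>' = UNIV"
      using sets_eq_imp_space_eq[OF s(2)] sets_eq_imp_space_eq[OF s'(2)] by simp_all
    have [measurable]: "B \<in> sets \<nu>'" "- B \<in> sets \<nu>'" using B s' by auto
    have m': "measure \<nu>' UNIV = measure \<nu> UNIV" unfolding \<nu>'_def by (rule measure_bind_P_UNIV[OF s])
    have m\<rho>: "measure \<rho> UNIV = measure \<nu> UNIV - measure \<nu>' B"
    proof -
      have "emeasure \<rho> UNIV = emeasure \<nu>' (UNIV - B)"
        unfolding \<rho>_def using sp B s' by (subst emeasure_density) (auto simp: Compl_eq_Diff_UNIV)
      then have "measure \<rho> UNIV = measure \<nu>' (UNIV - B)" by (simp add: measure_def)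
      also have "\<dots> = measure \<nu>' UNIV - measure \<nu>' B"
        using sp s' by (intro \<nu>'.finite_measure_Diff) auto
      finally show ?thesis by (simp add: m')
    qed
    have "(\<lambda>n. 2 * C * u / real n) \<longlonglongrightarrow> 0"
      by (intro tendsto_divide_0[OF tendsto_const] filterlim_at_top_imp_at_infinity filterlim_real_sequentially)
    then have "\<forall>\<^sub>F n in sequentially. 2 * C * u / real n < \<delta> / 3"
      using Suc.prems by (intro order_tendstoD) auto
    moreover have "\<forall>\<^sub>F n in sequentially. (\<integral>y. \<bar>av (real n) f y - a n\<bar> * indicator B y \<partial>\<nu>') \<le> e * measure \<nu>' B + \<delta> / 3"
      using Suc.prems by (intro av_diff_restrict_small[OF t' \<kappa> f a B near e]) auto
    moreover have "\<forall>\<^sub>F n in sequentially. \<bar>\<integral>y. av (real n) f y - a n \<partial>\<rho>\<bar>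
      \<le> (e + (1 - c) ^ k * (K + A)) * measure \<rho> UNIV + \<eta> / 3 + \<delta> / 3"
      using Suc.prems by (intro Suc.IH[OF t\<rho>]) auto
    ultimately show ?case using eventually_gt_at_top[of 0]
    proof eventually_elim
      case (elim n)
      have i: "integrable \<nu> (av (real n) f)" "integrable \<nu>' (av (real n) f)"
        using int[OF Suc.prems(1)] int[OF t'] by auto
      have iB: "integrable \<nu>' (\<lambda>y. (av (real n) f y - a n) * indicator B y)"
        "integrable \<nu>' (\<lambda>y. (av (real n) f y - a n) * indicator (- B) y)"
        using i by (auto intro!: integrable_real_mult_indicator)
      have 1: "\<bar>(\<integral>y. av (real n) f y - a n \<partial>\<nu>') - (\<integral>y. av (real n) f y - a n \<partial>\<nu>)\<bar> \<le> 2 * C * u / real n"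
      proof -
        have "(\<integral>y. av (real n) f y - a n \<partial>\<nu>') - (\<integral>y. av (real n) f y - a n \<partial>\<nu>)
            = (\<integral>y. av (real n) f y \<partial>\<nu>') - (\<integral>y. av (real n) f y \<partial>\<nu>)"
          using i by (simp add: sp m')
        then show ?thesis
          using integral_av_bind_P_diff_le[OF s f C(1) C(2)[OF Suc.prems(1)] u(1), of "real n"] elim(4)
          by (simp add: \<nu>'_def)
      qed
      have "(\<integral>y. av (real n) f y - a n \<partial>\<nu>')
          = (\<integral>y. (av (real n) f y - a n) * indicator B y + (av (real n) f y - a n) * indicator (- B) y \<partial>\<nu>')"
        by (rule Bochner_Integration.integral_cong) (auto split: split_indicator)
      also have "\<dots> = (\<integral>y. (av (real n) f y - a n) * indicator B y \<partial>\<nu>')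
          + (\<integral>y. (av (real n) f y - a n) * indicator (- B) y \<partial>\<nu>')"
        using iB by simp
      also have "(\<integral>y. (av (real n) f y - a n) * indicator (- B) y \<partial>\<nu>') = (\<integral>y. av (real n) f y - a n \<partial>\<rho>)"
      proof -
        have "\<rho> = density \<nu>' (\<lambda>y. ennreal (indicator (- B) y))" unfolding \<rho>_def by (simp add: ennreal_indicator)
        then show ?thesis by (simp add: integral_density mult.commute)
      qed
      finally have 2: "(\<integral>y. av (real n) f y - a n \<partial>\<nu>')
          = (\<integral>y. (av (real n) f y - a n) * indicator B y \<partial>\<nu>') + (\<integral>y. av (real n) f y - a n \<partial>\<rho>)" .
      have 3: "\<bar>\<integral>y. (av (real n) f y - a n) * indicator B y \<partial>\<nu>'\<bar> \<le> (\<integral>y. \<bar>av (real n) f y - a n\<bar> * indicator B y \<partial>\<nu>')"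
        using integral_abs_bound[of \<nu>' "\<lambda>y. (av (real n) f y - a n) * indicator B y"] by (simp add: abs_mult)
      define w where "w = (1 - c) ^ k * (K + A)"
      have w: "0 \<le> w" using c1 K(1) A0 by (simp add: w_def)
      have "w * measure \<rho> UNIV \<le> w * ((1 - c) * measure \<nu> UNIV)"
        using u(2) w unfolding m\<rho> \<nu>'_def by (intro mult_left_mono) (auto simp: algebra_simps)
      moreover have "\<bar>\<integral>y. av (real n) f y - a n \<partial>\<nu>\<bar>
          \<le> e * measure \<nu>' B + (e + w) * measure \<rho> UNIV + \<eta> / 3 + \<delta>"
        using 1 2 3 elim(1,2,3) unfolding w_def by linarith
      \<comment> \<open>Settled and remaining mass add up to the mass of \<open>\<nu>\<close>, so
        the terms in \<open>e\<close> do not accumulate over the rounds.\<close>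
      moreover have "e * measure \<nu>' B + (e + w) * measure \<rho> UNIV = e * measure \<nu> UNIV + w * measure \<rho> UNIV"
        unfolding m\<rho> by (simp add: algebra_simps)
      ultimately have "\<bar>\<integral>y. av (real n) f y - a n \<partial>\<nu>\<bar> \<le> e * measure \<nu> UNIV + w * ((1 - c) * measure \<nu> UNIV) + \<eta> / 3 + \<delta>"
        by linarith
      then show ?case by (simp add: w_def algebra_simps)
    qed
  qed
  have "(\<lambda>k. (1 - c) ^ k * (K + A)) \<longlonglongrightarrow> 0 * (K + A)"
    using c c1 by (intro tendsto_intros LIMSEQ_power_zero) auto
  then have "\<forall>\<^sub>F k in sequentially. (1 - c) ^ k * (K + A) < \<eta> / 3"
    using \<eta> by (intro order_tendstoD) auto
  then obtain k where k: "(1 - c) ^ k * (K + A) < \<eta> / 3" by (auto simp: eventually_sequentially)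
  have le1: "measure \<nu> UNIV \<le> 1" by (rule subprob_space.subprob_measure_le_1[OF sub(1)[OF \<nu>]])
  show ?thesis
  proof (rule eventually_mono[OF iter[OF \<nu>, of "\<eta> / 3" k]])
    fix n
    assume *: "\<bar>\<integral>y. av (real n) f y - a n \<partial>\<nu>\<bar> \<le> (e + (1 - c) ^ k * (K + A)) * measure \<nu> UNIV + \<eta> / 3 + \<eta> / 3"
    define X where "X = (e + (1 - c) ^ k * (K + A)) * measure \<nu> UNIV"
    have "X \<le> (e + \<eta> / 3) * 1"
      unfolding X_def using k e \<eta> le1 by (intro mult_mono) auto
    then have "X + \<eta> / 3 + \<eta> / 3 \<le> e + \<eta>" by simp
    with *[folded X_def] show "\<bar>\<integral>y. av (real n) f y - a n \<partial>\<nu>\<bar> \<le> e + \<eta>"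
      by (rule order_trans)
  qed (use \<eta> in simp)
qed

end

section \<open>Integrability and convergence\<close>

text \<open>Inner regularity gives a compact subset, and a narrow bump around it does the rest; each
  step costs less than \<open>e / 2\<close> in mean.\<close>

lemma indicator_approx_bounded_lipschitz:
  fixes m :: "'a::polish_space measure"
  assumes m: "prob_space m" "sets m = sets borel" and A: "A \<in> sets borel" and e: "0 < e"
  obtains g where "g \<in> bounded_lipschitz" "\<And>y. \<bar>g y\<bar> \<le> 1" "(\<integral>y. \<bar>indicator A y - g y\<bar> \<partial>m) < e"
proof -
  interpret prob_space m by (rule m)
  note m(2) [measurable_cong]
  have Am [measurable]: "A \<in> sets m" using A m by simp
  have sp: "space m = UNIV" using sets_eq_imp_space_eq[OF m(2)] by simp
  have ind: "integrable m (indicat_real S)" if "S \<in> sets m" for S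
    using that by (intro integrable_bounded[where C=1]) auto
  have "emeasure m A = (SUP K \<in> {K. K \<subseteq> A \<and> compact K}. emeasure m K)"
    by (rule inner_regular[OF m(2) _ A]) simp
  then have "\<exists>K. K \<subseteq> A \<and> compact K \<and> measure m A - e / 2 < measure m K"
  proof (cases "measure m A - e / 2 < 0")
    case True
    then show ?thesis by (intro exI[of _ "{}"]) auto
  next
    case False
    assume eq: "emeasure m A = (SUP K \<in> {K. K \<subseteq> A \<and> compact K}. emeasure m K)"
    have "ennreal (measure m A - e / 2) < emeasure m A"
      using False e by (simp add: emeasure_eq_measure ennreal_less_iff)
    then obtain K where "K \<subseteq> A" "compact K" "ennreal (measure m A - e / 2) < emeasure m K"
      unfolding eq less_SUP_iff by auto
    then show ?thesis using False by (auto simp: emeasure_eq_measure ennreal_less_iff)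
  qed
  then obtain K where K: "K \<subseteq> A" "compact K" "measure m A - e / 2 < measure m K" by blast
  have Km [measurable]: "K \<in> sets m" using K(2) m(2) by (simp add: compact_imp_closed)
  have AK: "(\<integral>y. indicator A y - indicator K y \<partial>m) < e / 2"
    using K(3) ind by (simp add: sp)
  show ?thesis
  \<comment> \<open>The bump of the empty set is constantly 1, so the zero function takes its
    place.\<close>
  proof (cases "K = {}")
    case True
    show ?thesis
    proof (rule that[of "\<lambda>_. 0"])
      show "(\<lambda>_. 0) \<in> bounded_lipschitz" by (rule bounded_lipschitzI[where C=0 and L=0]) auto
      show "(\<integral>y. \<bar>indicator A y - 0\<bar> \<partial>m) < e" using AK True e by (simp add: sp)
    qed simp
  next
    case False
    have "(\<lambda>n. \<integral>y. bump K (1 / real (Suc n)) y \<partial>m) \<longlonglongrightarrow> measure m K"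
      using measure_closed_lim_bump[OF finite_measure_axioms m(2) compact_imp_closed[OF K(2)] False] .
    then have "\<forall>\<^sub>F n in sequentially. (\<integral>y. bump K (1 / real (Suc n)) y \<partial>m) < measure m K + e / 2"
      using e by (intro order_tendstoD) auto
    then obtain n where n: "(\<integral>y. bump K (1 / real (Suc n)) y \<partial>m) < measure m K + e / 2"
      by (auto simp: eventually_sequentially)
    define g where "g = bump K (1 / real (Suc n))"
    have gbl: "g \<in> bounded_lipschitz" unfolding g_def by (intro bump_bounded_lipschitz) simp
    have [measurable]: "g \<in> borel_measurable borel" by (rule bounded_lipschitz_measurable[OF gbl])
    have g1: "0 \<le> g y" "g y \<le> 1" "\<bar>g y\<bar> \<le> 1" for y by (auto simp: g_def)
    have gi: "integrable m g" by (rule integrable_bounded[OF _ g1(3)]) measurable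
    have "(\<integral>y. \<bar>indicator A y - g y\<bar> \<partial>m) \<le> (\<integral>y. (indicator A y - indicator K y) + (g y - indicator K y) \<partial>m)"
    proof (rule integral_mono)
      show "integrable m (\<lambda>y. \<bar>indicator A y - g y\<bar>)"
        "integrable m (\<lambda>y. (indicator A y - indicator K y) + (g y - indicator K y))"
        using ind gi by auto
      fix y
      have "g y = 1" if "y \<in> K" using that by (simp add: g_def)
      then show "\<bar>indicator A y - g y\<bar> \<le> (indicator A y - indicator K y) + (g y - indicator K y)"
        using K(1) g1[of y] by (cases "y \<in> K"; cases "y \<in> A") auto
    qed
    also have "\<dots> = (\<integral>y. indicator A y - indicator K y \<partial>m) + ((\<integral>y. g y \<partial>m) - measure m K)"
      using ind gi by (simp add: sp)
    also have "\<dots> < e" using AK n by (simp add: g_def)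
    finally show ?thesis using that gbl g1(3) by blast
  qed
qed

text \<open>Otherwise a countable base would cover the space by null sets. This supplies
  \<open>z\<close> when mean ergodicity is given.\<close>

lemma exists_support_point:
  fixes m :: "'a::{metric_space, second_countable_topology} measure"
  assumes m: "prob_space m" "sets m = sets borel"
  shows "\<exists>z. \<forall>r>0. 0 < measure m (ball z r)"
proof (rule ccontr)
  assume no: "\<not> ?thesis"
  interpret prob_space m by (rule m)
  obtain \<B> :: "'a set set" where \<B>: "countable \<B>" "topological_basis \<B>"
    using ex_countable_basis by blast
  define \<N> where "\<N> = {U \<in> \<B>. measure m U \<le> 0}"
  have "\<Union>\<N> \<in> null_sets m"
  proof (rule null_sets_UN'[of \<N> "\<lambda>U. U", simplified])
    show "countable \<N>" using \<B>(1) by (auto simp: \<N>_def intro: countable_subset)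
    fix U assume U: "U \<in> \<N>"
    then have "open U" using topological_basis_open[OF \<B>(2)] by (auto simp: \<N>_def)
    moreover have "measure m U \<le> 0" using U by (auto simp: \<N>_def)
    ultimately show "U \<in> null_sets m"
      using m(2) by (auto simp: null_sets_def emeasure_eq_measure measure_le_0_iff)
  qed
  moreover have "y \<in> \<Union>\<N>" for y
  proof -
    obtain r where r: "0 < r" "measure m (ball y r) \<le> 0" using no by (meson not_less)
    obtain V where V: "V \<in> \<B>" "y \<in> V" "V \<subseteq> ball y r"
      using topological_basisE[OF \<B>(2) open_ball, of y y r] r(1) by auto
    have "measure m V \<le> measure m (ball y r)" using V m(2) by (intro finite_measure_mono) auto
    then have "V \<in> \<N>" using V r by (simp add: \<N>_def)
    then show ?thesis using V by blast
  qed
  then have "\<Union>\<N> = space m" using sets_eq_imp_space_eq[OF m(2)] by auto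
  ultimately show False using emeasure_space_1 by (auto simp: null_sets_def)
qed

context feller_semigroup
begin

text \<open>Merging is available for Lipschitz functions only. Averaging preserves the
  \<open>m\<close>-mean of the approximation error \<open>d\<close>, so the convergence passes to
  indicators in the mean, though not pointwise.\<close>

lemma indicator_av_L1:
  assumes m: "invariant m" and A [measurable]: "A \<in> sets borel"
    and merge: "\<And>f x. f \<in> bounded_lipschitz \<Longrightarrow> (\<lambda>n. av (real n) f x - av (real n) f z) \<longlonglongrightarrow> 0"
  shows "(\<lambda>n. \<integral>y. \<bar>av (real n) (indicator A) y - measure m A\<bar> \<partial>m) \<longlonglongrightarrow> 0"
proof (rule LIMSEQ_I)
  fix e :: real assume e: "0 < e"
  have p: "prob_space m" "sets m = sets borel" using m by (auto simp: invariant_def)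
  interpret prob_space m by (rule p)
  note p(2) [measurable_cong]
  have [measurable]: "A \<in> sets m" using A p by simp
  have sp: "space m = UNIV" using sets_eq_imp_space_eq[OF p(2)] by simp
  obtain g where g: "g \<in> bounded_lipschitz" "\<And>y. \<bar>g y\<bar> \<le> 1" "(\<integral>y. \<bar>indicator A y - g y\<bar> \<partial>m) < e / 3"
    using indicator_approx_bounded_lipschitz[OF p A, of "e / 3"] e by auto
  have gm [measurable]: "g \<in> borel_measurable borel" by (rule bounded_lipschitz_measurable[OF g(1)])
  have im [measurable]: "indicat_real A \<in> borel_measurable borel" by measurable
  have i1: "\<bar>indicat_real A y\<bar> \<le> 1" for y by (auto split: split_indicator)
  define d where "d y = \<bar>indicator A y - g y\<bar>" for y
  have dm [measurable]: "d \<in> borel_measurable borel" unfolding d_def by measurable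
  have d2: "\<bar>d y\<bar> \<le> 2" for y using g(2)[of y] i1[of y] unfolding d_def by linarith
  have ig: "integrable m g" "integrable m (indicat_real A)" "integrable m d"
    by (rule integrable_bounded[OF _ g(2)], measurable, rule integrable_bounded[OF _ i1], measurable,
      rule integrable_bounded[OF _ d2], measurable)
  have dg: "\<bar>measure m A - (\<integral>y. g y \<partial>m)\<bar> < e / 3"
  proof -
    have "measure m A - (\<integral>y. g y \<partial>m) = (\<integral>y. indicator A y - g y \<partial>m)" using ig by (simp add: sp)
    also have "\<bar>\<dots>\<bar> \<le> (\<integral>y. \<bar>indicator A y - g y\<bar> \<partial>m)" by (rule integral_abs_bound)
    finally show ?thesis using g(3) by linarith
  qed
  have "(\<lambda>n. \<integral>y. \<bar>av (real n) g y - (\<integral>y. g y \<partial>m)\<bar> \<partial>m) \<longlonglongrightarrow> (\<integral>y. 0 \<partial>m)"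
  proof (rule integral_dominated_convergence[where w="\<lambda>_. 2"])
    show "AE y in m. (\<lambda>n. \<bar>av (real n) g y - (\<integral>y. g y \<partial>m)\<bar>) \<longlonglongrightarrow> 0"
    proof (rule AE_I2)
      fix y
      have "(\<lambda>n. av (real n) g y - (\<integral>y. g y \<partial>m)) \<longlonglongrightarrow> 0"
        using av_tendsto_bounded[OF m gm g(2) merge[OF g(1)], of y] by (simp add: LIM_zero_iff)
      then show "(\<lambda>n. \<bar>av (real n) g y - (\<integral>y. g y \<partial>m)\<bar>) \<longlonglongrightarrow> 0" by (rule tendsto_rabs_zero)
    qed
    show "AE y in m. norm \<bar>av (real n) g y - (\<integral>y. g y \<partial>m)\<bar> \<le> 2" for n
    proof (rule AE_I2)
      fix y
      show "norm \<bar>av (real n) g y - (\<integral>y. g y \<partial>m)\<bar> \<le> 2"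
        using abs_av_le[OF _ gm g(2), of "real n" y] abs_integral_le_const[where f=g, OF g(2)] by simp
    qed
  qed auto
  then have "\<forall>\<^sub>F n in sequentially. (\<integral>y. \<bar>av (real n) g y - (\<integral>y. g y \<partial>m)\<bar> \<partial>m) < e / 3"
    using e by (intro order_tendstoD) auto
  then have "\<forall>\<^sub>F n in sequentially. norm ((\<integral>y. \<bar>av (real n) (indicator A) y - measure m A\<bar> \<partial>m) - 0) < e"
    using eventually_gt_at_top[of 0]
  proof eventually_elim
    case (elim n)
    then have n: "0 < real n" by simp
    have ai: "integrable m (av (real n) g)" "integrable m (av (real n) (indicat_real A))" "integrable m (av (real n) d)"
      using ig by (auto intro!: integrable_av_invariant[OF m n])
    have "(\<integral>y. \<bar>av (real n) (indicator A) y - measure m A\<bar> \<partial>m)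
        \<le> (\<integral>y. av (real n) d y + (\<bar>av (real n) g y - (\<integral>y. g y \<partial>m)\<bar> + \<bar>measure m A - (\<integral>y. g y \<partial>m)\<bar>) \<partial>m)"
    proof (rule integral_mono)
      fix y
      interpret q: prob_space "Q (real n) y" by (rule prob_space_Q[OF n])
      have "av (real n) (indicator A) y - av (real n) g y = (\<integral>w. indicator A w - g w \<partial>Q (real n) y)"
        using integral_Q[OF n im i1, of y] integral_Q[OF n gm g(2), of y]
          integrable_Q[OF n im i1, of y] integrable_Q[OF n gm g(2), of y] by simp
      also have "\<bar>\<dots>\<bar> \<le> (\<integral>w. d w \<partial>Q (real n) y)" unfolding d_def by (rule integral_abs_bound)
      also have "\<dots> = av (real n) d y" by (rule integral_Q[OF n dm d2])
      finally show "\<bar>av (real n) (indicator A) y - measure m A\<bar>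
          \<le> av (real n) d y + (\<bar>av (real n) g y - (\<integral>y. g y \<partial>m)\<bar> + \<bar>measure m A - (\<integral>y. g y \<partial>m)\<bar>)"
        by linarith
    qed (use ai in auto)
    also have "\<dots> = (\<integral>y. d y \<partial>m) + ((\<integral>y. \<bar>av (real n) g y - (\<integral>y. g y \<partial>m)\<bar> \<partial>m) + \<bar>measure m A - (\<integral>y. g y \<partial>m)\<bar>)"
      using ai integral_av_invariant[OF m n dm ig(3)] by (simp add: prob_space)
    also have "\<dots> < e" using g(3) dg elim(1) unfolding d_def by linarith
    finally show ?case by simp
  qed
  then show "\<exists>N. \<forall>n\<ge>N. norm ((\<integral>y. \<bar>av (real n) (indicator A) y - measure m A\<bar> \<partial>m) - 0) < e"
    by (simp add: eventually_sequentially)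
qed

lemma tail_bounded_return:
  assumes [measurable]: "f \<in> borel_measurable borel"
  shows "tail_bounded f (\<lambda>K. SUP t\<in>{0..}. \<integral>\<^sup>+w. tail f K w \<partial>P t x) (return borel x)"
  unfolding tail_bounded_def
  by (auto simp: subprob_space_return nn_integral_return intro!: SUP_upper)

lemma tail_bounded_return_const:
  assumes f [measurable]: "f \<in> borel_measurable borel"
    and ui: "((\<lambda>K. SUP t\<in>{0..}. \<integral>\<^sup>+w. tail f K w \<partial>P t x) \<longlongrightarrow> 0) at_top"
  shows "\<exists>C\<ge>0. \<forall>r\<ge>0. (\<integral>\<^sup>+w. ennreal \<bar>f w\<bar> \<partial>P r x) \<le> ennreal C \<and> \<bar>\<integral>w. f w \<partial>P r x\<bar> \<le> C"
proof -
  obtain C where C: "0 \<le> C" "\<And>r. 0 \<le> r \<Longrightarrow> (\<integral>\<^sup>+w. ennreal \<bar>f w\<bar> \<partial>P r x) \<le> ennreal C"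
    using tail_bounded_const[OF ui f] tail_bounded_return[OF f, of x] by (auto simp: nn_integral_return)
  show ?thesis
  proof (rule exI[of _ C], intro conjI allI impI C)
    fix r :: real assume "0 \<le> r"
    have "ennreal \<bar>\<integral>w. f w \<partial>P r x\<bar> \<le> ennreal C"
      using ennreal_abs_integral_le[of "P r x" f] C(2)[OF \<open>0 \<le> r\<close>] by (rule order_trans)
    then show "\<bar>\<integral>w. f w \<partial>P r x\<bar> \<le> C" using C(1) by simp
  qed
qed

lemma abs_av_le_of_mean:
  assumes f [measurable]: "f \<in> borel_measurable borel" and C: "\<And>r. 0 \<le> r \<Longrightarrow> \<bar>\<integral>w. f w \<partial>P r x\<bar> \<le> C" and t: "0 \<le> t"
  shows "\<bar>av t f x\<bar> \<le> C"
proof (cases "t = 0")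
  case True
  then show ?thesis using C[of 0] by (simp add: av_def)
next
  case False
  have i: "set_integrable lborel {0..t} (\<lambda>s. \<integral>w. f w \<partial>P s x)"
    by (rule set_integrable_bounded_Icc[where C=C]) (use C in auto)
  have "\<bar>LINT s:{0..t}|lborel. \<integral>w. f w \<partial>P s x\<bar> \<le> (LINT s:{0..t}|lborel. \<bar>\<integral>w. f w \<partial>P s x\<bar>)"
    using set_integral_norm_bound[OF i] by simp
  also have "\<dots> \<le> (LINT s:{0..t}|lborel. C)"
  proof (rule set_integral_mono[OF set_integrable_abs[OF i]])
    show "set_integrable lborel {0..t} (\<lambda>s. C)"
      by (rule set_integrable_bounded_Icc[where C="\<bar>C\<bar>"]) auto
  qed (use C in auto)
  finally show ?thesis using t False by (simp add: av_def set_integral_const field_simps)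
qed

text \<open>The averages of the absolute value of \<open>f\<close> are bounded from each point,
  hence uniformly on a set of measure above one half. There the averages of the level set indicators
  are close in mean to the measures of the level sets, which bounds the sum of these
  measures.\<close>

lemma integrable_of_uniformly_integrable:
  assumes m: "invariant m" and f [measurable]: "f \<in> borel_measurable borel"
    and ui: "\<And>x. ((\<lambda>K. SUP t\<in>{0..}. \<integral>\<^sup>+w. tail f K w \<partial>P t x) \<longlongrightarrow> 0) at_top"
    and merge: "\<And>f x. f \<in> bounded_lipschitz \<Longrightarrow> (\<lambda>n. av (real n) f x - av (real n) f z) \<longlonglongrightarrow> 0"
  shows "integrable m f"
proof -
  have p: "prob_space m" "sets m = sets borel" using m by (auto simp: invariant_def)
  interpret prob_space m by (rule p)
  note p(2) [measurable_cong]
  have sp: "space m = UNIV" using sets_eq_imp_space_eq[OF p(2)] by simp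
  define A where "A j = {w. real (Suc j) \<le> \<bar>f w\<bar>}" for j
  have Ab [measurable]: "A j \<in> sets borel" for j unfolding A_def by measurable
  have Am [measurable]: "A j \<in> sets m" for j using Ab p by simp
  \<comment> \<open>The integer part of the absolute value of \<open>f\<close>, cut off at
    \<open>k\<close> and written as a layer-cake sum.\<close>
  define \<phi> where "\<phi> k w = (\<Sum>j<k. indicat_real (A j) w)" for k w
  have \<phi>m [measurable]: "\<phi> k \<in> borel_measurable borel" for k unfolding \<phi>_def by measurable
  have \<phi>0: "0 \<le> \<phi> k w" for k w unfolding \<phi>_def by (rule sum_nonneg) simp
  have \<phi>k: "\<bar>\<phi> k w\<bar> \<le> real k" for k w
  proof -
    have "\<phi> k w \<le> (\<Sum>j<k. 1)" unfolding \<phi>_def by (rule sum_mono) (auto split: split_indicator)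
    then show ?thesis using \<phi>0[of k w] by simp
  qed
  have \<phi>f: "\<phi> k w \<le> \<bar>f w\<bar>" for k w
  proof -
    have "\<phi> k w = real (card {j. j < k \<and> real (Suc j) \<le> \<bar>f w\<bar>})"
      unfolding \<phi>_def indicator_def A_def by (simp add: sum.If_cases Int_def flip: of_bool_def)
    also have "card {j. j < k \<and> real (Suc j) \<le> \<bar>f w\<bar>} \<le> card {..<nat \<lfloor>\<bar>f w\<bar>\<rfloor>}"
    proof (rule card_mono)
      show "{j. j < k \<and> real (Suc j) \<le> \<bar>f w\<bar>} \<subseteq> {..<nat \<lfloor>\<bar>f w\<bar>\<rfloor>}"
        by auto linarith
    qed simp
    also have "real (card {..<nat \<lfloor>\<bar>f w\<bar>\<rfloor>}) \<le> \<bar>f w\<bar>" by simp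
    finally show ?thesis by simp
  qed
  have \<phi>le: "\<bar>f w\<bar> \<le> 1 + \<phi> (nat \<lfloor>\<bar>f w\<bar>\<rfloor>) w" for w
  proof -
    have "\<phi> (nat \<lfloor>\<bar>f w\<bar>\<rfloor>) w = (\<Sum>j<nat \<lfloor>\<bar>f w\<bar>\<rfloor>. 1)"
      unfolding \<phi>_def
    proof (rule sum.cong)
      fix j assume "j \<in> {..<nat \<lfloor>\<bar>f w\<bar>\<rfloor>}"
      then have "real (Suc j) \<le> \<bar>f w\<bar>" by simp linarith
      then show "indicat_real (A j) w = 1" by (simp add: A_def)
    qed simp
    then show ?thesis by simp linarith
  qed
  define S where "S c = {y \<in> space m. \<forall>n\<ge>1. \<forall>k. av (real n) (\<phi> k) y \<le> real c}" for c :: nat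
  have Sm [measurable]: "S c \<in> sets m" for c unfolding S_def by measurable
  have "(\<Union>c. S c) = UNIV"
  proof -
    have "\<exists>c. y \<in> S c" for y
    proof -
      obtain C where C: "0 \<le> C" "\<And>r. 0 \<le> r \<Longrightarrow> (\<integral>\<^sup>+w. ennreal \<bar>f w\<bar> \<partial>P r y) \<le> ennreal C"
        using tail_bounded_return_const[OF f ui, of y] by blast
      obtain c :: nat where c: "C \<le> real c" using real_arch_simple by blast
      have "\<bar>\<integral>w. \<phi> k w \<partial>P r y\<bar> \<le> C" if "0 \<le> r" for r k
      proof -
        have "ennreal \<bar>\<integral>w. \<phi> k w \<partial>P r y\<bar> \<le> (\<integral>\<^sup>+w. ennreal \<bar>\<phi> k w\<bar> \<partial>P r y)" by (rule ennreal_abs_integral_le)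
        also have "\<dots> \<le> (\<integral>\<^sup>+w. ennreal \<bar>f w\<bar> \<partial>P r y)"
          using \<phi>f \<phi>0 by (intro nn_integral_mono ennreal_leI) simp
        also have "\<dots> \<le> ennreal C" by (rule C(2)[OF that])
        finally show ?thesis using C(1) by simp
      qed
      then have "\<bar>av (real n) (\<phi> k) y\<bar> \<le> C" for n k by (rule abs_av_le_of_mean[OF \<phi>m]) auto
      then have "av (real n) (\<phi> k) y \<le> real c" for n k using c by (smt (verit))
      then show ?thesis unfolding S_def sp by blast
    qed
    then show ?thesis by blast
  qed
  then have "measure m (\<Union>c. S c) = 1" using prob_space sp by simp
  moreover have "(\<lambda>c. measure m (S c)) \<longlonglongrightarrow> measure m (\<Union>c. S c)"
  proof (rule finite_Lim_measure_incseq)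
    show "incseq S"
    proof (intro monoI subsetI)
      fix c c' :: nat and y assume "c \<le> c'" "y \<in> S c"
      then have "\<forall>n\<ge>1. \<forall>k. av (real n) (\<phi> k) y \<le> real c" by (simp add: S_def)
      moreover have "real c \<le> real c'" using \<open>c \<le> c'\<close> by simp
      ultimately show "y \<in> S c'" unfolding S_def sp using order_trans by blast
    qed
  qed auto
  ultimately have "(\<lambda>c. measure m (S c)) \<longlonglongrightarrow> 1" by simp
  then have "\<forall>\<^sub>F c in sequentially. 1 / 2 < measure m (S c)" by (rule order_tendstoD) simp
  then obtain c where c: "1 / 2 < measure m (S c)" by (auto simp: eventually_sequentially)
  \<comment> \<open>On \<open>S c\<close> the sum \<open>v\<close> exceeds \<open>c\<close> by at
    most the deviation of the averages from the level set measures. Integrating over this set, of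
    measure above one half, gives the factor 2.\<close>
  have bound: "(\<Sum>j<k. measure m (A j)) \<le> 2 * real c" for k
  proof -
    define v where "v = (\<Sum>j<k. measure m (A j))"
    have v0: "0 \<le> v" unfolding v_def by (rule sum_nonneg) simp
    have "(\<lambda>n. real c + (\<Sum>j<k. \<integral>y. \<bar>av (real n) (indicator (A j)) y - measure m (A j)\<bar> \<partial>m)) \<longlonglongrightarrow> real c + (\<Sum>j<k. 0)"
      by (intro tendsto_add tendsto_const tendsto_sum indicator_av_L1[OF m Ab merge])
    moreover have "\<forall>\<^sub>F n in sequentially. v / 2 \<le> real c + (\<Sum>j<k. \<integral>y. \<bar>av (real n) (indicator (A j)) y - measure m (A j)\<bar> \<partial>m)"
      using eventually_ge_at_top[of 1]
    proof eventually_elim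
      case (elim n)
      then have n: "0 < real n" by simp
      have i1: "\<bar>indicat_real (A j) y\<bar> \<le> 1" for j y by (auto split: split_indicator)
      have im: "indicat_real (A j) \<in> borel_measurable borel" for j by measurable
      have ai: "integrable m (av (real n) (indicat_real (A j)))" for j
        by (rule integrable_bounded[where C=1]) (use abs_av_le[OF _ im i1] in auto)
      have eq: "av (real n) (\<phi> k) y = (\<Sum>j<k. av (real n) (indicator (A j)) y)" for y
        unfolding \<phi>_def integral_Q[OF n \<phi>m[unfolded \<phi>_def] \<phi>k[unfolded \<phi>_def], symmetric]
          integral_Q[OF n im i1, symmetric]
        by (rule Bochner_Integration.integral_sum) (rule integrable_Q[OF n im i1])
      have "v / 2 \<le> v * measure m (S c)" using c v0 mult_left_mono[of "1/2" "measure m (S c)" v] by simp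
      also have "\<dots> = (\<integral>y. v * indicator (S c) y \<partial>m)" by (simp add: sp)
      also have "\<dots> \<le> (\<integral>y. real c + (\<Sum>j<k. \<bar>av (real n) (indicator (A j)) y - measure m (A j)\<bar>) \<partial>m)"
      proof (rule integral_mono)
        show "integrable m (\<lambda>y. v * indicator (S c) y)"
          by (rule integrable_bounded[where C=v]) (use v0 in \<open>auto split: split_indicator\<close>)
        show "integrable m (\<lambda>y. real c + (\<Sum>j<k. \<bar>av (real n) (indicator (A j)) y - measure m (A j)\<bar>))"
          using ai by auto
        fix y
        have nn: "0 \<le> (\<Sum>j<k. \<bar>av (real n) (indicator (A j)) y - measure m (A j)\<bar>)" by (rule sum_nonneg) simp
        show "v * indicator (S c) y \<le> real c + (\<Sum>j<k. \<bar>av (real n) (indicator (A j)) y - measure m (A j)\<bar>)"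
        proof (cases "y \<in> S c")
          case True
          then have "av (real n) (\<phi> k) y \<le> real c" using elim unfolding S_def by simp
          then have 1: "(\<Sum>j<k. av (real n) (indicator (A j)) y) \<le> real c" unfolding eq .
          have "v - (\<Sum>j<k. av (real n) (indicator (A j)) y) = (\<Sum>j<k. measure m (A j) - av (real n) (indicator (A j)) y)"
            unfolding v_def sum_subtractf ..
          also have "\<dots> \<le> (\<Sum>j<k. \<bar>av (real n) (indicator (A j)) y - measure m (A j)\<bar>)"
            by (rule sum_mono) simp
          finally show ?thesis using 1 True by simp
        qed (use nn in simp)
      qed
      also have "\<dots> = real c + (\<Sum>j<k. \<integral>y. \<bar>av (real n) (indicator (A j)) y - measure m (A j)\<bar> \<partial>m)"
        using ai by (subst Bochner_Integration.integral_add) (auto simp: prob_space intro!: Bochner_Integration.integral_sum)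
      finally show ?case .
    qed
    ultimately have "v / 2 \<le> real c + (\<Sum>j<k. 0)"
      by (intro tendsto_lowerbound[OF _ _ trivial_limit_sequentially])
    then show ?thesis unfolding v_def by simp
  qed
  have "(\<integral>\<^sup>+w. ennreal \<bar>f w\<bar> \<partial>m) \<le> (\<integral>\<^sup>+w. 1 + (\<Sum>j. indicator (A j) w) \<partial>m)"
  proof (rule nn_integral_mono)
    fix w
    define k where "k = nat \<lfloor>\<bar>f w\<bar>\<rfloor>"
    have "ennreal \<bar>f w\<bar> \<le> ennreal (1 + \<phi> k w)" using \<phi>le[of w] unfolding k_def by (rule ennreal_leI)
    also have "\<dots> = 1 + (\<Sum>j<k. indicator (A j) w)"
      using \<phi>0[of k w] by (simp add: \<phi>_def ennreal_plus sum_ennreal[symmetric] ennreal_indicator)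
    also have "\<dots> \<le> 1 + (\<Sum>j. indicator (A j) w)"
      by (intro add_left_mono sum_le_suminf) auto
    finally show "ennreal \<bar>f w\<bar> \<le> 1 + (\<Sum>j. indicator (A j) w)" .
  qed
  also have "\<dots> = 1 + (\<Sum>j. emeasure m (A j))"
    by (subst nn_integral_add) (auto simp: nn_integral_suminf emeasure_space_1)
  also have "\<dots> \<le> 1 + ennreal (2 * real c)"
  proof (intro add_left_mono suminf_le_const)
    fix k
    have "(\<Sum>j<k. emeasure m (A j)) = ennreal (\<Sum>j<k. measure m (A j))"
      by (simp add: emeasure_eq_measure sum_ennreal)
    also have "\<dots> \<le> ennreal (2 * real c)" using bound by (rule ennreal_leI)
    finally show "(\<Sum>j<k. emeasure m (A j)) \<le> ennreal (2 * real c)" .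
  qed simp
  also have "\<dots> < \<infinity>" by simp
  finally show ?thesis unfolding integrable_iff_bounded by simp
qed

theorem mean_ergodic_of_lower_bound:
  assumes F: "\<And>f. f \<in> F \<Longrightarrow> f \<in> borel_measurable borel" "bounded_lipschitz \<subseteq> F"
    and ui: "\<And>f x. f \<in> F \<Longrightarrow> ((\<lambda>K. SUP t\<in>{0..}. \<integral>\<^sup>+w. tail f K w \<partial>P t x) \<longlongrightarrow> 0) at_top"
    and ec: "\<And>f e. f \<in> F \<Longrightarrow> 0 < e \<Longrightarrow> \<exists>r>0. \<forall>x\<in>ball z r. \<forall>\<^sub>F n in sequentially. \<bar>av (real n) f x - av (real n) f z\<bar> < e"
    and c2: "\<And>r. 0 < r \<Longrightarrow> \<exists>c>0. \<forall>x. \<exists>\<^sub>F t in at_top. c < av t (indicator (ball z r)) x"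
  shows "\<exists>!m. invariant m"
    and "\<And>m f. invariant m \<Longrightarrow> f \<in> F \<Longrightarrow> integrable m f"
    and "\<And>m f x. invariant m \<Longrightarrow> f \<in> F \<Longrightarrow> ((\<lambda>t. av t f x) \<longlongrightarrow> (\<integral>y. f y \<partial>m)) at_top"
proof -
  have lb: "\<exists>c>0. \<forall>x. \<exists>s\<ge>0. c \<le> measure (P s x) (ball z r)" if "0 < r" for r
  proof -
    obtain c where c: "0 < c" "\<And>x. \<exists>\<^sub>F t in at_top. c < av t (indicator (ball z r)) x" using c2[OF \<open>0 < r\<close>] by blast
    have "\<exists>s\<ge>0. c \<le> measure (P s x) (ball z r)" for x
    proof -
      have "\<exists>\<^sub>F t in at_top. c < av t (indicator (ball z r)) x \<and> 0 < t"
        by (rule frequently_rev_mp[OF c(2)[of x]])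
          (rule eventually_mono[OF eventually_gt_at_top[of 0]], simp)
      then obtain t where "c < av t (indicator (ball z r)) x" "0 < t" using frequently_ex by blast
      then show ?thesis by (intro hits_of_av[of t]) auto
    qed
    then show ?thesis using c(1) by blast
  qed
  have merge: "(\<lambda>n. av (real n) f x - av (real n) f z) \<longlonglongrightarrow> 0" if f: "f \<in> bounded_lipschitz" for f x
  proof -
    obtain C where C: "\<And>y. \<bar>f y\<bar> \<le> C" using f by (rule bounded_lipschitzE) blast
    show ?thesis
      by (rule averages_merge_bounded[OF bounded_lipschitz_measurable[OF f] C ec lb]) (use f F in auto)
  qed
  have c2z: "\<exists>c>0. \<exists>\<^sub>F t in at_top. c < av t (indicator (ball z r)) z" if "0 < r" for r
    using c2[OF that] by blast
  show "\<exists>!m. invariant m"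
    using invariant_exists[OF merge c2z] invariant_unique[OF merge] by blast
  show int: "integrable m f" if "invariant m" "f \<in> F" for m f
    by (rule integrable_of_uniformly_integrable[OF that(1) F(1)[OF that(2)] ui[OF that(2)] merge])
  show "((\<lambda>t. av t f x) \<longlongrightarrow> (\<integral>y. f y \<partial>m)) at_top" if m: "invariant m" and f: "f \<in> F" for m f x
  proof -
    have fm [measurable]: "f \<in> borel_measurable borel" by (rule F(1)[OF f])
    obtain A where A: "0 \<le> A" "\<And>r. 0 \<le> r \<Longrightarrow> \<bar>\<integral>w. f w \<partial>P r z\<bar> \<le> A"
      using tail_bounded_return_const[OF fm ui[OF f], of z] by blast
    have a: "\<bar>av (real n) f z\<bar> \<le> A" for n by (rule abs_av_le_of_mean[OF fm A(2)]) auto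
    \<comment> \<open>Merging for the possibly unbounded \<open>f\<close>, from the Dirac law at
      \<open>y\<close>: one \<open>e\<close> is the error inside the ball, the other is the
      allowance of the killing argument.\<close>
    have mF: "\<forall>\<^sub>F n in sequentially. \<bar>av (real n) f y - av (real n) f z\<bar> \<le> 2 * e" if e: "0 < e" for y e
    proof -
      obtain r where r: "0 < r" "\<And>x. x \<in> ball z r \<Longrightarrow> \<forall>\<^sub>F n in sequentially. \<bar>av (real n) f x - av (real n) f z\<bar> < e"
        using ec[OF f e] by blast
      obtain c where c: "0 < c" "\<And>\<nu>. subprob_space \<nu> \<Longrightarrow> sets \<nu> = sets borel \<Longrightarrow>
          \<exists>s\<ge>0. c * measure \<nu> UNIV \<le> measure (\<nu> \<bind> P s) (ball z r)"
        using uniform_hitting[OF m r(1) merge c2z] by blast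
      have "\<forall>\<^sub>F n in sequentially. \<bar>\<integral>w. av (real n) f w - av (real n) f z \<partial>return borel y\<bar> \<le> e + e"
      proof (rule av_merge_tail_bounded[OF ui[OF f] fm a _ _ _ c(1) c(2) tail_bounded_return[OF fm]])
        show "\<forall>\<^sub>F n in sequentially. \<bar>av (real n) f w - av (real n) f z\<bar> \<le> e" if "w \<in> ball z r" for w
          using r(2)[OF that] by (rule eventually_mono) simp
      qed (use e in auto)
      then show ?thesis by (simp add: integral_return)
    qed
    have p: "prob_space m" "sets m = sets borel" using m by (auto simp: invariant_def)
    interpret prob_space m by (rule p)
    have sp: "space m = UNIV" using sets_eq_imp_space_eq[OF p(2)] by simp
    \<comment> \<open>Now that \<open>f\<close> is integrable, invariance makes \<open>m\<close>
      itself a law with a tail bound, so merging can be integrated against \<open>m\<close> to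
      identify the limit at \<open>z\<close>.\<close>
    define \<kappa> where "\<kappa> K = (\<integral>\<^sup>+w. tail f K w \<partial>m)" for K
    have tb: "tail_bounded f \<kappa> m"
      unfolding tail_bounded_def \<kappa>_def using p
      by (auto simp: nn_integral_invariant[OF m] prob_space_imp_subprob_space)
    have \<kappa>: "(\<kappa> \<longlongrightarrow> 0) at_top"
    proof -
      have fin: "(\<integral>\<^sup>+w. ennreal \<bar>f w\<bar> \<partial>m) < \<infinity>" using int[OF m f] by (simp add: integrable_iff_bounded)
      note p(2) [measurable_cong]
      have lim: "(\<lambda>n. \<kappa> (real n)) \<longlonglongrightarrow> (\<integral>\<^sup>+w. 0 \<partial>m)"
        unfolding \<kappa>_def
      proof (rule nn_integral_dominated_convergence[where w="\<lambda>w. ennreal \<bar>f w\<bar>"])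
        show "AE w in m. tail f (real n) w \<le> ennreal \<bar>f w\<bar>" for n by (auto simp: tail_def split: split_indicator)
        show "AE w in m. (\<lambda>n. tail f (real n) w) \<longlonglongrightarrow> 0"
        proof (rule AE_I2)
          fix w
          obtain N where "\<bar>f w\<bar> < real N" using reals_Archimedean2 by blast
          then have "\<forall>\<^sub>F n in sequentially. tail f (real n) w = 0"
            by (intro eventually_sequentiallyI[of N]) (auto simp: tail_def split: split_indicator)
          then show "(\<lambda>n. tail f (real n) w) \<longlonglongrightarrow> 0" by (rule tendsto_eventually)
        qed
      qed (use fin in auto)
      show ?thesis
      proof (rule order_tendstoI)
        fix b :: ennreal assume "0 < b"
        with lim have "\<forall>\<^sub>F n in sequentially. \<kappa> (real n) < b" by (auto intro: order_tendstoD)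
        then obtain n where n: "\<kappa> (real n) < b" by (auto simp: eventually_sequentially)
        show "\<forall>\<^sub>F K in at_top. \<kappa> K < b"
        proof (rule eventually_mono[OF eventually_ge_at_top[of "real n"]])
          fix K assume "real n \<le> K"
          then have "\<kappa> K \<le> \<kappa> (real n)" unfolding \<kappa>_def
            by (intro nn_integral_mono) (auto simp: tail_def split: split_indicator)
          then show "\<kappa> K < b" using n by (rule le_less_trans)
        qed
      qed simp
    qed
    have ai: "integrable m (av (real n) f)" "(\<integral>y. av (real n) f y \<partial>m) = (\<integral>y. f y \<partial>m)" if "0 < n" for n
      using that integrable_av_invariant[OF m _ fm int[OF m f], of "real n"]
        integral_av_invariant[OF m _ fm int[OF m f], of "real n"] by auto
    have limz: "(\<lambda>n. av (real n) f z) \<longlonglongrightarrow> (\<integral>y. f y \<partial>m)"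
    proof (rule LIMSEQ_I)
      fix e :: real assume e: "0 < e"
      have "\<forall>\<^sub>F n in sequentially. (\<integral>y. \<bar>av (real n) f y - av (real n) f z\<bar> * indicator UNIV y \<partial>m) \<le> 2 * (e / 4) * measure m UNIV + e / 4"
        by (rule av_diff_restrict_small[OF tb \<kappa> fm a]) (use mF[of "e / 4"] e in auto)
      then have "\<forall>\<^sub>F n in sequentially. norm (av (real n) f z - (\<integral>y. f y \<partial>m)) < e"
        using eventually_gt_at_top[of 0]
      proof eventually_elim
        case (elim n)
        have "(\<integral>y. f y \<partial>m) - av (real n) f z = (\<integral>y. av (real n) f y - av (real n) f z \<partial>m)"
          using ai[OF elim(2)] prob_space by simp
        also have "\<bar>\<dots>\<bar> \<le> (\<integral>y. \<bar>av (real n) f y - av (real n) f z\<bar> \<partial>m)" by (rule integral_abs_bound)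
        also have "\<dots> \<le> 2 * (e / 4) + e / 4" using elim(1) prob_space sp by simp
        finally show ?case using e by (simp add: abs_minus_commute)
      qed
      then show "\<exists>N. \<forall>n\<ge>N. norm (av (real n) f z - (\<integral>y. f y \<partial>m)) < e"
        by (simp add: eventually_sequentially)
    qed
    have "(\<lambda>n. av (real n) f x - av (real n) f z) \<longlonglongrightarrow> 0"
    proof (rule LIMSEQ_I)
      fix e :: real assume e: "0 < e"
      have "\<forall>\<^sub>F n in sequentially. norm (av (real n) f x - av (real n) f z - 0) < e"
        using mF[of "e / 4" x] e by (auto elim: eventually_mono)
      then show "\<exists>N. \<forall>n\<ge>N. norm (av (real n) f x - av (real n) f z - 0) < e"
        by (simp add: eventually_sequentially)
    qed
    from tendsto_add[OF this limz] have limx: "(\<lambda>n. av (real n) f x) \<longlonglongrightarrow> (\<integral>y. f y \<partial>m)" by simp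
    obtain C where C: "0 \<le> C" "\<And>r. 0 \<le> r \<Longrightarrow> \<bar>\<integral>w. f w \<partial>P r x\<bar> \<le> C"
      using tail_bounded_return_const[OF fm ui[OF f], of x] by blast
    show ?thesis by (rule av_tendsto_real[OF fm C(2) limx])
  qed
qed

text \<open>For \<open>z\<close> in the support of \<open>m\<close>, the averages of a bump at
  \<open>z\<close> tend to a positive mean from every point. The bound then holds for all large
  times, which is stronger than one on the upper limit.\<close>

lemma lower_bound_of_mean_ergodic:
  assumes m: "invariant m"
    and lim: "\<And>f x. f \<in> bounded_lipschitz \<Longrightarrow> ((\<lambda>t. av t f x) \<longlongrightarrow> (\<integral>y. f y \<partial>m)) at_top"
  shows "\<exists>z. \<forall>r>0. \<exists>c>0. \<forall>x. \<forall>\<^sub>F t in at_top. c \<le> av t (indicator (ball z r)) x"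
proof -
  have p: "prob_space m" "sets m = sets borel" using m by (auto simp: invariant_def)
  interpret prob_space m by (rule p)
  note p(2) [measurable_cong]
  obtain z where z: "\<And>r. 0 < r \<Longrightarrow> 0 < measure m (ball z r)" using exists_support_point[OF p] by blast
  have "\<exists>c>0. \<forall>x. \<forall>\<^sub>F t in at_top. c \<le> av t (indicator (ball z r)) x" if r: "0 < r" for r
  proof -
    define g where "g = bump (ball z (r / 2)) (r / 2)"
    have gbl: "g \<in> bounded_lipschitz" unfolding g_def using r by (intro bump_bounded_lipschitz) simp
    have gm [measurable]: "g \<in> borel_measurable borel" by (rule bounded_lipschitz_measurable[OF gbl])
    have g01: "0 \<le> g y" "g y \<le> 1" "\<bar>g y\<bar> \<le> 1" for y using r by (auto simp: g_def)
    have gball: "g y \<le> indicator (ball z r) y" for y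
      unfolding g_def using r by (rule bump_ball_le_indicator)
    have "0 < measure m (ball z (r / 2))" using z r by simp
    also have "measure m (ball z (r / 2)) = (\<integral>y. indicator (ball z (r / 2)) y \<partial>m)"
      using sets_eq_imp_space_eq[OF p(2)] by simp
    also have "\<dots> \<le> (\<integral>y. g y \<partial>m)"
    proof (rule integral_mono)
      show "integrable m (indicat_real (ball z (r / 2)))"
        by (rule integrable_bounded[where C=1]) (auto intro!: borel_measurable_indicator split: split_indicator)
      show "integrable m g" by (rule integrable_bounded[OF _ g01(3)]) measurable
      show "indicator (ball z (r / 2)) y \<le> g y" for y
        using g01(1)[of y] by (cases "y \<in> ball z (r / 2)") (auto simp: g_def)
    qed
    finally have b: "0 < (\<integral>y. g y \<partial>m)" .
    show ?thesis
    proof (rule exI[of _ "(\<integral>y. g y \<partial>m) / 2"], intro conjI allI)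
      show "0 < (\<integral>y. g y \<partial>m) / 2" using b by simp
      fix x
      have "\<forall>\<^sub>F t in at_top. (\<integral>y. g y \<partial>m) / 2 < av t g x"
        using lim[OF gbl, of x] b by (intro order_tendstoD) auto
      then show "\<forall>\<^sub>F t in at_top. (\<integral>y. g y \<partial>m) / 2 \<le> av t (indicator (ball z r)) x"
        using eventually_gt_at_top[of 0]
      proof eventually_elim
        case (elim t)
        have "av t g x \<le> av t (indicator (ball z r)) x"
          by (rule av_mono[where C=1 and D=1])
            (use elim g01 gball in \<open>auto intro!: borel_measurable_indicator split: split_indicator\<close>)
        then show ?case using elim by linarith
      qed
    qed
  qed
  then show ?thesis by blast
qed

end

section \<open>The equivalence\<close>

text \<open>Joint measurability is where right-continuity of the paths enters: at a fixed time the
  Feller property gives continuity in the state, and general times are approached from the right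
  along a grid.\<close>

lemma cadlag_feller_markov_semigroup:
  fixes Phi :: "real \<Rightarrow> 'w \<Rightarrow> 'a::polish_space"
  assumes X: "cadlag_feller_markov M Pr Phi"
  shows "feller_semigroup (\<lambda>s. Pk Pr Phi (max 0 s))"
proof -
  have prob: "prob_space (Pr x)" and sets: "sets (Pr x) = sets M" for x
    using X by (auto simp: cadlag_feller_markov_def)
  have Phi [measurable]: "Phi t \<in> M \<rightarrow>\<^sub>M borel" if "0 \<le> t" for t
    using X that by (auto simp: cadlag_feller_markov_def)
  have ker: "(\<lambda>y. emeasure (Pk Pr Phi t y) B) \<in> borel_measurable borel" if "0 \<le> t" "B \<in> sets borel" for t B
    using X that unfolding cadlag_feller_markov_def by blast
  have markov: "emeasure (Pr x) ({\<omega>\<in>space M. Phi (s + t) \<omega> \<in> B} \<inter> A)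
      = (\<integral>\<^sup>+\<omega>. emeasure (Pk Pr Phi t (Phi s \<omega>)) B * indicator A \<omega> \<partial>Pr x)"
    if "0 \<le> s" "0 \<le> t" "A \<in> nat_filt M Phi s" "B \<in> sets borel" for x s t A B
    using X that unfolding cadlag_feller_markov_def by blast
  have feller: "continuous_on UNIV (\<lambda>y. \<integral>w. f w \<partial>Pk Pr Phi t y)"
    if "0 \<le> t" "continuous_on UNIV f" "bounded (range f)" for t and f :: "'a \<Rightarrow> real"
    using X that unfolding cadlag_feller_markov_def by blast
  have right: "continuous (at_right t) (\<lambda>s. Phi s \<omega>)" if "\<omega> \<in> space M" "0 \<le> t" for t \<omega>
    using X that unfolding cadlag_feller_markov_def by blast
  have Phi' [measurable]: "Phi t \<in> Pr x \<rightarrow>\<^sub>M borel" if "0 \<le> t" for t x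
    using Phi[OF that] by (subst measurable_cong_sets[OF sets refl])
  have sp: "space (Pr x) = space M" for x by (rule sets_eq_imp_space_eq[OF sets])
  have PkP: "prob_space (Pk Pr Phi t x)" if "0 \<le> t" for t x
    unfolding Pk_def by (rule prob_space.prob_space_distr[OF prob Phi'[OF that]])
  have Pks: "sets (Pk Pr Phi t x) = sets borel" for t x by (simp add: Pk_def)
  have int_meas: "(\<lambda>(s, y). \<integral>w. f w \<partial>Pk Pr Phi (max 0 s) y) \<in> borel_measurable (borel \<Otimes>\<^sub>M borel)"
    if f: "continuous_on UNIV f" "\<And>w. \<bar>f w\<bar> \<le> C" for f :: "'a \<Rightarrow> real" and C
  proof (rule borel_measurable_LIMSEQ_real)
    \<comment> \<open>\<open>\<tau> n (k n s)\<close> is the first multiple of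
      \<open>1 / real (Suc n)\<close> strictly beyond \<open>max 0 s\<close>. Strictness, due to the
      \<open>Suc j\<close>, is what convergence in \<open>at_right\<close> requires.\<close>
    define k where "k n s = nat \<lfloor>max 0 s * real (Suc n)\<rfloor>" for n and s :: real
    define \<tau> where "\<tau> n j = real (Suc j) / real (Suc n)" for n j
    have bf: "bounded (range f)" using f(2) by (auto simp: bounded_iff)
    have fm [measurable]: "f \<in> borel_measurable borel" by (rule borel_measurable_continuous_onI[OF f(1)])
    show "(\<lambda>p. \<integral>w. f w \<partial>Pk Pr Phi (\<tau> n (k n (fst p))) (snd p)) \<in> borel_measurable (borel \<Otimes>\<^sub>M borel)" for n
    proof (rule measurable_compose_countable)
      fix j
      have "(\<lambda>y. \<integral>w. f w \<partial>Pk Pr Phi (\<tau> n j) y) \<in> borel_measurable borel"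
        by (intro borel_measurable_continuous_onI feller f(1) bf) (simp add: \<tau>_def)
      then show "(\<lambda>p. \<integral>w. f w \<partial>Pk Pr Phi (\<tau> n j) (snd p)) \<in> borel_measurable (borel \<Otimes>\<^sub>M borel)"
        by (rule measurable_compose[OF measurable_snd])
    next
      show "(\<lambda>p. k n (fst p)) \<in> (borel :: real measure) \<Otimes>\<^sub>M (borel :: 'a measure) \<rightarrow>\<^sub>M count_space UNIV"
        unfolding k_def by measurable
    qed
    fix p :: "real \<times> 'a"
    obtain s y where p: "p = (s, y)" by (cases p)
    define s' where "s' = max 0 s"
    have s': "0 \<le> s'" by (simp add: s'_def)
    have lt: "s' < \<tau> n (k n s)" "\<tau> n (k n s) \<le> s' + 1 / real (Suc n)" for n
    proof -
      have "real (k n s) \<le> s' * real (Suc n)" "s' * real (Suc n) < real (k n s) + 1"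
        unfolding k_def s'_def by (auto simp: of_nat_nat)
      moreover have "s' + 1 / real (Suc n) = (s' * real (Suc n) + 1) / real (Suc n)"
        by (simp add: add_divide_distrib)
      ultimately show "s' < \<tau> n (k n s)" "\<tau> n (k n s) \<le> s' + 1 / real (Suc n)"
        unfolding \<tau>_def by (simp_all add: pos_less_divide_eq divide_right_mono)
    qed
    have "(\<lambda>n. \<tau> n (k n s)) \<longlonglongrightarrow> s'"
    proof (rule tendsto_sandwich[of "\<lambda>_. s'" _ _ "\<lambda>n. s' + 1 / real (Suc n)"])
      have "(\<lambda>n. s' + 1 / real (Suc n)) \<longlonglongrightarrow> s' + 0"
        by (intro tendsto_add tendsto_const LIMSEQ_Suc[OF lim_1_over_n])
      then show "(\<lambda>n. s' + 1 / real (Suc n)) \<longlonglongrightarrow> s'" by simp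
    qed (intro always_eventually allI less_imp_le[OF lt(1)] lt(2) tendsto_const)+
    then have fl: "filterlim (\<lambda>n. \<tau> n (k n s)) (at_right s') sequentially"
      using lt by (intro tendsto_imp_filterlim_at_right) auto
    have \<tau>0: "0 \<le> \<tau> n (k n s)" for n using lt(1)[of n] s' by simp
    have "(\<lambda>n. \<integral>\<omega>. f (Phi (\<tau> n (k n s)) \<omega>) \<partial>Pr y) \<longlonglongrightarrow> (\<integral>\<omega>. f (Phi s' \<omega>) \<partial>Pr y)"
    proof (rule integral_dominated_convergence[where w="\<lambda>_. C"])
      show "AE \<omega> in Pr y. (\<lambda>n. f (Phi (\<tau> n (k n s)) \<omega>)) \<longlonglongrightarrow> f (Phi s' \<omega>)"
      proof (rule AE_I2)
        fix \<omega> assume "\<omega> \<in> space (Pr y)"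
        then have "((\<lambda>u. Phi u \<omega>) \<longlongrightarrow> Phi s' \<omega>) (at_right s')"
          using right[OF _ s'] by (simp add: sp continuous_within)
        from filterlim_compose[OF this fl] have "(\<lambda>n. Phi (\<tau> n (k n s)) \<omega>) \<longlonglongrightarrow> Phi s' \<omega>" .
        moreover have "isCont f (Phi s' \<omega>)" using f(1) by (simp add: continuous_on_eq_continuous_at)
        ultimately show "(\<lambda>n. f (Phi (\<tau> n (k n s)) \<omega>)) \<longlonglongrightarrow> f (Phi s' \<omega>)"
          by (rule isCont_tendsto_compose[rotated])
      qed
      show "integrable (Pr y) (\<lambda>_. C)"
        by (rule finite_measure.integrable_const[OF prob_space.finite_measure[OF prob]])
    qed (use f(2) s' \<tau>0 in \<open>auto intro!: measurable_compose[OF Phi' fm]\<close>)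
    then show "(\<lambda>n. \<integral>w. f w \<partial>Pk Pr Phi (\<tau> n (k n (fst p))) (snd p))
        \<longlonglongrightarrow> (case p of (s, y) \<Rightarrow> \<integral>w. f w \<partial>Pk Pr Phi (max 0 s) y)"
      unfolding p Pk_def using \<tau>0 s' by (simp add: integral_distr[OF Phi' fm] s'_def)
  qed
  show ?thesis
  proof
    show "(\<lambda>(s, y). Pk Pr Phi (max 0 s) y) \<in> borel \<Otimes>\<^sub>M borel \<rightarrow>\<^sub>M prob_algebra borel"
    proof (rule measurable_prob_algebra_generated[where \<Omega>=UNIV and G="{C. closed C}"])
      show "sets borel = sigma_sets (UNIV :: 'a set) {C. closed C}" by (simp add: borel_eq_closed)
      show "Int_stable {C :: 'a set. closed C}" by (auto simp: Int_stable_def)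
      fix p :: "real \<times> 'a"
      show "prob_space (case p of (s, y) \<Rightarrow> Pk Pr Phi (max 0 s) y)"
        "sets (case p of (s, y) \<Rightarrow> Pk Pr Phi (max 0 s) y) = sets borel"
        by (cases p; simp add: PkP Pks)+
    next
      fix C :: "'a set" assume "C \<in> {C. closed C}"
      then have C: "closed C" by simp
      have "(\<lambda>(s, y). measure (Pk Pr Phi (max 0 s) y) C) \<in> borel_measurable (borel \<Otimes>\<^sub>M borel)"
      proof (cases "C = {}")
        case False
        show ?thesis
        proof (rule borel_measurable_LIMSEQ_real)
          show "(\<lambda>(s, y). \<integral>w. bump C (1 / real (Suc n)) w \<partial>Pk Pr Phi (max 0 s) y) \<in> borel_measurable (borel \<Otimes>\<^sub>M borel)" for n
            by (rule int_meas[where C=1]) (auto intro: continuous_bump)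
          fix p :: "real \<times> 'a"
          show "(\<lambda>n. case p of (s, y) \<Rightarrow> \<integral>w. bump C (1 / real (Suc n)) w \<partial>Pk Pr Phi (max 0 s) y)
              \<longlonglongrightarrow> (case p of (s, y) \<Rightarrow> measure (Pk Pr Phi (max 0 s) y) C)"
            using measure_closed_lim_bump[OF prob_space.finite_measure[OF PkP] Pks C False]
            by (cases p) simp
        qed
      qed simp
      then have "(\<lambda>p. ennreal (case p of (s, y) \<Rightarrow> measure (Pk Pr Phi (max 0 s) y) C)) \<in> borel_measurable (borel \<Otimes>\<^sub>M borel)"
        by measurable
      moreover have "emeasure (case p of (s, y) \<Rightarrow> Pk Pr Phi (max 0 s) y) C
          = ennreal (case p of (s, y) \<Rightarrow> measure (Pk Pr Phi (max 0 s) y) C)" for p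
        using finite_measure.emeasure_eq_measure[OF prob_space.finite_measure[OF PkP]] by (cases p) simp
      ultimately show "(\<lambda>p. emeasure (case p of (s, y) \<Rightarrow> Pk Pr Phi (max 0 s) y) C) \<in> borel_measurable (borel \<Otimes>\<^sub>M borel)"
        by simp
    qed auto
    show "Pk Pr Phi (max 0 (s + t)) x = Pk Pr Phi (max 0 s) x \<bind> Pk Pr Phi (max 0 t)" if st: "0 \<le> s" "0 \<le> t" for s t x
    proof -
      have km: "Pk Pr Phi t \<in> borel \<rightarrow>\<^sub>M subprob_algebra borel"
        using st ker by (intro measurable_subprob_algebra prob_space_imp_subprob_space PkP) (auto simp: Pks)
      have km': "Pk Pr Phi t \<in> Pk Pr Phi s x \<rightarrow>\<^sub>M subprob_algebra borel"
        using km by (subst measurable_cong_sets[OF Pks refl])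
      have ne: "space (Pk Pr Phi s x) \<noteq> {}" by (simp add: Pk_def)
      have "Pk Pr Phi (s + t) x = Pk Pr Phi s x \<bind> Pk Pr Phi t"
      proof (rule measure_eqI)
        show "sets (Pk Pr Phi (s + t) x) = sets (Pk Pr Phi s x \<bind> Pk Pr Phi t)"
          using sets_bind[where f="Pk Pr Phi t" and N=borel, OF Pks ne] by (simp add: Pks)
        fix B assume "B \<in> sets (Pk Pr Phi (s + t) x)"
        then have B: "B \<in> sets borel" by (simp add: Pks)
        \<comment> \<open>For the event \<open>space M\<close> the Markov property becomes the
          Chapman-Kolmogorov equation.\<close>
        have top: "space M \<in> nat_filt M Phi s" unfolding nat_filt_def by (rule sigma_sets_top)
        have "emeasure (Pk Pr Phi (s + t) x) B = emeasure (Pr x) ({\<omega>\<in>space M. Phi (s + t) \<omega> \<in> B} \<inter> space M)"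
          unfolding Pk_def using st B
          by (subst emeasure_distr[OF Phi']) (auto simp: sp intro!: arg_cong2[where f=emeasure])
        also have "\<dots> = (\<integral>\<^sup>+\<omega>. emeasure (Pk Pr Phi t (Phi s \<omega>)) B * indicator (space M) \<omega> \<partial>Pr x)"
          by (rule markov[OF st top B])
        also have "\<dots> = (\<integral>\<^sup>+\<omega>. emeasure (Pk Pr Phi t (Phi s \<omega>)) B \<partial>Pr x)"
          by (rule nn_integral_cong) (simp add: sp)
        also have "\<dots> = (\<integral>\<^sup>+y. emeasure (Pk Pr Phi t y) B \<partial>Pk Pr Phi s x)"
          unfolding Pk_def[of Pr Phi s] using ker[OF st(2) B] by (subst nn_integral_distr[OF Phi'[OF st(1)]]) auto
        also have "\<dots> = emeasure (Pk Pr Phi s x \<bind> Pk Pr Phi t) B"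
          by (rule emeasure_bind[OF ne km' B, symmetric])
        finally show "emeasure (Pk Pr Phi (s + t) x) B = emeasure (Pk Pr Phi s x \<bind> Pk Pr Phi t) B" .
      qed
      then show ?thesis using st by (simp add: max_absorb2)
    qed
    show "continuous_on UNIV (\<lambda>y. \<integral>w. f w \<partial>Pk Pr Phi (max 0 t) y)"
      if "0 \<le> t" "continuous_on UNIV f" "\<And>x. \<bar>f x\<bar> \<le> C" for t and f :: "'a \<Rightarrow> real" and C
    proof -
      have "bounded (range f)" using that(3) by (auto simp: bounded_iff)
      then show ?thesis using that by (intro feller) auto
    qed
  qed
qed

lemma frequently_of_less_Limsup:
  fixes c :: ereal
  assumes "c < Limsup F f"
  shows "\<exists>\<^sub>F x in F. c < f x"
proof (rule ccontr)
  assume "\<not> ?thesis"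
  then have "\<forall>\<^sub>F x in F. f x \<le> c" by (simp add: frequently_def not_less)
  then have "Limsup F f \<le> c" by (rule Limsup_bounded)
  then show False using assms by simp
qed

theorem mainTheorem2:
  fixes M :: "'w measure" and Pr :: "'a::polish_space \<Rightarrow> 'w measure"
    and Phi :: "real \<Rightarrow> 'w \<Rightarrow> 'a" and F :: "('a \<Rightarrow> real) set"
  assumes "cadlag_feller_markov M Pr Phi"
    and "\<forall>f\<in>F. f \<in> borel_measurable borel"
    and "bounded_lipschitz \<subseteq> F"
    and "hyp_H1 Pr Phi F"
  shows "(mean_ergodic Pr Phi F \<longleftrightarrow>
            (\<forall>x. cesaro_ev_cont_at Pr Phi F x) \<and> (\<exists>z. lower_bound_C2 Pr Phi z))
       \<and> (mean_ergodic Pr Phi F \<longleftrightarrow>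
            (\<exists>z. cesaro_ev_cont_at Pr Phi F z \<and> lower_bound_C2 Pr Phi z))"
proof -
  interpret feller_semigroup "\<lambda>s. Pk Pr Phi (max 0 s)"
    by (rule cadlag_feller_markov_semigroup[OF assms(1)])
  have av: "av t f x = Qtf Pr Phi t f x" for t f x
    unfolding av_def Qtf_def Ptf_def
    by (intro arg_cong2[where f="(/)"] set_lebesgue_integral_cong) (auto simp: max_absorb2)
  have inv: "invariant_prob Pr Phi m \<longleftrightarrow> invariant m" for m
  proof -
    have "(\<forall>t\<ge>0. \<forall>B\<in>sets borel. (\<integral>\<^sup>+x. emeasure (Pk Pr Phi t x) B \<partial>m) = emeasure m B)
        \<longleftrightarrow> (\<forall>t\<ge>0. m \<bind> Pk Pr Phi (max 0 t) = m)" if m: "prob_space m" "sets m = sets borel"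
    proof (intro all_cong1 imp_cong refl)
      fix t :: real assume t: "0 \<le> t"
      have "emeasure (m \<bind> Pk Pr Phi (max 0 t)) B = (\<integral>\<^sup>+x. emeasure (Pk Pr Phi t x) B \<partial>m)" if "B \<in> sets borel" for B
        using emeasure_bind[OF prob_space.not_empty[OF m(1)] P_meas_cong[OF m(2)] that, of t] t by (simp add: max_absorb2)
      moreover have "m \<bind> Pk Pr Phi (max 0 t) = m \<longleftrightarrow>
          (\<forall>B\<in>sets borel. emeasure (m \<bind> Pk Pr Phi (max 0 t)) B = emeasure m B)"
      proof
        assume *: "\<forall>B\<in>sets borel. emeasure (m \<bind> Pk Pr Phi (max 0 t)) B = emeasure m B"
        show "m \<bind> Pk Pr Phi (max 0 t) = m"
          by (rule measure_eqI) (use * m sets_bind_P[OF m(2), of t] in auto)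
      qed simp
      ultimately show "(\<forall>B\<in>sets borel. (\<integral>\<^sup>+x. emeasure (Pk Pr Phi t x) B \<partial>m) = emeasure m B)
          \<longleftrightarrow> m \<bind> Pk Pr Phi (max 0 t) = m" by auto
    qed
    then show ?thesis unfolding invariant_prob_def invariant_def by blast
  qed
  have ME: "mean_ergodic Pr Phi F \<longleftrightarrow> (\<exists>!m. invariant m) \<and> (\<forall>m. invariant m \<longrightarrow> (\<forall>f\<in>F. integrable m f) \<and>
      (\<forall>f\<in>F. \<forall>x. ((\<lambda>t. \<bar>av t f x - (\<integral>y. f y \<partial>m)\<bar>) \<longlongrightarrow> 0) at_top))"
    unfolding mean_ergodic_def inv av ..
  \<comment> \<open>Under mean ergodicity the averages from any two points have the same limit, so
    the inner upper limit vanishes for every pair.\<close>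
  have 1: "(\<forall>x. cesaro_ev_cont_at Pr Phi F x) \<and> (\<exists>z. lower_bound_C2 Pr Phi z)" if me: "mean_ergodic Pr Phi F"
  proof -
    obtain m where m: "invariant m" using me unfolding ME by blast
    have lim: "((\<lambda>t. av t f x) \<longlongrightarrow> (\<integral>y. f y \<partial>m)) at_top" if "f \<in> F" for f x
    proof -
      have "((\<lambda>t. \<bar>av t f x - (\<integral>y. f y \<partial>m)\<bar>) \<longlongrightarrow> 0) at_top" using me m that unfolding ME by blast
      then show ?thesis by (simp add: tendsto_rabs_zero_iff LIM_zero_iff)
    qed
    have "cesaro_ev_cont_at Pr Phi F x" for x
      unfolding cesaro_ev_cont_at_def
    proof
      fix f assume f: "f \<in> F"
      have "Limsup at_top (\<lambda>t. ereal \<bar>Qtf Pr Phi t f x' - Qtf Pr Phi t f x\<bar>) = 0" for x'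
      proof (rule lim_imp_Limsup)
        have "((\<lambda>t. \<bar>av t f x' - av t f x\<bar>) \<longlongrightarrow> \<bar>(\<integral>y. f y \<partial>m) - (\<integral>y. f y \<partial>m)\<bar>) at_top"
          by (intro tendsto_rabs tendsto_diff lim f)
        then have "((\<lambda>t. ereal \<bar>av t f x' - av t f x\<bar>) \<longlongrightarrow> ereal 0) at_top" by simp
        then show "((\<lambda>t. ereal \<bar>Qtf Pr Phi t f x' - Qtf Pr Phi t f x\<bar>) \<longlongrightarrow> 0) at_top"
          by (simp add: av zero_ereal_def)
      qed simp
      then show "Limsup (at x) (\<lambda>x'. Limsup at_top (\<lambda>t. ereal \<bar>Qtf Pr Phi t f x' - Qtf Pr Phi t f x\<bar>)) \<le> 0"
        by (intro Limsup_bounded) simp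
    qed
    moreover obtain z where z: "\<And>r. 0 < r \<Longrightarrow> \<exists>c>0. \<forall>x. \<forall>\<^sub>F t in at_top. c \<le> av t (indicator (ball z r)) x"
      using lower_bound_of_mean_ergodic[OF m lim] assms(3) by blast
    have "lower_bound_C2 Pr Phi z"
      unfolding lower_bound_C2_def
    proof (intro allI impI)
      fix r :: real assume "0 < r"
      from z[OF this] obtain c where c: "0 < c" "\<And>x. \<forall>\<^sub>F t in at_top. c \<le> av t (indicator (ball z r)) x" by blast
      have "ereal c \<le> (INF x. Limsup at_top (\<lambda>t. ereal (Qtf Pr Phi t (indicator (ball z r)) x)))"
      proof (rule INF_greatest)
        fix x
        show "ereal c \<le> Limsup at_top (\<lambda>t. ereal (Qtf Pr Phi t (indicator (ball z r)) x))"
          using c(2)[of x] by (intro le_Limsup) (auto simp: av)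
      qed
      moreover have "0 < ereal c" using c(1) by simp
      ultimately show "0 < (INF x. Limsup at_top (\<lambda>t. ereal (Qtf Pr Phi t (indicator (ball z r)) x)))"
        by (rule less_le_trans[rotated])
    qed
    ultimately show ?thesis by blast
  qed
  \<comment> \<open>This is the third statement implying the first; the second yields the third by
    specialising to \<open>z\<close>.\<close>
  have 2: "mean_ergodic Pr Phi F" if ec: "cesaro_ev_cont_at Pr Phi F z" and c2: "lower_bound_C2 Pr Phi z" for z
  proof -
    have Fm: "f \<in> borel_measurable borel" if "f \<in> F" for f using assms(2) that by blast
    have ui: "((\<lambda>K. SUP t\<in>{0..}. \<integral>\<^sup>+w. tail f K w \<partial>Pk Pr Phi (max 0 t) x) \<longlongrightarrow> 0) at_top" if f: "f \<in> F" for f x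
    proof -
      note Fm[OF f, measurable]
      have "(\<integral>\<^sup>+w. tail f K w \<partial>Pk Pr Phi (max 0 t) x)
          = (\<integral>\<^sup>+\<omega>. ennreal \<bar>f (Phi t \<omega>)\<bar> * indicator {\<omega>. \<bar>f (Phi t \<omega>)\<bar> \<ge> K} \<omega> \<partial>Pr x)" if t: "t \<in> {0..}" for K t
      proof -
        have "Phi t \<in> Pr x \<rightarrow>\<^sub>M borel"
          using assms(1) t measurable_cong_sets[of "Pr x" M borel borel] unfolding cadlag_feller_markov_def by auto
        then show ?thesis
          using t unfolding Pk_def by (simp add: max_absorb2 nn_integral_distr tail_def indicator_def)
      qed
      then show ?thesis using assms(4) f unfolding hyp_H1_def by simp
    qed
    have ec': "\<exists>r>0. \<forall>x\<in>ball z r. \<forall>\<^sub>F n in sequentially. \<bar>av (real n) f x - av (real n) f z\<bar> < e" if f: "f \<in> F" and e: "0 < e" for f e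
    proof -
      have "Limsup (at z) (\<lambda>x'. Limsup at_top (\<lambda>t. ereal \<bar>av t f x' - av t f z\<bar>)) < ereal e"
        using ec f e unfolding cesaro_ev_cont_at_def av by (auto intro: le_less_trans)
      then have "\<forall>\<^sub>F x' in at z. Limsup at_top (\<lambda>t. ereal \<bar>av t f x' - av t f z\<bar>) < ereal e" by (rule Limsup_lessD)
      then obtain r where r: "0 < r" "\<And>x. x \<noteq> z \<Longrightarrow> dist x z < r \<Longrightarrow> Limsup at_top (\<lambda>t. ereal \<bar>av t f x - av t f z\<bar>) < ereal e"
        unfolding eventually_at by auto
      have "\<forall>\<^sub>F n in sequentially. \<bar>av (real n) f x - av (real n) f z\<bar> < e" if x: "x \<in> ball z r" for x
      \<comment> \<open>The upper limit at \<open>z\<close> leaves out \<open>z\<close> itself,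
        where the difference is 0.\<close>
      proof (cases "x = z")
        case False
        then have "Limsup at_top (\<lambda>t. ereal \<bar>av t f x - av t f z\<bar>) < ereal e" using r(2) x by (simp add: dist_commute)
        then have "\<forall>\<^sub>F t in at_top. ereal \<bar>av t f x - av t f z\<bar> < ereal e" by (rule Limsup_lessD)
        then have "\<forall>\<^sub>F t in at_top. \<bar>av t f x - av t f z\<bar> < e" by simp
        then show ?thesis using filterlim_real_sequentially unfolding filterlim_iff by blast
      qed (use e in simp)
      then show ?thesis using r(1) by blast
    qed
    have c2': "\<exists>c>0. \<forall>x. \<exists>\<^sub>F t in at_top. c < av t (indicator (ball z r)) x" if r: "0 < r" for r
    proof -
      have "0 < (INF x. Limsup at_top (\<lambda>t. ereal (av t (indicator (ball z r)) x)))"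
        using c2 r unfolding lower_bound_C2_def av by blast
      \<comment> \<open>A real level strictly below the infimum: strictness turns each upper limit
        into a frequently strict inequality.\<close>
      then obtain c where c: "0 < ereal c" "ereal c < (INF x. Limsup at_top (\<lambda>t. ereal (av t (indicator (ball z r)) x)))"
        using ereal_dense2 by blast
      have "\<exists>\<^sub>F t in at_top. c < av t (indicator (ball z r)) x" for x
      proof -
        have "ereal c < Limsup at_top (\<lambda>t. ereal (av t (indicator (ball z r)) x))"
          using c(2) by (rule less_le_trans) (rule INF_lower, simp)
        from frequently_of_less_Limsup[OF this] show ?thesis by simp
      qed
      then show ?thesis using c(1) by auto
    qed
    note E = mean_ergodic_of_lower_bound[where F=F and z=z, OF Fm assms(3) ui ec' c2']
    show ?thesis
      unfolding ME
    proof (intro conjI allI impI ballI)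
      show "\<exists>!m. invariant m" by (rule E(1))
      fix m f assume m: "invariant m" and f: "f \<in> F"
      show "integrable m f" by (rule E(2)) (use m f in auto)
      fix x
      show "((\<lambda>t. \<bar>av t f x - (\<integral>y. f y \<partial>m)\<bar>) \<longlongrightarrow> 0) at_top"
        by (intro tendsto_rabs_zero LIM_zero, rule E(3)) (use m f in auto)
    qed
  qed
  show ?thesis using 1 2 by blast
qed

end
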